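(* Let $n\ge2$ and let $\Sigma$ be an $n$-dimensional Riemannian manifold with metric $g$. Then there exists a sequence $(\psi_\ell)$ of nonzero functions in $W^{1,n}_0(\Sigma)$ such that $\|\nabla^\Sigma\psi_\ell\|_{L^n(\Sigma)}\le1$ for all $\ell$ and $$\frac{1}{\|\psi_\ell\|^n_{L^n(\Sigma)}}\int_\Sigma\frac{\exp_n\left(n\,\omega_{n-1}^{\frac1{n-1}}|\psi_\ell|^{\frac n{n-1}}\right)}{(1+|\psi_\ell|)^q}\,d\mathcal H^n_g\xrightarrow{\ \ell\to\infty\ }\infty,\qquad\forall\,q<\frac n{n-1}.$$ Moreover, for all $\alpha>n\,\omega_{n-1}^{\frac1{n-1}}$ and $q\ge0$, $$\int_\Sigma\frac{\exp_n\left(\alpha|\psi_\ell|^{\frac n{n-1}}\right)}{(1+|\psi_\ell|)^q}\,d\mathcal H^n_g\xrightarrow{\ \ell\to\infty\ }\infty.$$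
   Context: $\exp_n(t)=e^t-\sum_{i=0}^{n-2}\frac{t^i}{i!}$. $\omega_{n-1}$ is the $(n-1)$-dimensional volume of the unit sphere $\mathbb S^{n-1}\subset\mathbb R^n$. $\mathcal H^n_g$ is the $n$-dimensional Hausdorff measure of $(\Sigma,g)$ (its Riemannian volume), with respect to which $L^n(\Sigma)$ norms are taken; $\nabla^\Sigma$ is the (weak) gradient on $\Sigma$. $W^{1,n}_0(\Sigma)$ is the closure of $C_0^\infty(\Sigma)$ (smooth functions with compact support in $\Sigma\setminus\partial\Sigma$) in $W^{1,n}(\Sigma)$ with respect to the norm $\|u\|_{L^n(\Sigma)}+\|\nabla^\Sigma u\|_{L^n(\Sigma)}$. *)

theory Defs
  imports "HOL-Analysis.Analysis"
begin

subsection \<open>Smooth functions\<close>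

fun Ck_on :: "nat \<Rightarrow> ('e::euclidean_space \<Rightarrow> 'f::real_normed_vector) \<Rightarrow> 'e set \<Rightarrow> bool" where
  "Ck_on 0 f U \<longleftrightarrow> continuous_on U f"
| "Ck_on (Suc k) f U \<longleftrightarrow>
     (\<forall>x\<in>U. f differentiable (at x)) \<and> (\<forall>v. Ck_on k (\<lambda>x. frechet_derivative f (at x) v) U)"

text \<open>On a set that need not be open, such as a relatively open subset of a half-space,
  smooth means: locally the restriction of a smooth function on an open set.\<close>

definition smooth_on :: "('e::euclidean_space \<Rightarrow> 'f::real_normed_vector) \<Rightarrow> 'e set \<Rightarrow> bool" where
  "smooth_on f S \<longleftrightarrow>
     (\<forall>x\<in>S. \<exists>U F. open U \<and> x \<in> U \<and> (\<forall>k. Ck_on k F U) \<and> (\<forall>y\<in>S \<inter> U. F y = f y))"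

definition test_function :: "('e::euclidean_space) set \<Rightarrow> ('e \<Rightarrow> real) \<Rightarrow> bool" where
  "test_function \<Omega> \<eta> \<longleftrightarrow>
     smooth_on \<eta> UNIV \<and> compact (closure {x. \<eta> x \<noteq> 0}) \<and> closure {x. \<eta> x \<noteq> 0} \<subseteq> \<Omega>"


subsection \<open>Smooth manifolds, possibly with boundary\<close>

text \<open>A chart is a pair of a domain and a coordinate map; the values of the coordinate map
  outside the domain play no role. The image of the domain is relatively open
  in the whole space or in a closed coordinate half-space.\<close>

type_synonym ('a, 'n) chart = "'a set \<times> ('a \<Rightarrow> real^'n)"

abbreviation chart_dom :: "('a, 'n::finite) chart \<Rightarrow> 'a set" where
  "chart_dom c \<equiv> fst c"

abbreviation coord :: "('a, 'n::finite) chart \<Rightarrow> 'a \<Rightarrow> real^'n" where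
  "coord c \<equiv> snd c"

definition chart_img :: "('a, 'n::finite) chart \<Rightarrow> (real^'n) set" where
  "chart_img c = coord c ` chart_dom c"

definition coord_inv :: "('a, 'n::finite) chart \<Rightarrow> real^'n \<Rightarrow> 'a" where
  "coord_inv c = inv_into (chart_dom c) (coord c)"

definition transition :: "('a, 'n::finite) chart \<Rightarrow> ('a, 'n) chart \<Rightarrow> real^'n \<Rightarrow> real^'n" where
  "transition c d = coord d \<circ> coord_inv c"

definition model_space :: "(real^'n::finite) set \<Rightarrow> bool" where
  "model_space H \<longleftrightarrow> H = UNIV \<or> (\<exists>k. H = {x. 0 \<le> x $ k})"

definition is_chart :: "'a topology \<Rightarrow> ('a, 'n::finite) chart \<Rightarrow> bool" where
  "is_chart X c \<longleftrightarrow>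
     openin X (chart_dom c) \<and>
     homeomorphic_map (subtopology X (chart_dom c)) (top_of_set (chart_img c)) (coord c) \<and>
     (\<exists>H. model_space H \<and> openin (top_of_set H) (chart_img c))"

locale smooth_manifold =
  fixes X :: "'a topology" and A :: "('a, 'n::finite) chart set"
  assumes nonempty: "topspace X \<noteq> {}"
    and Hausdorff: "Hausdorff_space X"
    and second_countable: "second_countable X"
    and charts: "c \<in> A \<Longrightarrow> is_chart X c"
    and cover: "(\<Union>c\<in>A. chart_dom c) = topspace X"
    and compatible: "c \<in> A \<Longrightarrow> d \<in> A \<Longrightarrow>
      smooth_on (transition c d) (coord c ` (chart_dom c \<inter> chart_dom d))"

text \<open>The complement of the boundary.\<close>

definition manifold_interior :: "('a, 'n::finite) chart set \<Rightarrow> 'a set" where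
  "manifold_interior A = {p. \<exists>c\<in>A. p \<in> chart_dom c \<and> coord c p \<in> interior (chart_img c)}"

text \<open>Smooth functions with compact support in the complement of the boundary.\<close>

definition C0_inf :: "'a topology \<Rightarrow> ('a, 'n::finite) chart set \<Rightarrow> ('a \<Rightarrow> real) set" where
  "C0_inf X A =
     {f. (\<forall>c\<in>A. smooth_on (f \<circ> coord_inv c) (chart_img c)) \<and>
         compactin X (X closure_of {p \<in> topspace X. f p \<noteq> 0}) \<and>
         X closure_of {p \<in> topspace X. f p \<noteq> 0} \<subseteq> manifold_interior A}"


subsection \<open>Riemannian metrics\<close>

text \<open>\<open>g c p\<close> is the matrix, in the chart \<open>c\<close>, of the inner product on the tangent space
  at \<open>p\<close>; the last axiom is the transformation law of covariant 2-tensors. The derivative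
  \<open>J\<close> of a transition map exists and is unique also at boundary points.\<close>

locale riemannian_manifold = smooth_manifold X A
  for X :: "'a topology" and A :: "('a, 'n::finite) chart set" +
  fixes g :: "('a, 'n) chart \<Rightarrow> 'a \<Rightarrow> real^'n^'n"
  assumes symmetric: "c \<in> A \<Longrightarrow> p \<in> chart_dom c \<Longrightarrow> transpose (g c p) = g c p"
    and positive: "c \<in> A \<Longrightarrow> p \<in> chart_dom c \<Longrightarrow> v \<noteq> 0 \<Longrightarrow> 0 < v \<bullet> (g c p *v v)"
    and smooth: "c \<in> A \<Longrightarrow> smooth_on (g c \<circ> coord_inv c) (chart_img c)"
    and transform: "c \<in> A \<Longrightarrow> d \<in> A \<Longrightarrow> p \<in> chart_dom c \<inter> chart_dom d \<Longrightarrow>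
      (transition c d has_derivative J)
        (at (coord c p) within coord c ` (chart_dom c \<inter> chart_dom d)) \<Longrightarrow>
      v \<bullet> (g c p *v w) = J v \<bullet> (g d p *v J w)"

definition borel_on :: "'a topology \<Rightarrow> 'a measure" where
  "borel_on X = sigma (topspace X) {U. openin X U}"

text \<open>The unique Borel measure given by \<open>sqrt (det g) dx\<close> in every chart.\<close>

definition riemannian_volume ::
  "'a topology \<Rightarrow> ('a, 'n::finite) chart set \<Rightarrow> (('a, 'n) chart \<Rightarrow> 'a \<Rightarrow> real^'n^'n) \<Rightarrow> 'a measure"
where
  "riemannian_volume X A g =
     (THE \<mu>. sets \<mu> = sets (borel_on X) \<and>
        (\<forall>c\<in>A. \<forall>E\<in>sets (borel_on X). E \<subseteq> chart_dom c \<longrightarrow>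
           emeasure \<mu> E =
             (\<integral>\<^sup>+x. ennreal (sqrt (det (g c (coord_inv c x)))) * indicator (coord c ` E) x \<partial>lborel)))"

text \<open>A (Borel) vector field is given by its components in each chart.\<close>

definition vector_field ::
  "'a topology \<Rightarrow> ('a, 'n::finite) chart set \<Rightarrow> (('a, 'n) chart \<Rightarrow> 'a \<Rightarrow> real^'n) \<Rightarrow> bool"
where
  "vector_field X A V \<longleftrightarrow>
     (\<forall>c\<in>A. V c \<in> borel_measurable (restrict_space (borel_on X) (chart_dom c))) \<and>
     (\<forall>c\<in>A. \<forall>d\<in>A. \<forall>p\<in>chart_dom c \<inter> chart_dom d. \<forall>J.
        (transition c d has_derivative J)
          (at (coord c p) within coord c ` (chart_dom c \<inter> chart_dom d)) \<longrightarrow>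
        V d p = J (V c p))"

text \<open>The pointwise length of a vector field; it does not depend on the choice of the chart.\<close>

definition vf_norm ::
  "('a, 'n::finite) chart set \<Rightarrow> (('a, 'n) chart \<Rightarrow> 'a \<Rightarrow> real^'n^'n) \<Rightarrow>
   (('a, 'n) chart \<Rightarrow> 'a \<Rightarrow> real^'n) \<Rightarrow> 'a \<Rightarrow> real"
where
  "vf_norm A g V p =
     (let c = (SOME c. c \<in> A \<and> p \<in> chart_dom c) in sqrt (V c p \<bullet> (g c p *v V c p)))"


subsection \<open>Weak gradients and Sobolev spaces\<close>

text \<open>\<open>V\<close> is a weak gradient of \<open>u\<close> if in every chart the covector field \<open>g V\<close> has as
  components the weak partial derivatives of \<open>u\<close>. It is determined up to null sets, so it
  is treated as a relation.\<close>

definition has_weak_gradient ::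
  "'a topology \<Rightarrow> ('a, 'n::finite) chart set \<Rightarrow> (('a, 'n) chart \<Rightarrow> 'a \<Rightarrow> real^'n^'n) \<Rightarrow>
   ('a \<Rightarrow> real) \<Rightarrow> (('a, 'n) chart \<Rightarrow> 'a \<Rightarrow> real^'n) \<Rightarrow> bool"
where
  "has_weak_gradient X A g u V \<longleftrightarrow>
     u \<in> borel_measurable (borel_on X) \<and> vector_field X A V \<and>
     (\<forall>c\<in>A.
        let \<Omega> = interior (chart_img c);
            u' = (\<lambda>x. u (coord_inv c x));
            du = (\<lambda>x. g c (coord_inv c x) *v V c (coord_inv c x))
        in (\<forall>K. compact K \<and> K \<subseteq> \<Omega> \<longrightarrow> set_integrable lborel K u' \<and> set_integrable lborel K du) \<and>
           (\<forall>\<eta> i. test_function \<Omega> \<eta> \<longrightarrow>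
              (LINT x:\<Omega>|lborel. u' x * frechet_derivative \<eta> (at x) (axis i 1)) =
              - (LINT x:\<Omega>|lborel. du x $ i * \<eta> x)))"

definition Lp_space :: "nat \<Rightarrow> 'a measure \<Rightarrow> ('a \<Rightarrow> real) set" where
  "Lp_space p M = {f \<in> borel_measurable M. integrable M (\<lambda>x. \<bar>f x\<bar> ^ p)}"

definition Lp_norm :: "nat \<Rightarrow> 'a measure \<Rightarrow> ('a \<Rightarrow> real) \<Rightarrow> real" where
  "Lp_norm p M f = root p (\<integral>x. \<bar>f x\<bar> ^ p \<partial>M)"

text \<open>\<open>u\<close> belongs to \<open>W\<^sup>1\<^sup>,\<^sup>n\<close>, where \<open>n\<close> is the dimension, and its weak gradient is \<open>V\<close>.\<close>

definition has_W1n_gradient ::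
  "'a topology \<Rightarrow> ('a, 'n::finite) chart set \<Rightarrow> (('a, 'n) chart \<Rightarrow> 'a \<Rightarrow> real^'n^'n) \<Rightarrow>
   ('a \<Rightarrow> real) \<Rightarrow> (('a, 'n) chart \<Rightarrow> 'a \<Rightarrow> real^'n) \<Rightarrow> bool"
where
  "has_W1n_gradient X A g u V \<longleftrightarrow>
     has_weak_gradient X A g u V \<and>
     u \<in> Lp_space CARD('n) (riemannian_volume X A g) \<and>
     vf_norm A g V \<in> Lp_space CARD('n) (riemannian_volume X A g)"

definition W1n ::
  "'a topology \<Rightarrow> ('a, 'n::finite) chart set \<Rightarrow> (('a, 'n) chart \<Rightarrow> 'a \<Rightarrow> real^'n^'n) \<Rightarrow>
   ('a \<Rightarrow> real) set"
where
  "W1n X A g = {u. \<exists>V. has_W1n_gradient X A g u V}"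

definition W1n_0 ::
  "'a topology \<Rightarrow> ('a, 'n::finite) chart set \<Rightarrow> (('a, 'n) chart \<Rightarrow> 'a \<Rightarrow> real^'n^'n) \<Rightarrow>
   ('a \<Rightarrow> real) set"
where
  "W1n_0 X A g =
     {u \<in> W1n X A g. \<forall>\<epsilon>>0. \<exists>f\<in>C0_inf X A. \<exists>V.
        has_W1n_gradient X A g (\<lambda>p. u p - f p) V \<and>
        Lp_norm CARD('n) (riemannian_volume X A g) (\<lambda>p. u p - f p) +
        Lp_norm CARD('n) (riemannian_volume X A g) (vf_norm A g V) < \<epsilon>}"


subsection \<open>The constant and the nonlinearity\<close>

text \<open>The \<open>(n-1)\<close>-dimensional volume of a compact smooth hypersurface, as its Minkowski content.\<close>

definition hypersurface_volume :: "('e::euclidean_space) set \<Rightarrow> real" where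
  "hypersurface_volume S =
     Lim (at_right 0) (\<lambda>\<epsilon>. measure lborel (\<Union>x\<in>S. ball x \<epsilon>) / (2 * \<epsilon>))"

definition sphere_volume :: "'n::finite itself \<Rightarrow> real" where
  "sphere_volume _ = hypersurface_volume (sphere 0 1 :: (real^'n) set)"

lemma sphere_volume_eq:
  assumes "2 \<le> CARD('n::finite)"
  shows "sphere_volume TYPE('n) = CARD('n) * unit_ball_vol CARD('n)"
proof -
  let ?n = "CARD('n)" and ?b = "unit_ball_vol (real CARD('n))"
  have nbhd: "(\<Union>x\<in>sphere 0 1. ball x \<epsilon>) = ball 0 (1 + \<epsilon>) - cball (0 :: real^'n) (1 - \<epsilon>)"
    if e: "0 < \<epsilon>" "\<epsilon> < 1" for \<epsilon>
  proof (intro equalityI subsetI)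
    fix y :: "real^'n" assume "y \<in> (\<Union>x\<in>sphere 0 1. ball x \<epsilon>)"
    then obtain x :: "real^'n" where x: "norm x = 1" "dist x y < \<epsilon>" by auto
    then have "norm (x - y) < \<epsilon>" by (simp add: dist_norm)
    with x show "y \<in> ball 0 (1 + \<epsilon>) - cball 0 (1 - \<epsilon>)"
      using norm_triangle_ineq2[of x y] norm_triangle_ineq2[of y x]
      by (auto simp: norm_minus_commute)
  next
    fix y :: "real^'n" assume y: "y \<in> ball 0 (1 + \<epsilon>) - cball 0 (1 - \<epsilon>)"
    then have n: "1 - \<epsilon> < norm y" "norm y < 1 + \<epsilon>" by auto
    with e have "norm y > 0" by linarith
    let ?x = "y /\<^sub>R norm y"
    have "?x - y = (inverse (norm y) - 1) *\<^sub>R y" by (simp add: algebra_simps)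
    then have "norm (?x - y) = \<bar>inverse (norm y) - 1\<bar> * norm y" by simp
    also have "\<dots> = \<bar>(inverse (norm y) - 1) * norm y\<bar>" by (simp add: abs_mult)
    also have "\<dots> = \<bar>1 - norm y\<bar>" using \<open>norm y > 0\<close> by (simp add: algebra_simps)
    also have "\<dots> < \<epsilon>" using n by linarith
    finally have "y \<in> ball ?x \<epsilon>" by (simp add: dist_norm)
    moreover have "?x \<in> sphere 0 1" using \<open>norm y > 0\<close> by simp
    ultimately show "y \<in> (\<Union>x\<in>sphere 0 1. ball x \<epsilon>)" by blast
  qed
  have meas: "measure lborel (\<Union>x\<in>sphere (0 :: real^'n) 1. ball x \<epsilon>) =
      ?b * (1 + \<epsilon>) ^ ?n - ?b * (1 - \<epsilon>) ^ ?n" if e: "0 < \<epsilon>" "\<epsilon> < 1" for \<epsilon>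
  proof -
    have "measure lborel (ball 0 (1 + \<epsilon>) - cball (0 :: real^'n) (1 - \<epsilon>)) =
        measure lborel (ball (0 :: real^'n) (1 + \<epsilon>)) - measure lborel (cball (0 :: real^'n) (1 - \<epsilon>))"
    proof (rule measure_Diff)
      show "emeasure lborel (ball (0 :: real^'n) (1 + \<epsilon>)) \<noteq> \<infinity>"
        using e by (simp add: emeasure_ball)
    qed (use e in auto)
    then show ?thesis
      using e nbhd[OF e] content_ball[of "1 + \<epsilon>" "0 :: real^'n"]
        content_cball[of "1 - \<epsilon>" "0 :: real^'n"]
      by simp
  qed
  have "((\<lambda>x. ?b * (1 + x) ^ ?n - ?b * (1 - x) ^ ?n) has_real_derivative 2 * (?n * ?b)) (at 0)"
    by (auto intro!: derivative_eq_intros)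
  then have "((\<lambda>x. (?b * (1 + x) ^ ?n - ?b * (1 - x) ^ ?n) / x) \<longlongrightarrow> 2 * (?n * ?b)) (at 0)"
    by (simp add: DERIV_def)
  then have "((\<lambda>x. (?b * (1 + x) ^ ?n - ?b * (1 - x) ^ ?n) / x) \<longlongrightarrow> 2 * (?n * ?b)) (at_right 0)"
    by (rule filterlim_mono[OF _ order_refl at_le]) simp
  then have "((\<lambda>x. (?b * (1 + x) ^ ?n - ?b * (1 - x) ^ ?n) / x / 2) \<longlongrightarrow> 2 * (?n * ?b) / 2) (at_right 0)"
    by (intro tendsto_intros) simp_all
  moreover have "\<forall>\<^sub>F \<epsilon> in at_right 0. (?b * (1 + \<epsilon>) ^ ?n - ?b * (1 - \<epsilon>) ^ ?n) / \<epsilon> / 2 =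
      measure lborel (\<Union>x\<in>sphere (0 :: real^'n) 1. ball x \<epsilon>) / (2 * \<epsilon>)"
    unfolding eventually_at_right_field by (rule exI[of _ 1]) (simp add: meas mult.commute)
  ultimately have "((\<lambda>\<epsilon>. measure lborel (\<Union>x\<in>sphere (0 :: real^'n) 1. ball x \<epsilon>) / (2 * \<epsilon>))
      \<longlongrightarrow> ?n * ?b) (at_right 0)"
    using tendsto_cong by fastforce
  then show ?thesis
    unfolding sphere_volume_def hypersurface_volume_def
    by (rule tendsto_Lim[rotated]) simp
qed

text \<open>The exponential without the terms of degree at most \<open>n - 2\<close>, for \<open>n \<ge> 2\<close>.\<close>

definition exp_n :: "nat \<Rightarrow> real \<Rightarrow> real" where
  "exp_n n t = exp t - (\<Sum>i\<le>n - 2. t ^ i / fact i)"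

end

theory Submission
  imports Defs "HOL-Real_Asymp.Real_Asymp"
begin

text \<open>
The functions are a smooth version of Moser's concentrating sequence. Fix a chart, a point in the
interior of its image and linear coordinates \<open>y\<close> centered there in which the metric at the point is
the identity. With \<open>r = norm y\<close>, a small \<open>\<delta>\<close> and a large \<open>L\<close>, consider \<open>\<kappa> * w (ln (\<delta> / r))\<close>, where
\<open>w = trunc L\<close> vanishes on the negative axis, has a derivative between 0 and 1 and is
constant from \<open>L + 1\<close> on, with a value between \<open>L - 1\<close> and \<open>L\<close>.

In dimension \<open>n\<close> the integral of \<open>r\<close> to the power \<open>- n\<close> over an annulus is \<open>\<omega>\<close> times the logarithm of the
quotient of the radii. So the Euclidean energy of the function is at most \<open>\<kappa> ^ n * \<omega> * (L + 1)\<close>. The metric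
differs from the Euclidean one by a factor \<open>1 + O(r)\<close>, and an additional factor \<open>r\<close> makes the integrand integrable at
the center: the deviation only adds a constant to \<open>L + 1\<close>. Hence
\<open>\<kappa> = (\<omega> * (L + slack)) powr (- (1 / n))\<close>, with a number \<open>slack\<close> independent of \<open>L\<close>, makes the norm of the
gradient at most 1 (\<open>gradient_integral_bound\<close>).

On the core, where \<open>r \<le> \<delta> * exp (- (L + 1))\<close>, the function is a constant of size \<open>L powr (1 - 1 / n)\<close>, and the
critical exponent \<open>n * \<omega> powr (1 / (n - 1)) * \<bar>\<psi>\<bar> powr (n / (n - 1))\<close> is at least \<open>n * L\<close> up to an additive
constant (\<open>critical_exponent_lower\<close>). The volume of the core is of order \<open>exp (- (n * L))\<close>
(\<open>emeasure_core\<close>), so the exponential and the volume cancel, and the integral over the core is at least a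
constant times \<open>L powr (- (1 - 1 / n) * q)\<close>. The \<open>n\<close>-th power of the \<open>L\<^sup>n\<close> norm is \<open>O(1 / L)\<close>
(\<open>bump_integral_bound\<close>). The quotient is therefore at least a constant times \<open>L powr (1 - (1 - 1 / n) * q)\<close>,
which tends to infinity as \<open>q < n / (n - 1)\<close>. If the critical constant is multiplied by \<open>\<theta> > 1\<close>, a
factor \<open>exp ((\<theta> - 1) * n * L)\<close> is left over, and it beats every power of \<open>L\<close>.

The functions are smooth with compact support, so they approximate themselves and belong to \<open>W1n_0\<close>. Two
geometric facts connect the computation in one chart with the manifold. The Riemannian volume, which is
given by a description, exists: a countable atlas cuts the manifold into disjoint pieces of charts, and change of
variables makes the result independent of the charts (\<open>is_volume_exists\<close>, \<open>is_volume_unique\<close>). And a function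
that is smooth with compact support inside one chart is, extended by zero, smooth in all charts; its gradient
in the other charts is transported by the derivatives of the transition maps (\<open>push_C0_inf\<close>,
\<open>push_has_weak_gradient\<close>).
\<close>

section \<open>Calculus of smooth functions\<close>

lemma Ck_on_cong:
  assumes "open U" "\<And>x. x \<in> U \<Longrightarrow> f x = g x" "Ck_on k f U"
  shows "Ck_on k g U"
  using assms(2,3)
proof (induction k arbitrary: f g)
  case 0
  then show ?case by (auto cong: continuous_on_cong)
next
  case (Suc k)
  have d: "(g has_derivative frechet_derivative f (at x)) (at x)" if "x \<in> U" for x
    using Suc.prems that assms(1) frechet_derivative_works[of f "at x"]
    by (auto intro: has_derivative_transform_within_open[where s = U])
  show ?case
    unfolding Ck_on.simps
  proof (intro conjI ballI allI)
    show "g differentiable (at x)" if "x \<in> U" for x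
      using d[OF that] by (auto simp: differentiable_def)
    show "Ck_on k (\<lambda>x. frechet_derivative g (at x) v) U" for v
      by (rule Suc.IH[of "\<lambda>x. frechet_derivative f (at x) v"])
        (use Suc.prems(2) frechet_derivative_at[OF d] in auto)
  qed
qed

lemma Ck_on_subset: "Ck_on k f U \<Longrightarrow> V \<subseteq> U \<Longrightarrow> Ck_on k f V"
  by (induction k arbitrary: f) (auto intro: continuous_on_subset)

lemma Ck_on_SucD: "Ck_on (Suc k) f U \<Longrightarrow> Ck_on k f U"
proof (induction k arbitrary: f)
  case 0
  then show ?case
    by (auto intro!: continuous_at_imp_continuous_on differentiable_imp_continuous_within)
next
  case (Suc k)
  then show ?case
    using Ck_on.simps(2)[of "Suc k" f U] Ck_on.simps(2)[of k f U] by blast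
qed

lemma Ck_on_SucI:
  assumes "open U" "\<And>x. x \<in> U \<Longrightarrow> (f has_derivative f' x) (at x)"
    and "\<And>v. Ck_on k (\<lambda>x. f' x v) U"
  shows "Ck_on (Suc k) f U"
  unfolding Ck_on.simps
proof (intro conjI ballI allI)
  show "f differentiable (at x)" if "x \<in> U" for x
    using assms(2)[OF that] by (auto simp: differentiable_def)
  show "Ck_on k (\<lambda>x. frechet_derivative f (at x) v) U" for v
    by (rule Ck_on_cong[OF assms(1) _ assms(3)[of v]]) (simp add: frechet_derivative_at[OF assms(2)])
qed

lemma Ck_on_SucE:
  assumes "Ck_on (Suc k) f U"
  obtains f' where "\<And>x. x \<in> U \<Longrightarrow> (f has_derivative f' x) (at x)" "\<And>v. Ck_on k (\<lambda>x. f' x v) U"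
  using assms frechet_derivative_works[of f] that[of "\<lambda>x. frechet_derivative f (at x)"] by auto

lemma Ck_on_const: "Ck_on k (\<lambda>x. c) U"
  by (induction k arbitrary: c) (auto simp: frechet_derivative_const)

lemma Ck_on_linear: "bounded_linear f \<Longrightarrow> Ck_on k f U"
proof (cases k)
  case (Suc j)
  assume f: "bounded_linear f"
  have d: "(f has_derivative f) (at x)" for x
    by (rule bounded_linear_imp_has_derivative[OF f])
  have "Ck_on k f UNIV"
    unfolding Suc by (rule Ck_on_SucI[where f' = "\<lambda>x. f"]) (use d Ck_on_const in auto)
  then show ?thesis by (rule Ck_on_subset) simp
qed (simp add: linear_continuous_on)

lemma Ck_on_linear_comp:
  assumes "bounded_linear L" "open U" "Ck_on k f U"
  shows "Ck_on k (\<lambda>x. L (f x)) U"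
  using assms(3)
proof (induction k arbitrary: f)
  case 0
  then show ?case using bounded_linear.continuous_on[OF assms(1)] by auto
next
  case (Suc k)
  from Ck_on_SucE[OF Suc.prems] obtain f' where f': "\<And>x. x \<in> U \<Longrightarrow> (f has_derivative f' x) (at x)"
    "\<And>v. Ck_on k (\<lambda>x. f' x v) U" by blast
  show ?case
    by (rule Ck_on_SucI[OF assms(2) bounded_linear.has_derivative[OF assms(1) f'(1)] Suc.IH[OF f'(2)]])
qed

lemma Ck_on_add:
  assumes "open U" "Ck_on k f U" "Ck_on k g U"
  shows "Ck_on k (\<lambda>x. f x + g x) U"
  using assms(2,3)
proof (induction k arbitrary: f g)
  case 0
  then show ?case by (auto intro: continuous_intros)
next
  case (Suc k)
  from Ck_on_SucE[OF Suc.prems(1)] obtain f' where f': "\<And>x. x \<in> U \<Longrightarrow> (f has_derivative f' x) (at x)"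
    "\<And>v. Ck_on k (\<lambda>x. f' x v) U" by blast
  from Ck_on_SucE[OF Suc.prems(2)] obtain g' where g': "\<And>x. x \<in> U \<Longrightarrow> (g has_derivative g' x) (at x)"
    "\<And>v. Ck_on k (\<lambda>x. g' x v) U" by blast
  show ?case
    by (rule Ck_on_SucI[OF assms(1) has_derivative_add[OF f'(1) g'(1)] Suc.IH[OF f'(2) g'(2)]])
qed

lemma Ck_on_sum:
  assumes "open U" "\<And>i. i \<in> I \<Longrightarrow> Ck_on k (f i) U"
  shows "Ck_on k (\<lambda>x. \<Sum>i\<in>I. f i x) U"
  using assms(2)
  by (induction I rule: infinite_finite_induct) (auto intro: Ck_on_const Ck_on_add[OF assms(1)])

lemma Ck_on_mult:
  fixes f g :: "'e::euclidean_space \<Rightarrow> real"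
  assumes "open U" "Ck_on k f U" "Ck_on k g U"
  shows "Ck_on k (\<lambda>x. f x * g x) U"
  using assms(2,3)
proof (induction k arbitrary: f g)
  case 0
  then show ?case by (auto intro: continuous_intros)
next
  case (Suc k)
  from Ck_on_SucE[OF Suc.prems(1)] obtain f' where f': "\<And>x. x \<in> U \<Longrightarrow> (f has_derivative f' x) (at x)"
    "\<And>v. Ck_on k (\<lambda>x. f' x v) U" by blast
  from Ck_on_SucE[OF Suc.prems(2)] obtain g' where g': "\<And>x. x \<in> U \<Longrightarrow> (g has_derivative g' x) (at x)"
    "\<And>v. Ck_on k (\<lambda>x. g' x v) U" by blast
  show ?case
    by (rule Ck_on_SucI[OF assms(1) has_derivative_mult[OF f'(1) g'(1)]])
      (auto intro!: Ck_on_add[OF assms(1)] Suc.IH f'(2) g'(2) Ck_on_SucD[OF Suc.prems(1)] Ck_on_SucD[OF Suc.prems(2)])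
qed

lemma Ck_on_minus: "open U \<Longrightarrow> Ck_on k f U \<Longrightarrow> Ck_on k (\<lambda>x. - f x) U"
  by (rule Ck_on_linear_comp[where L = uminus]) (auto intro: bounded_linear_minus bounded_linear_ident)

text \<open>The derivative of \<open>\<lambda>x. F (T x)\<close> in direction \<open>v\<close> is the sum over the basis vectors \<open>b\<close> of
  \<open>(T' x v \<bullet> b) * F' (T x) b\<close>. Each factor has one derivative less than \<open>F\<close> or \<open>T\<close>, which is the
  induction on \<open>k\<close>.\<close>

lemma Ck_on_compose:
  fixes F :: "'b::euclidean_space \<Rightarrow> real" and T :: "'a::euclidean_space \<Rightarrow> 'b"
  assumes "open U" "T ` U \<subseteq> V" "Ck_on k F V" "Ck_on k T U"
  shows "Ck_on k (\<lambda>x. F (T x)) U"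
  using assms(3,4)
proof (induction k arbitrary: F)
  case 0
  then show ?case using continuous_on_compose2[of V F U T] assms(2) by auto
next
  case (Suc k)
  from Ck_on_SucE[OF Suc.prems(1)] obtain F' where F': "\<And>x. x \<in> V \<Longrightarrow> (F has_derivative F' x) (at x)"
    "\<And>v. Ck_on k (\<lambda>x. F' x v) V" by blast
  from Ck_on_SucE[OF Suc.prems(2)] obtain T' where T': "\<And>x. x \<in> U \<Longrightarrow> (T has_derivative T' x) (at x)"
    "\<And>v. Ck_on k (\<lambda>x. T' x v) U" by blast
  show ?case
  proof (rule Ck_on_SucI[OF assms(1), where f' = "\<lambda>x v. F' (T x) (T' x v)"])
    fix x assume x: "x \<in> U"
    show "((\<lambda>x. F (T x)) has_derivative (\<lambda>v. F' (T x) (T' x v))) (at x)"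
      using has_derivative_compose[OF T'(1)[OF x] F'(1)] x assms(2) by auto
  next
    fix v
    have "Ck_on k (\<lambda>x. \<Sum>b\<in>Basis. (T' x v \<bullet> b) * F' (T x) b) U"
      by (intro Ck_on_sum Ck_on_mult assms(1) Suc.IH F'(2) Ck_on_SucD[OF Suc.prems(2)]
          Ck_on_linear_comp[OF bounded_linear_inner_left] T'(2))
    then show "Ck_on k (\<lambda>x. F' (T x) (T' x v)) U"
    proof (rule Ck_on_cong[OF assms(1), rotated])
      fix x assume "x \<in> U"
      then have l: "linear (F' (T x))" using F'(1)[of "T x"] assms(2)
        by (meson has_derivative_linear image_subset_iff)
      have "F' (T x) (T' x v) = F' (T x) (\<Sum>b\<in>Basis. (T' x v \<bullet> b) *\<^sub>R b)"
        by (simp add: euclidean_representation)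
      also have "\<dots> = (\<Sum>b\<in>Basis. (T' x v \<bullet> b) * F' (T x) b)"
        using l by (simp add: linear_sum linear_scale)
      finally show "(\<Sum>b\<in>Basis. (T' x v \<bullet> b) * F' (T x) b) = F' (T x) (T' x v)" ..
    qed
  qed
qed

lemma Ck_on_local:
  assumes "\<And>x. x \<in> U \<Longrightarrow> \<exists>W. open W \<and> x \<in> W \<and> Ck_on k f W"
  shows "Ck_on k f U"
  using assms
proof (induction k arbitrary: f)
  case 0
  show ?case
    unfolding Ck_on.simps
  proof (rule continuous_at_imp_continuous_on, rule ballI)
    fix x assume "x \<in> U"
    with 0 show "isCont f x" by (metis Ck_on.simps(1) continuous_on_eq_continuous_at)
  qed
next
  case (Suc k)
  show ?case
    unfolding Ck_on.simps
  proof (intro conjI ballI allI)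
    fix x assume "x \<in> U"
    with Suc.prems[OF this] show "f differentiable (at x)" by auto
  next
    fix v
    show "Ck_on k (\<lambda>x. frechet_derivative f (at x) v) U"
      by (rule Suc.IH) (use Suc.prems in fastforce)
  qed
qed

lemma Ck_on_real_SucI:
  fixes f f' :: "real \<Rightarrow> real"
  assumes "open U" "\<And>x. x \<in> U \<Longrightarrow> (f has_real_derivative f' x) (at x)" "Ck_on k f' U"
  shows "Ck_on (Suc k) f U"
proof (rule Ck_on_SucI[OF assms(1), where f' = "\<lambda>x v. v * f' x"])
  show "(f has_derivative (\<lambda>v. v * f' x)) (at x)" if "x \<in> U" for x
    using assms(2)[OF that] by (simp add: has_field_derivative_def mult.commute[of _ "f' x"])
  show "Ck_on k (\<lambda>x. v * f' x) U" for v
    by (rule Ck_on_linear_comp[OF bounded_linear_mult_right assms(1,3)])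
qed

lemma Ck_on_inverse: "Ck_on k (inverse :: real \<Rightarrow> real) {0<..}"
proof (induction k)
  case (Suc k)
  show ?case
  proof (rule Ck_on_real_SucI[where f' = "\<lambda>x. - (inverse x * inverse x)"])
    show "(inverse has_real_derivative - (inverse x * inverse x)) (at x)" if "x \<in> {0<..}" for x :: real
      using DERIV_inverse[of x] that by (simp add: power2_eq_square numeral_2_eq_2)
  qed (auto intro!: Ck_on_minus Ck_on_mult Suc.IH)
qed (auto intro!: continuous_intros)

lemma Ck_on_ln: "Ck_on k (ln :: real \<Rightarrow> real) {0<..}"
proof (cases k)
  case (Suc j)
  show ?thesis
    unfolding Suc
    by (rule Ck_on_real_SucI[where f' = inverse]) (auto intro!: Ck_on_inverse derivative_eq_intros simp: field_simps)
qed (auto intro!: continuous_intros)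

section \<open>A smooth positive part\<close>

text \<open>The functions \<open>p (1 / t) * exp (- 1 / t)\<close>, extended by 0, form a class that contains the derivatives
  of its members. One proof of differentiability at 0 for the whole class therefore gives smoothness.\<close>

definition flat_poly :: "real poly \<Rightarrow> real \<Rightarrow> real" where
  "flat_poly p t = (if 0 < t then poly p (1 / t) * exp (- (1 / t)) else 0)"

lemma flat_poly_tendsto_0: "(flat_poly p \<longlongrightarrow> 0) (at_right 0)"
proof -
  have "((\<lambda>y. poly p y * exp (- y)) \<longlongrightarrow> 0) at_top"
  proof -
    have "((\<lambda>y. \<Sum>i\<le>degree p. coeff p i * (y ^ i / exp y)) \<longlongrightarrow> (\<Sum>i\<le>degree p. coeff p i * 0)) at_top"
      by (intro tendsto_intros tendsto_power_div_exp_0)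
    then show ?thesis
      by (simp add: poly_altdef sum_distrib_right exp_minus divide_inverse mult.assoc)
  qed
  then have "((\<lambda>t. poly p (inverse t) * exp (- inverse t)) \<longlongrightarrow> 0) (at_right 0)"
    by (rule filterlim_compose[OF _ filterlim_inverse_at_top_right])
  then show ?thesis
    by (rule filterlim_cong[THEN iffD1, OF refl refl, rotated])
      (auto simp: eventually_at_right_field flat_poly_def field_simps intro!: exI[of _ 1])
qed

lemma flat_poly_has_derivative:
  "(flat_poly p has_real_derivative flat_poly ([:0, 0, 1:] * (p - pderiv p)) t) (at t)"
proof -
  consider "t < 0" | "t = 0" | "t > 0" by linarith
  then show ?thesis
  proof cases
    case 1
    then have "((\<lambda>t. 0) has_real_derivative 0) (at t)" by simp
    then have "(flat_poly p has_real_derivative 0) (at t)"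
      by (rule has_field_derivative_transform_within_open[where S = "{..<0}"]) (use 1 in \<open>auto simp: flat_poly_def\<close>)
    with 1 show ?thesis by (simp add: flat_poly_def)
  next
    case 2
    have "((\<lambda>h. flat_poly p h / h) \<longlongrightarrow> 0) (at_right 0)"
    proof (rule filterlim_cong[THEN iffD1, OF refl refl _ flat_poly_tendsto_0[of "[:0, 1:] * p"]])
      show "\<forall>\<^sub>F h in at_right 0. flat_poly ([:0, 1:] * p) h = flat_poly p h / h"
        by (auto simp: eventually_at_right_field flat_poly_def intro!: exI[of _ 1])
    qed
    moreover have "((\<lambda>h. flat_poly p h / h) \<longlongrightarrow> 0) (at_left 0)"
    proof (rule filterlim_cong[THEN iffD1, OF refl refl])
      show "\<forall>\<^sub>F h in at_left 0. 0 = flat_poly p h / h"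
        by (auto simp: eventually_at_left_field flat_poly_def intro!: exI[of _ "-1"])
    qed simp
    ultimately have "((\<lambda>h. flat_poly p h / h) \<longlongrightarrow> 0) (at 0)"
      by (simp add: filterlim_at_split)
    then have "(flat_poly p has_real_derivative 0) (at 0)"
      by (simp add: DERIV_def flat_poly_def)
    with 2 show ?thesis by (simp add: flat_poly_def)
  next
    case 3
    then have "((\<lambda>t. poly p (1 / t) * exp (- (1 / t))) has_real_derivative
        flat_poly ([:0, 0, 1:] * (p - pderiv p)) t) (at t)"
      by (auto intro!: derivative_eq_intros poly_DERIV[THEN DERIV_chain2] simp: flat_poly_def field_simps power2_eq_square)
    then show ?thesis
      by (rule has_field_derivative_transform_within_open[where S = "{0<..}"]) (use 3 in \<open>auto simp: flat_poly_def\<close>)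
  qed
qed

lemma Ck_on_flat_poly: "Ck_on k (flat_poly p) UNIV"
proof (induction k arbitrary: p)
  case 0
  have "isCont (flat_poly p) t" for t
    using flat_poly_has_derivative by (rule DERIV_isCont)
  then show ?case by (simp add: continuous_at_imp_continuous_on)
next
  case (Suc k)
  show ?case by (rule Ck_on_real_SucI[OF _ flat_poly_has_derivative Suc.IH]) auto
qed

text \<open>A smooth substitute for \<open>max 0 t\<close>, from which it differs by at most 1. Its derivative stays in
  the interval from 0 to 1, which is what makes compositions of it harmless for the energy.\<close>

definition soft_pos :: "real \<Rightarrow> real" where
  "soft_pos t = t * flat_poly 1 t"

definition soft_pos' :: "real \<Rightarrow> real" where
  "soft_pos' t = (if 0 < t then exp (- (1 / t)) * (1 + 1 / t) else 0)"

lemma Ck_on_soft_pos: "Ck_on k soft_pos UNIV"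
  unfolding soft_pos_def
  by (intro Ck_on_mult Ck_on_flat_poly Ck_on_linear[where f = "\<lambda>x. x"] bounded_linear_ident open_UNIV)

lemma soft_pos_has_derivative: "(soft_pos has_real_derivative soft_pos' t) (at t)"
proof -
  have "((\<lambda>t. t * flat_poly 1 t) has_real_derivative
      1 * flat_poly 1 t + flat_poly ([:0, 0, 1:] * (1 - pderiv 1)) t * t) (at t)"
    by (rule DERIV_mult[OF DERIV_ident flat_poly_has_derivative])
  moreover have "1 * flat_poly 1 t + flat_poly ([:0, 0, 1:] * (1 - pderiv 1)) t * t = soft_pos' t"
    by (simp add: soft_pos'_def flat_poly_def field_simps power2_eq_square)
  moreover have "soft_pos = (\<lambda>t. t * flat_poly 1 t)"
    by (simp add: fun_eq_iff soft_pos_def)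
  ultimately show ?thesis by simp
qed

lemma soft_pos'_bounds: "0 \<le> soft_pos' t" "soft_pos' t \<le> 1"
proof -
  show "0 \<le> soft_pos' t" by (simp add: soft_pos'_def)
  have "1 + 1 / t \<le> exp (1 / t)" by (rule exp_ge_add_one_self)
  then have "exp (- (1 / t)) * (1 + 1 / t) \<le> exp (- (1 / t)) * exp (1 / t)"
    by (intro mult_left_mono) auto
  then show "soft_pos' t \<le> 1" by (simp add: soft_pos'_def exp_minus)
qed

lemma soft_pos_nonpos: "t \<le> 0 \<Longrightarrow> soft_pos t = 0"
  by (simp add: soft_pos_def flat_poly_def)

lemma soft_pos_nonneg: "0 \<le> soft_pos t"
  by (simp add: soft_pos_def flat_poly_def)

lemma soft_pos_pos: "0 < t \<Longrightarrow> 0 < soft_pos t"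
  by (simp add: soft_pos_def flat_poly_def)

lemma soft_pos_le: "0 \<le> t \<Longrightarrow> soft_pos t \<le> t"
  by (simp add: soft_pos_def flat_poly_def mult_left_le)

lemma soft_pos_ge: "t - 1 \<le> soft_pos t"
proof (cases "0 < t")
  case True
  have "1 + - (1 / t) \<le> exp (- (1 / t))" by (rule exp_ge_add_one_self)
  then have "t * (1 + - (1 / t)) \<le> t * exp (- (1 / t))" using True by (intro mult_left_mono) auto
  also have "t * (1 + - (1 / t)) = t - 1" using True by (simp add: algebra_simps)
  finally show ?thesis using True by (simp add: soft_pos_def flat_poly_def)
qed (use soft_pos_nonneg[of t] in linarith)

section \<open>Change of variables\<close>

text \<open>A finite type can be enumerated, but it has no distinguished order. The copy of the type carries the order
  of an enumeration, so that theorems about matrices whose indices are well-ordered apply to all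
  finite index types.\<close>

typedef 'a ord_copy = "UNIV :: 'a set" morphisms of_copy to_copy by simp

lemma inj_of_copy: "inj of_copy" by (simp add: inj_def of_copy_inject)

lemma bij_of_copy: "bij of_copy"
  by (metis bij_betw_def inj_of_copy surj_def to_copy_inverse UNIV_I)

lemma bij_to_copy: "bij to_copy"
  by (metis bij_betw_byWitness bij_of_copy UNIV_I of_copy_inverse subset_UNIV to_copy_inverse)

instance ord_copy :: (finite) finite
proof
  show "finite (UNIV :: 'a ord_copy set)"
    using inj_of_copy by (rule finite_imageD[rotated]) simp
qed

instantiation ord_copy :: (finite) wellorder
begin

definition less_eq_ord_copy :: "'a ord_copy \<Rightarrow> 'a ord_copy \<Rightarrow> bool" where
  "x \<le> y \<longleftrightarrow> to_nat (of_copy x) \<le> to_nat (of_copy y)"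

definition less_ord_copy :: "'a ord_copy \<Rightarrow> 'a ord_copy \<Rightarrow> bool" where
  "x < y \<longleftrightarrow> to_nat (of_copy x) < to_nat (of_copy y)"

instance
proof
  fix P :: "'a ord_copy \<Rightarrow> bool" and a
  assume "\<And>x. (\<And>y. y < x \<Longrightarrow> P y) \<Longrightarrow> P x"
  then show "P a"
    unfolding less_ord_copy_def by (rule measure_induct_rule)
qed (auto simp: less_eq_ord_copy_def less_ord_copy_def of_copy_inject)

end

definition to_ord :: "real^'n \<Rightarrow> real^('n::finite) ord_copy" where
  "to_ord x = (\<chi> i. x $ of_copy i)"

definition of_ord :: "real^('n::finite) ord_copy \<Rightarrow> real^'n" where
  "of_ord x = (\<chi> i. x $ to_copy i)"

lemma of_ord_to_ord [simp]: "of_ord (to_ord x) = x"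
  by (simp add: of_ord_def to_ord_def to_copy_inverse)

lemma to_ord_of_ord [simp]: "to_ord (of_ord x) = x"
  by (simp add: of_ord_def to_ord_def of_copy_inverse)

lemma linear_to_ord: "bounded_linear to_ord"
  by (simp add: linear_conv_bounded_linear[symmetric] linear_iff to_ord_def vec_eq_iff)

lemma linear_of_ord: "bounded_linear of_ord"
  by (simp add: linear_conv_bounded_linear[symmetric] linear_iff of_ord_def vec_eq_iff)

lemma borel_measurable_to_ord [measurable]: "to_ord \<in> borel_measurable borel"
  by (intro borel_measurable_continuous_onI linear_continuous_on linear_to_ord)

lemma borel_measurable_of_ord [measurable]: "of_ord \<in> borel_measurable borel"
  by (intro borel_measurable_continuous_onI linear_continuous_on linear_of_ord)

lemma prod_Basis_cart:
  fixes f :: "real^'n::finite \<Rightarrow> real"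
  shows "(\<Prod>b\<in>Basis. f b) = (\<Prod>i\<in>UNIV. f (axis i 1))"
proof -
  have B: "(Basis :: (real^'n) set) = range (\<lambda>i. axis i 1)"
    by (auto simp: Basis_vec_def)
  have "inj (\<lambda>i. axis i 1 :: real^'n)"
    by (auto simp: inj_def axis_eq_axis)
  then show ?thesis unfolding B by (subst prod.reindex) (simp_all add: o_def)
qed

lemma lborel_to_ord: "distr lborel borel (to_ord :: real^'n::finite \<Rightarrow> _) = lborel"
proof (rule sym, rule lborel_eqI)
  fix l u :: "real^'n ord_copy"
  assume lu: "\<And>b. b \<in> Basis \<Longrightarrow> l \<bullet> b \<le> u \<bullet> b"
  have le: "l $ i \<le> u $ i" for i
    using lu[of "axis i 1"] by (simp add: inner_axis Basis_vec_def) blast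
  have box: "to_ord -` box l u = box (of_ord l) (of_ord u :: real^'n)"
  proof (intro set_eqI iffI)
    fix x :: "real^'n" assume "x \<in> to_ord -` box l u"
    then have *: "l $ i < x $ of_copy i" "x $ of_copy i < u $ i" for i
      by (auto simp: mem_box_cart to_ord_def)
    then show "x \<in> box (of_ord l) (of_ord u)"
      using *[of "to_copy _"] by (auto simp: mem_box_cart of_ord_def to_copy_inverse)
  next
    fix x :: "real^'n" assume "x \<in> box (of_ord l) (of_ord u)"
    then have *: "l $ to_copy i < x $ i" "x $ i < u $ to_copy i" for i
      by (auto simp: mem_box_cart of_ord_def)
    then show "x \<in> to_ord -` box l u"
      using *[of "of_copy _"] by (auto simp: mem_box_cart to_ord_def of_copy_inverse)
  qed
  have "emeasure (distr lborel borel (to_ord :: real^'n \<Rightarrow> _)) (box l u) = emeasure lborel (box (of_ord l) (of_ord u))"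
    by (subst emeasure_distr) (auto simp: box)
  also have "\<dots> = ennreal (\<Prod>b\<in>Basis. (of_ord u - of_ord l) \<bullet> b)"
    using le by (intro emeasure_lborel_box) (auto simp: Basis_vec_def inner_axis of_ord_def)
  also have "(\<Prod>b\<in>Basis. (of_ord u - of_ord l) \<bullet> b) = (\<Prod>i\<in>UNIV. u $ to_copy i - l $ to_copy i)"
    by (simp add: prod_Basis_cart inner_axis of_ord_def)
  also have "\<dots> = (\<Prod>i\<in>UNIV. u $ i - l $ i)"
    by (rule prod.reindex_bij_betw[OF bij_to_copy])
  also have "\<dots> = (\<Prod>b\<in>Basis. (u - l) \<bullet> b)"
    by (simp add: prod_Basis_cart inner_axis)
  finally show "emeasure (distr lborel borel (to_ord :: real^'n \<Rightarrow> _)) (box l u) = (\<Prod>b\<in>Basis. (u - l) \<bullet> b)" .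
qed simp

text \<open>Renaming the indices conjugates the permutations in the Leibniz formula, and conjugation preserves
  the sign.\<close>

lemma det_ord_copy:
  fixes A :: "real^'n::finite^'n"
  shows "det (\<chi> i j. A $ of_copy i $ of_copy j) = det A"
proof -
  let ?c = "\<lambda>p. to_copy \<circ> p \<circ> (of_copy :: 'n ord_copy \<Rightarrow> _)"
  have mp: "map_permutation UNIV to_copy p = ?c p" for p :: "'n \<Rightarrow> 'n"
  proof -
    have "inv to_copy = (of_copy :: 'n ord_copy \<Rightarrow> _)"
      by (rule inv_equality) (auto simp: to_copy_inverse of_copy_inverse)
    moreover have "range (to_copy :: 'n \<Rightarrow> _) = UNIV" using bij_to_copy by (rule bij_is_surj)
    ultimately show ?thesis
      by (simp add: map_permutation_def restrict_id_def fun_eq_iff)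
  qed
  have sg: "sign (?c p) = sign p" if "p permutes UNIV" for p
    unfolding mp[symmetric] by (rule sign_map_permutation) (use that bij_to_copy in \<open>auto simp: bij_def\<close>)
  have perm: "?c p permutes UNIV" if "p permutes (UNIV :: 'n set)" for p
    by (intro bij_imp_permutes bij_comp bij_to_copy bij_of_copy permutes_bij[OF that]) simp
  show ?thesis
    unfolding det_def
  proof (rule sum.reindex_bij_witness[where i = ?c and j = "\<lambda>p. of_copy \<circ> p \<circ> to_copy"])
    fix p assume "p \<in> {p. p permutes (UNIV :: 'n ord_copy set)}"
    then have p: "bij p" by (simp add: permutes_bij)
    show "of_copy \<circ> p \<circ> to_copy \<in> {p. p permutes (UNIV :: 'n set)}"
      by (auto intro!: bij_imp_permutes bij_comp bij_to_copy bij_of_copy p)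
    show c: "?c (of_copy \<circ> p \<circ> to_copy) = p"
      by (auto simp: fun_eq_iff of_copy_inverse)
    have "sign (of_copy \<circ> p \<circ> to_copy) = sign p"
      using sg[of "of_copy \<circ> p \<circ> to_copy"] p
      \<open>of_copy \<circ> p \<circ> to_copy \<in> _\<close> c by simp
    moreover have "(\<Prod>i\<in>UNIV. A $ i $ (of_copy \<circ> p \<circ> to_copy) i) =
        (\<Prod>i\<in>UNIV. A $ of_copy i $ of_copy (p i))"
      using prod.reindex_bij_betw[OF bij_of_copy, of "\<lambda>i. A $ i $ (of_copy \<circ> p \<circ> to_copy) i"]
      by (simp add: of_copy_inverse)
    ultimately show "of_int (sign (of_copy \<circ> p \<circ> to_copy)) * (\<Prod>i\<in>UNIV. A $ i $ (of_copy \<circ> p \<circ> to_copy) i) =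
        of_int (sign p) * (\<Prod>i\<in>UNIV. (\<chi> i j. A $ of_copy i $ of_copy j) $ i $ p i)"
      by simp
  next
    fix p assume "p \<in> {p. p permutes (UNIV :: 'n set)}"
    then show "?c p \<in> {p. p permutes UNIV}" "of_copy \<circ> ?c p \<circ> to_copy = p"
      using perm by (auto simp: fun_eq_iff to_copy_inverse)
  qed
qed

text \<open>Change of variables is a statement about absolutely integrable functions: one side is integrable
  if and only if the other is, with the same integral. For nonnegative functions this is an identity
  of integrals with values in the extended reals, as both sides are infinite otherwise.\<close>

lemma nn_integral_absolutely_integrable:
  fixes h :: "'a::euclidean_space \<Rightarrow> real"
  assumes h: "(\<lambda>x. indicator S x * h x) \<in> borel_measurable borel" and nn: "\<And>x. x \<in> S \<Longrightarrow> 0 \<le> h x"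
  shows "h absolutely_integrable_on S \<longleftrightarrow> (\<integral>\<^sup>+x. ennreal (h x) * indicator S x \<partial>lborel) < \<infinity>"
    and "h absolutely_integrable_on S \<Longrightarrow>
      (\<integral>\<^sup>+x. ennreal (h x) * indicator S x \<partial>lborel) = ennreal (integral S h)"
proof -
  have eq: "ennreal (h x) * indicator S x = ennreal (indicator S x * h x)" for x
    by (auto simp: indicator_def)
  have nn': "0 \<le> indicator S x * h x" for x using nn by (auto simp: indicator_def)
  have iff: "h absolutely_integrable_on S \<longleftrightarrow> integrable lborel (\<lambda>x. indicator S x * h x)"
    unfolding set_integrable_def using h by (simp add: integrable_completion)
  show "h absolutely_integrable_on S \<longleftrightarrow> (\<integral>\<^sup>+x. ennreal (h x) * indicator S x \<partial>lborel) < \<infinity>"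
    unfolding iff eq integrable_iff_bounded using h nn' by simp
  assume a: "h absolutely_integrable_on S"
  with iff have "integrable lborel (\<lambda>x. indicator S x * h x)" by simp
  then have "(\<integral>\<^sup>+x. ennreal (h x) * indicator S x \<partial>lborel) = ennreal (\<integral>x. indicator S x * h x \<partial>lborel)"
    unfolding eq using nn' by (intro nn_integral_eq_integral) auto
  also have "(\<integral>x. indicator S x * h x \<partial>lborel) = integral S h"
    using set_lebesgue_integral_eq_integral(2)[OF a] h
    by (simp add: set_lebesgue_integral_def integral_completion)
  finally show "(\<integral>\<^sup>+x. ennreal (h x) * indicator S x \<partial>lborel) = ennreal (integral S h)" .
qed

lemma nn_integral_change_of_variables_wellorder:
  fixes T :: "real^'m::{finite,wellorder} \<Rightarrow> real^'m::_" and f :: "real^'m::_ \<Rightarrow> real"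
  assumes S: "S \<in> sets borel"
    and T: "\<And>x. x \<in> S \<Longrightarrow> (T has_derivative T' x) (at x within S)"
    and inj: "inj_on T S"
    and nn: "\<And>x. x \<in> S \<Longrightarrow> 0 \<le> f (T x)"
    and m1: "(\<lambda>y. indicator (T ` S) y * f y) \<in> borel_measurable borel"
    and m2: "(\<lambda>x. indicator S x * (\<bar>det (matrix (T' x))\<bar> * f (T x))) \<in> borel_measurable borel"
  shows "(\<integral>\<^sup>+y. ennreal (f y) * indicator (T ` S) y \<partial>lborel) =
    (\<integral>\<^sup>+x. ennreal (\<bar>det (matrix (T' x))\<bar> * f (T x)) * indicator S x \<partial>lborel)"
proof -
  let ?h = "\<lambda>x. \<bar>det (matrix (T' x))\<bar> * f (T x)"
  have "?h absolutely_integrable_on S \<and> integral S ?h = b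
     \<longleftrightarrow> f absolutely_integrable_on (T ` S) \<and> integral (T ` S) f = b" for b
    using has_absolute_integral_change_of_variables[OF _ T inj, where f = "\<lambda>x. vec (f x) :: real^1" and b = "vec b"] S
    by (simp add: absolutely_integrable_on_1_iff integral_on_1_eq vec_eq_iff)
  moreover note nn_integral_absolutely_integrable[OF m1] nn_integral_absolutely_integrable[OF m2]
  ultimately show ?thesis
    using nn by (smt (verit, best) imageE infinity_ennreal_def less_top mult_nonneg_nonneg)
qed

theorem nn_integral_change_of_variables:
  fixes T :: "real^'n::finite \<Rightarrow> real^'n" and f :: "real^'n \<Rightarrow> real"
  assumes S: "S \<in> sets borel"
    and T: "\<And>x. x \<in> S \<Longrightarrow> (T has_derivative T' x) (at x within S)"
    and inj: "inj_on T S"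
    and nn: "\<And>x. x \<in> S \<Longrightarrow> 0 \<le> f (T x)"
    and m1: "(\<lambda>y. indicator (T ` S) y * f y) \<in> borel_measurable borel"
    and m2: "(\<lambda>x. indicator S x * (\<bar>det (matrix (T' x))\<bar> * f (T x))) \<in> borel_measurable borel"
  shows "(\<integral>\<^sup>+y. ennreal (f y) * indicator (T ` S) y \<partial>lborel) =
    (\<integral>\<^sup>+x. ennreal (\<bar>det (matrix (T' x))\<bar> * f (T x)) * indicator S x \<partial>lborel)"
proof -
  let ?T = "\<lambda>x. to_ord (T (of_ord x))" and ?T' = "\<lambda>x v. to_ord (T' (of_ord x) (of_ord v))"
  let ?S = "to_ord ` S" and ?f = "\<lambda>x. f (of_ord x)"
  have S_eq: "?S = of_ord -` S" by (auto simp: image_iff) (metis to_ord_of_ord)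
  have TS_eq: "?T ` ?S = of_ord -` (T ` S)"
  proof (intro set_eqI iffI)
    fix x assume "x \<in> of_ord -` (T ` S)"
    then obtain y where "y \<in> S" "of_ord x = T y" by auto
    then have "x = ?T (to_ord y)" by (metis of_ord_to_ord to_ord_of_ord)
    with \<open>y \<in> S\<close> show "x \<in> ?T ` ?S" by blast
  qed auto
  have det: "det (matrix (?T' x)) = det (matrix (T' (of_ord x)))" if "x \<in> ?S" for x
  proof -
    have ax: "of_ord (axis j 1) = (axis (of_copy j) 1 :: real^'n)" for j
      by (auto simp: of_ord_def vec_eq_iff axis_def to_copy_inverse of_copy_inverse)
    have "matrix (?T' x) = (\<chi> i j. matrix (T' (of_ord x)) $ of_copy i $ of_copy j)"
      by (simp add: matrix_def vec_eq_iff ax to_ord_def)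
    then show ?thesis by (simp only: det_ord_copy)
  qed
  have meas: "?S \<in> sets borel"
    unfolding S_eq using measurable_sets[OF borel_measurable_of_ord S] by simp
  have ind1: "indicator ?S x = indicator S (of_ord x)" for x
    unfolding S_eq by (auto simp: indicator_def)
  have ind2: "indicator (?T ` ?S) x = indicator (T ` S) (of_ord x)" for x
    unfolding TS_eq by (auto simp: indicator_def)
  note ind = ind1 ind2
  have "(\<integral>\<^sup>+y. ennreal (f y) * indicator (T ` S) y \<partial>lborel) =
      (\<integral>\<^sup>+y. ennreal (?f (to_ord y)) * indicator (?T ` ?S) (to_ord y) \<partial>lborel)"
    unfolding ind by simp
  also have "\<dots> = (\<integral>\<^sup>+y. ennreal (?f y) * indicator (?T ` ?S) y \<partial>distr lborel borel to_ord)"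
  proof -
    have "(\<lambda>y. ennreal (indicator (T ` S) (of_ord y) * f (of_ord y))) \<in> borel_measurable borel"
      using measurable_compose[OF borel_measurable_of_ord m1] by measurable
    then have "(\<lambda>y. ennreal (?f y) * indicator (?T ` ?S) y) \<in> borel_measurable borel"
      unfolding ind by (rule measurable_cong[THEN iffD1, rotated]) (auto simp: indicator_def)
    then show ?thesis by (subst nn_integral_distr) simp_all
  qed
  also have "\<dots> = (\<integral>\<^sup>+x. ennreal (\<bar>det (matrix (?T' x))\<bar> * ?f (?T x)) * indicator ?S x \<partial>lborel)"
    unfolding lborel_to_ord
  proof (rule nn_integral_change_of_variables_wellorder[OF meas])
    show "(?T has_derivative ?T' x) (at x within ?S)" if "x \<in> ?S" for x
    proof -
      have "(T has_derivative T' (of_ord x)) (at (of_ord x) within of_ord ` ?S)"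
        using T[of "of_ord x"] that by (auto simp: image_image)
      then have "((\<lambda>x. T (of_ord x)) has_derivative (\<lambda>v. T' (of_ord x) (of_ord v))) (at x within ?S)"
        by (rule has_derivative_in_compose[OF bounded_linear_imp_has_derivative[OF linear_of_ord]])
      then show ?thesis by (rule bounded_linear.has_derivative[OF linear_to_ord])
    qed
    show "inj_on ?T ?S"
      using inj by (auto simp: inj_on_def) (metis of_ord_to_ord)
    show "(\<lambda>y. indicator (?T ` ?S) y * ?f y) \<in> borel_measurable borel"
      unfolding ind using measurable_compose[OF borel_measurable_of_ord m1] by simp
    have "(\<lambda>x. indicator ?S x * (\<bar>det (matrix (?T' x))\<bar> * ?f (?T x))) =
        (\<lambda>x. indicator S (of_ord x) * (\<bar>det (matrix (T' (of_ord x)))\<bar> * f (T (of_ord x))))"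
      using det by (auto simp: fun_eq_iff indicator_def S_eq)
    then show "(\<lambda>x. indicator ?S x * (\<bar>det (matrix (?T' x))\<bar> * ?f (?T x))) \<in> borel_measurable borel"
      using measurable_compose[OF borel_measurable_of_ord m2] by simp
  qed (use nn in auto)
  also have "\<dots> = (\<integral>\<^sup>+x. ennreal (indicator S (of_ord x) *
      (\<bar>det (matrix (T' (of_ord x)))\<bar> * f (T (of_ord x)))) \<partial>distr lborel borel to_ord)"
    unfolding lborel_to_ord using det by (intro nn_integral_cong) (auto simp: indicator_def S_eq)
  also have "\<dots> = (\<integral>\<^sup>+x. ennreal (indicator S x * (\<bar>det (matrix (T' x))\<bar> * f (T x))) \<partial>lborel)"
    using measurable_compose[OF borel_measurable_of_ord m2] by (subst nn_integral_distr) auto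
  also have "\<dots> = (\<integral>\<^sup>+x. ennreal (\<bar>det (matrix (T' x))\<bar> * f (T x)) * indicator S x \<partial>lborel)"
    by (intro nn_integral_cong) (auto simp: indicator_def)
  finally show ?thesis .
qed

section \<open>Orthonormal frames and radial integrals\<close>

text \<open>Gram-Schmidt for the inner product \<open>v \<bullet> (G *v w)\<close>; the orthonormal vectors are the columns of \<open>P\<close>.\<close>

lemma linear_orthonormal_frame:
  fixes G :: "real^'n::finite^'n"
  assumes sym: "transpose G = G" and pos: "\<And>v. v \<noteq> 0 \<Longrightarrow> 0 < v \<bullet> (G *v v)"
  shows "\<exists>P :: real^'n^'n. transpose P ** (G ** P) = mat 1"
proof -
  have comm: "u \<bullet> (G *v v) = v \<bullet> (G *v u)" for u v
    by (metis sym dot_lmul_matrix inner_commute transpose_matrix_vector)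
  have "\<exists>B. finite B \<and> card B = k \<and> (\<forall>u\<in>B. \<forall>v\<in>B. u \<bullet> (G *v v) = (if u = v then 1 else 0))"
    if "k \<le> CARD('n)" for k
    using that
  proof (induction k)
    case 0
    show ?case by (rule exI[of _ "{}"]) simp
  next
    case (Suc k)
    then obtain B where B: "finite B" "card B = k"
      "\<And>u v. u \<in> B \<Longrightarrow> v \<in> B \<Longrightarrow> u \<bullet> (G *v v) = (if u = v then 1 else 0)" by auto
    have "dim B < DIM(real^'n)" using dim_le_card'[OF B(1)] B(2) Suc.prems by simp
    then have "span B \<noteq> UNIV" by (metis dim_UNIV dim_span less_irrefl)
    then obtain v where v: "v \<notin> span B" by blast
    define w where "w = v - (\<Sum>u\<in>B. (u \<bullet> (G *v v)) *\<^sub>R u)"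
    have "w \<noteq> 0"
    proof
      assume "w = 0"
      then have "v = (\<Sum>u\<in>B. (u \<bullet> (G *v v)) *\<^sub>R u)" by (simp add: w_def)
      also have "\<dots> \<in> span B" by (intro span_sum span_scale span_base)
      finally show False using v by simp
    qed
    have wB: "u \<bullet> (G *v w) = 0" if "u \<in> B" for u
    proof -
      have "u \<bullet> (G *v w) = u \<bullet> (G *v v) - (\<Sum>u'\<in>B. (u' \<bullet> (G *v v)) * (u \<bullet> (G *v u')))"
        unfolding w_def
        by (simp add: matrix_vector_mult_diff_distrib inner_diff_right linear_sum[OF matrix_vector_mul_linear]
            inner_sum_right matrix_vector_mult_scaleR)
      also have "(\<Sum>u'\<in>B. (u' \<bullet> (G *v v)) * (u \<bullet> (G *v u'))) = (\<Sum>u'\<in>B. if u = u' then u' \<bullet> (G *v v) else 0)"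
        using B(3) that by (intro sum.cong) auto
      also have "\<dots> = u \<bullet> (G *v v)" using B(1) that by simp
      finally show ?thesis by simp
    qed
    define e where "e = w /\<^sub>R sqrt (w \<bullet> (G *v w))"
    have ww: "0 < w \<bullet> (G *v w)" by (rule pos) fact
    have ee: "e \<bullet> (G *v e) = 1"
      using ww by (simp add: e_def matrix_vector_mult_scaleR field_simps)
    have eB: "u \<bullet> (G *v e) = 0" "e \<bullet> (G *v u) = 0" if "u \<in> B" for u
      using wB[OF that] comm[of e u] by (simp_all add: e_def matrix_vector_mult_scaleR)
    have "e \<notin> B" using eB ee by fastforce
    then show ?case
      using B ee eB by (intro exI[of _ "insert e B"]) auto
  qed
  from this[OF order_refl] obtain B where B: "finite B" "card B = CARD('n)"
    "\<And>u v. u \<in> B \<Longrightarrow> v \<in> B \<Longrightarrow> u \<bullet> (G *v v) = (if u = v then 1 else 0)" by blast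
  obtain b where b: "bij_betw b (UNIV :: 'n set) B"
    using finite_same_card_bij[of "UNIV :: 'n set" B] B by auto
  define P :: "real^'n^'n" where "P = (\<chi> i j. b j $ i)"
  have "(transpose P ** (G ** P)) $ i $ j = b i \<bullet> (G *v b j)" for i j :: 'n
    by (simp add: matrix_matrix_mult_def transpose_def P_def matrix_vector_mult_def inner_vec_def)
  moreover have "b i \<bullet> (G *v b j) = (mat 1 :: real^'n^'n) $ i $ j" for i j :: 'n
    using b B(3) bij_betwE[OF b] by (auto simp: mat_def bij_betw_def inj_on_eq_iff)
  ultimately have "transpose P ** (G ** P) = mat 1" by (simp add: vec_eq_iff)
  then show ?thesis by blast
qed

lemma positive_definite_det:
  fixes G :: "real^'n::finite^'n"
  assumes "transpose G = G" "\<And>v. v \<noteq> 0 \<Longrightarrow> 0 < v \<bullet> (G *v v)"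
  shows "0 < det G"
proof -
  from linear_orthonormal_frame[OF assms] obtain P :: "real^'n^'n" where "transpose P ** (G ** P) = mat 1" by blast
  then have "det P * (det G * det P) = 1" by (metis det_I det_mul det_transpose)
  then have "(det P)\<^sup>2 * det G = 1" by (simp add: power2_eq_square algebra_simps)
  then show ?thesis by (metis zero_le_power2 zero_less_mult_pos zero_less_one mult_zero_left order_le_less)
qed

text \<open>The distribution of the norm under Lebesgue measure is determined by the volumes of the balls
  \<open>norm x < r\<close>, and these are the integrals of the stated density.\<close>

lemma nn_integral_radial:
  fixes f :: "real \<Rightarrow> ennreal"
  assumes [measurable]: "f \<in> borel_measurable borel"
  shows "(\<integral>\<^sup>+x. f (norm (x :: 'a::euclidean_space)) \<partial>lborel) =
    (\<integral>\<^sup>+r. ennreal (DIM('a) * unit_ball_vol DIM('a) * r ^ (DIM('a) - 1)) * indicator {0..} r * f r \<partial>lborel)"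
proof -
  let ?n = "DIM('a)" and ?b = "unit_ball_vol (real DIM('a))"
  let ?d = "\<lambda>r. ennreal (?n * ?b * r ^ (?n - 1)) * indicator {0..} r"
  have b0: "0 \<le> ?b" by simp
  have m: "?d \<in> borel_measurable lborel" by simp
  have lessThan_borel: "{..<r} \<in> sets lborel" for r :: real by simp
  have n0: "0 < ?n" by simp
  have eq: "emeasure (distr lborel borel (norm :: 'a \<Rightarrow> real)) {..<r} = emeasure (density lborel ?d) {..<r}"
    and fin: "emeasure (distr lborel borel (norm :: 'a \<Rightarrow> real)) {..<r} \<noteq> \<infinity>" for r
  proof -
    have pre: "norm -` {..<r} = ball (0 :: 'a) r" by auto
    have e1: "emeasure (distr lborel borel (norm :: 'a \<Rightarrow> real)) {..<r} = emeasure lborel (ball (0 :: 'a) r)"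
      by (subst emeasure_distr) (auto simp: pre)
    then show "emeasure (distr lborel borel (norm :: 'a \<Rightarrow> real)) {..<r} \<noteq> \<infinity>"
      using emeasure_bounded_finite[of "ball (0 :: 'a) r"] by simp
    show "emeasure (distr lborel borel (norm :: 'a \<Rightarrow> real)) {..<r} = emeasure (density lborel ?d) {..<r}"
    proof (cases "0 \<le> r")
      case True
      have "emeasure (density lborel ?d) {..<r} = (\<integral>\<^sup>+x. ?d x * indicator {..<r} x \<partial>lborel)"
        by (subst emeasure_density) auto
      also have "\<dots> = (\<integral>\<^sup>+x. ennreal (?n * ?b * x ^ (?n - 1)) * indicator {0..r} x \<partial>lborel)"
      proof (rule nn_integral_cong_AE)
        have "AE x in lborel. x \<noteq> r" by (rule AE_lborel_singleton)
        then show "AE x in lborel. ?d x * indicator {..<r} x = ennreal (?n * ?b * x ^ (?n - 1)) * indicator {0..r} x"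
          by eventually_elim (auto simp: indicator_def)
      qed
      also have "\<dots> = ennreal (?b * r ^ ?n - ?b * 0 ^ ?n)"
        using True b0
        by (intro nn_integral_FTC_Icc) (auto intro!: derivative_eq_intros)
      also have "\<dots> = emeasure lborel (ball (0 :: 'a) r)"
        using True n0 by (simp add: emeasure_ball)
      finally show ?thesis using e1 by simp
    next
      case False
      then have "(\<lambda>x. ?d x * indicator {..<r} x) = (\<lambda>x. 0)"
        by (auto simp: fun_eq_iff indicator_def)
      then have "emeasure (density lborel ?d) {..<r} = (\<integral>\<^sup>+(x::real). 0 \<partial>lborel)"
        by (simp only: emeasure_density[OF m lessThan_borel])
      moreover have "emeasure lborel (ball (0 :: 'a) r) = 0"
      proof -
        have "ball (0 :: 'a) r = {}" using False by simp
        then show ?thesis by (simp only: emeasure_empty)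
      qed
      ultimately show ?thesis using e1 by simp
    qed
  qed
  have "distr lborel borel (norm :: 'a \<Rightarrow> real) = density lborel ?d"
  proof (rule measure_eqI_generator_eq[where E = "range lessThan" and A = "\<lambda>i. {..<real i}" and \<Omega> = UNIV])
    show "Int_stable (range (lessThan :: real \<Rightarrow> _))"
    proof -
      have "{..<a} \<inter> {..<b} = {..<min a b}" for a b :: real by auto
      then show ?thesis unfolding Int_stable_def by auto
    qed
    show "(\<Union>i. {..<real i}) = UNIV" by (auto intro: reals_Archimedean2)
    have "sets borel = sigma_sets UNIV (range (lessThan :: real \<Rightarrow> _))"
      by (subst borel_Iio) auto
    then show "sets (distr lborel borel (norm :: 'a \<Rightarrow> real)) = sigma_sets UNIV (range lessThan)"
      "sets (density lborel ?d) = sigma_sets UNIV (range lessThan)" by simp_all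
  qed (use eq fin in auto)
  then have "(\<integral>\<^sup>+r. f r \<partial>distr lborel borel (norm :: 'a \<Rightarrow> real)) = (\<integral>\<^sup>+r. f r \<partial>density lborel ?d)"
    by simp
  then show ?thesis
    by (subst (asm) nn_integral_distr, simp, simp) (simp add: nn_integral_density)
qed

section \<open>Charts and Borel sets\<close>

lemma smooth_on_imp_continuous_on:
  assumes "smooth_on f S"
  shows "continuous_on S f"
proof (rule continuous_on_eq_continuous_within[THEN iffD2], rule ballI)
  fix x assume x: "x \<in> S"
  with assms obtain U F where U: "open U" "x \<in> U" "\<forall>k. Ck_on k F U" "\<forall>y\<in>S \<inter> U. F y = f y"
    unfolding smooth_on_def by blast
  from U(3) have "Ck_on 0 F U" by blast
  then have "isCont F x" using U(1,2) by (simp add: continuous_on_eq_continuous_at)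
  then have "continuous (at x within S) F" by (rule continuous_at_imp_continuous_at_within)
  moreover have "\<forall>\<^sub>F y in at x within S. F y = f y"
    using U by (auto simp: eventually_at_topological)
  ultimately show "continuous (at x within S) f"
    using U x by (metis Int_iff continuous_within filterlim_cong)
qed

lemma smooth_on_imp_has_derivative:
  assumes "smooth_on f S" "x \<in> S"
  shows "\<exists>J. (f has_derivative J) (at x within S)"
proof -
  from assms obtain U F where U: "open U" "x \<in> U" "\<forall>k. Ck_on k F U" "\<forall>y\<in>S \<inter> U. F y = f y"
    unfolding smooth_on_def by blast
  from U(3) have "Ck_on (Suc 0) F U" by blast
  then obtain J where "(F has_derivative J) (at x)"
    using U(2) by (auto simp: differentiable_def)
  then have F: "(F has_derivative J) (at x within S)" by (rule has_derivative_at_withinI)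
  from U(1,2) obtain e where "0 < e" "ball x e \<subseteq> U" by (metis openE)
  then have "(f has_derivative J) (at x within S)"
    using U(4) assms(2)
    by (intro has_derivative_transform_within[OF F]) (auto simp: dist_commute subset_iff)
  then show ?thesis by blast
qed

lemma continuous_on_det:
  fixes f :: "'b::topological_space \<Rightarrow> real^'n::finite^'n"
  assumes "continuous_on S f"
  shows "continuous_on S (\<lambda>x. det (f x))"
  unfolding det_def using assms by (intro continuous_intros)

lemma inner_matrix_left:
  fixes B :: "real^'m::finite^'n::finite"
  shows "(B *v x) \<bullet> y = x \<bullet> (transpose B *v y)"
  using dot_lmul_matrix[of y B x] by (simp add: inner_commute)

lemma space_borel_on [simp]: "space (borel_on X) = topspace X"
  unfolding borel_on_def by (rule space_measure_of) (auto dest: openin_subset)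

lemma sets_borel_on_open: "openin X U \<Longrightarrow> U \<in> sets (borel_on X)"
  unfolding borel_on_def by (subst sets_measure_of) (auto dest: openin_subset)

lemma measurable_borel_onI:
  assumes "\<And>x. x \<in> space M \<Longrightarrow> f x \<in> topspace X"
    and "\<And>U. openin X U \<Longrightarrow> f -` U \<inter> space M \<in> sets M"
  shows "f \<in> measurable M (borel_on X)"
  unfolding borel_on_def
  by (rule measurable_measure_of) (use assms in \<open>auto dest: openin_subset\<close>)

lemma openin_borel_set:
  assumes "model_space H" "openin (top_of_set H) S"
  shows "S \<in> sets borel"
proof -
  have "closed H"
    using assms(1) closed_halfspace_component_ge_cart[of 0] by (auto simp: model_space_def)
  moreover obtain T where "open T" "S = H \<inter> T"
    using assms(2) by (auto simp: openin_open)
  ultimately show ?thesis by auto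
qed

context smooth_manifold
begin

lemma chart_dom_open: "c \<in> A \<Longrightarrow> openin X (chart_dom c)"
  using charts by (auto simp: is_chart_def)

lemma chart_dom_subset: "c \<in> A \<Longrightarrow> chart_dom c \<subseteq> topspace X"
  using chart_dom_open openin_subset by blast

lemma chart_dom_borel: "c \<in> A \<Longrightarrow> chart_dom c \<in> sets (borel_on X)"
  by (intro sets_borel_on_open chart_dom_open)

lemma chart_dom_space: "c \<in> A \<Longrightarrow> chart_dom c \<inter> topspace X \<in> sets (borel_on X)"
  by (intro sets.Int chart_dom_borel sets_borel_on_open openin_topspace)

lemma coord_inj: "c \<in> A \<Longrightarrow> inj_on (coord c) (chart_dom c)"
  using charts[of c] chart_dom_subset[of c]
    homeomorphic_imp_injective_map[of "subtopology X (chart_dom c)" "top_of_set (chart_img c)" "coord c"]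
  by (simp add: is_chart_def topspace_subtopology Int_absorb1)

lemma coord_inv_coord: "c \<in> A \<Longrightarrow> p \<in> chart_dom c \<Longrightarrow> coord_inv c (coord c p) = p"
  by (simp add: coord_inv_def coord_inj)

lemma coord_inv_in: "x \<in> chart_img c \<Longrightarrow> coord_inv c x \<in> chart_dom c"
  by (simp add: coord_inv_def chart_img_def inv_into_into)

lemma coord_coord_inv: "x \<in> chart_img c \<Longrightarrow> coord c (coord_inv c x) = x"
  by (simp add: coord_inv_def chart_img_def f_inv_into_f)

lemma coord_in: "p \<in> chart_dom c \<Longrightarrow> coord c p \<in> chart_img c"
  by (simp add: chart_img_def)

lemma coord_image_eq:
  assumes "c \<in> A" "E \<subseteq> chart_dom c"
  shows "coord c ` E = {x \<in> chart_img c. coord_inv c x \<in> E}"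
proof (intro set_eqI iffI)
  fix x assume "x \<in> coord c ` E"
  then obtain p where "p \<in> E" "x = coord c p" by blast
  with assms show "x \<in> {x \<in> chart_img c. coord_inv c x \<in> E}"
    using coord_inv_coord[of c p] coord_in[of p c] by auto
next
  fix x assume "x \<in> {x \<in> chart_img c. coord_inv c x \<in> E}"
  then show "x \<in> coord c ` E" using coord_coord_inv[of x c] by (intro image_eqI[of _ _ "coord_inv c x"]) auto
qed

lemma chart_img_borel: "c \<in> A \<Longrightarrow> chart_img c \<in> sets borel"
  using charts[of c] openin_borel_set unfolding is_chart_def by blast

lemma continuous_coord: "c \<in> A \<Longrightarrow> continuous_map (subtopology X (chart_dom c)) euclidean (coord c)"
  using charts[of c] homeomorphic_imp_continuous_map continuous_map_into_fulltopology
  unfolding is_chart_def by blast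

lemma openin_coord_image:
  assumes "c \<in> A" "openin X U" "U \<subseteq> chart_dom c"
  shows "openin (top_of_set (chart_img c)) (coord c ` U)"
proof -
  have "open_map (subtopology X (chart_dom c)) (top_of_set (chart_img c)) (coord c)"
    using charts[OF assms(1)] homeomorphic_imp_open_map by (auto simp: is_chart_def)
  moreover have "openin (subtopology X (chart_dom c)) U"
    using assms by (simp add: openin_open_subtopology chart_dom_open)
  ultimately show ?thesis by (simp add: open_map_def)
qed

lemma openin_coord_vimage:
  assumes "c \<in> A" "open U"
  shows "openin X {p \<in> chart_dom c. coord c p \<in> U}"
proof -
  have top: "topspace (subtopology X (chart_dom c)) = chart_dom c"
    using chart_dom_subset[OF assms(1)] by (auto simp: topspace_subtopology)
  have "openin (subtopology X (chart_dom c)) {p \<in> topspace (subtopology X (chart_dom c)). coord c p \<in> U}"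
    using continuous_coord[OF assms(1)] assms(2) unfolding continuous_map_def by simp
  then have "openin (subtopology X (chart_dom c)) {p \<in> chart_dom c. coord c p \<in> U}"
    unfolding top .
  then show ?thesis
    by (meson assms(1) chart_dom_open openin_trans_full)
qed

lemma measurable_coord:
  assumes "c \<in> A"
  shows "coord c \<in> borel_measurable (restrict_space (borel_on X) (chart_dom c))"
proof (rule borel_measurableI)
  fix S :: "(real^'n) set" assume "open S"
  have "coord c -` S \<inter> space (restrict_space (borel_on X) (chart_dom c)) = {p \<in> chart_dom c. coord c p \<in> S}"
    using chart_dom_subset[OF assms] by (auto simp: space_restrict_space)
  also have "\<dots> \<in> sets (restrict_space (borel_on X) (chart_dom c))"
    using openin_coord_vimage[OF assms \<open>open S\<close>, THEN sets_borel_on_open] chart_dom_space[OF assms]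
    by (subst sets_restrict_space_iff) auto
  finally show "coord c -` S \<inter> space (restrict_space (borel_on X) (chart_dom c))
      \<in> sets (restrict_space (borel_on X) (chart_dom c))" .
qed

lemma measurable_coord_inv:
  assumes c: "c \<in> A"
  shows "coord_inv c \<in> measurable (restrict_space borel (chart_img c)) (restrict_space (borel_on X) (chart_dom c))"
proof (rule measurable_restrict_space2)
  show "coord_inv c \<in> space (restrict_space borel (chart_img c)) \<rightarrow> chart_dom c"
    by (auto simp: space_restrict_space coord_inv_in)
  show "coord_inv c \<in> measurable (restrict_space borel (chart_img c)) (borel_on X)"
  proof (rule measurable_borel_onI)
    show "coord_inv c x \<in> topspace X" if "x \<in> space (restrict_space borel (chart_img c))" for x
      using that chart_dom_subset[OF c] coord_inv_in[of x c] by (auto simp: space_restrict_space)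
    fix U assume U: "openin X U"
    have "coord_inv c -` U \<inter> space (restrict_space borel (chart_img c)) = coord c ` (U \<inter> chart_dom c)"
      by (subst coord_image_eq[OF c]) (auto simp: space_restrict_space coord_inv_def chart_img_def inv_into_into)
    moreover have "openin (top_of_set (chart_img c)) (coord c ` (U \<inter> chart_dom c))"
      using c U by (intro openin_coord_image openin_Int chart_dom_open) auto
    then obtain T where "open T" "coord c ` (U \<inter> chart_dom c) = chart_img c \<inter> T"
      by (auto simp: openin_open)
    ultimately show "coord_inv c -` U \<inter> space (restrict_space borel (chart_img c))
        \<in> sets (restrict_space borel (chart_img c))"
      using chart_img_borel[OF c] by (auto simp: sets_restrict_space)
  qed
qed

lemma coord_image_borel:
  assumes c: "c \<in> A" and E: "E \<in> sets (borel_on X)" "E \<subseteq> chart_dom c"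
  shows "coord c ` E \<in> sets borel"
proof -
  have "E \<in> sets (restrict_space (borel_on X) (chart_dom c))"
    using E chart_dom_space[OF c] by (subst sets_restrict_space_iff) auto
  from measurable_sets[OF measurable_coord_inv[OF c] this]
  have "coord_inv c -` E \<inter> chart_img c \<in> sets (restrict_space borel (chart_img c))"
    by (simp add: space_restrict_space)
  then have "coord_inv c -` E \<inter> chart_img c \<in> sets borel"
    using chart_img_borel[OF c] by (subst (asm) sets_restrict_space_iff) auto
  moreover have "coord c ` E = coord_inv c -` E \<inter> chart_img c"
    using E coord_image_eq[OF c] by auto
  ultimately show ?thesis by simp
qed

text \<open>A second countable space is Lindelof. Countably many charts are what a measure can be glued from.\<close>

lemma countable_atlas:
  obtains C :: "nat \<Rightarrow> ('a, 'n) chart" where "\<And>i. C i \<in> A" "(\<Union>i. chart_dom (C i)) = topspace X"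
proof -
  obtain \<V> where V: "countable \<V>" "\<V> \<subseteq> chart_dom ` A" "\<Union>\<V> = topspace X"
    using Lindelof_spaceD[OF second_countable_imp_Lindelof_space[OF second_countable], of "chart_dom ` A"]
      chart_dom_open cover by (metis (no_types, lifting) imageE)
  have "\<V> \<noteq> {}" using V(3) nonempty by (metis Union_empty)
  have "\<exists>c. c \<in> A \<and> chart_dom c = from_nat_into \<V> i" for i
    using from_nat_into[OF \<open>\<V> \<noteq> {}\<close>, of i] V(2) by force
  then obtain C where C: "\<And>i. C i \<in> A" "\<And>i. chart_dom (C i) = from_nat_into \<V> i" by metis
  show ?thesis
    by (rule that[of C]) (use C V \<open>\<V> \<noteq> {}\<close> range_from_nat_into in auto)
qed

lemma transition_has_derivative:
  assumes "c \<in> A" "d \<in> A" "p \<in> chart_dom c \<inter> chart_dom d"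
  shows "\<exists>J. (transition c d has_derivative J) (at (coord c p) within coord c ` (chart_dom c \<inter> chart_dom d))"
  using compatible[OF assms(1,2)] assms(3) by (intro smooth_on_imp_has_derivative) auto

lemma transition_coord: "c \<in> A \<Longrightarrow> p \<in> chart_dom c \<Longrightarrow> transition c d (coord c p) = coord d p"
  by (simp add: transition_def coord_inv_coord)

end

section \<open>Existence and uniqueness of the Riemannian volume\<close>

context riemannian_manifold
begin

definition vol_density :: "('a, 'n) chart \<Rightarrow> real^'n \<Rightarrow> real" where
  "vol_density c x = sqrt (det (g c (coord_inv c x)))"

definition chart_measure :: "('a, 'n) chart \<Rightarrow> (real^'n) measure" where
  "chart_measure c = density lborel (\<lambda>x. ennreal (indicator (chart_img c) x * vol_density c x))"

lemma det_metric_pos: "c \<in> A \<Longrightarrow> p \<in> chart_dom c \<Longrightarrow> 0 < det (g c p)"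
  by (intro positive_definite_det symmetric positive)

lemma continuous_on_metric: "c \<in> A \<Longrightarrow> continuous_on (chart_img c) (\<lambda>x. g c (coord_inv c x))"
  using smooth_on_imp_continuous_on[OF smooth] by (simp add: o_def)

lemma continuous_on_vol_density: "c \<in> A \<Longrightarrow> continuous_on (chart_img c) (vol_density c)"
  unfolding vol_density_def
  by (intro continuous_intros continuous_on_det continuous_on_metric)

lemma vol_density_pos: "c \<in> A \<Longrightarrow> x \<in> chart_img c \<Longrightarrow> 0 < vol_density c x"
  using det_metric_pos[OF _ coord_inv_in] by (simp add: vol_density_def)

lemma measurable_vol_density:
  assumes "c \<in> A" "S \<in> sets borel" "S \<subseteq> chart_img c"
  shows "(\<lambda>x. indicator S x * vol_density c x) \<in> borel_measurable borel"
  using borel_measurable_continuous_on_indicator[OF assms(2) continuous_on_subset[OF continuous_on_vol_density assms(3)]]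
    assms(1) by simp

lemma emeasure_chart_measure:
  assumes c: "c \<in> A" and S: "S \<in> sets borel" "S \<subseteq> chart_img c"
  shows "emeasure (chart_measure c) S = (\<integral>\<^sup>+x. ennreal (vol_density c x) * indicator S x \<partial>lborel)"
proof -
  have "emeasure (chart_measure c) S =
      (\<integral>\<^sup>+x. ennreal (indicator (chart_img c) x * vol_density c x) * indicator S x \<partial>lborel)"
    unfolding chart_measure_def
    using measurable_vol_density[OF c chart_img_borel[OF c]] S by (subst emeasure_density) auto
  also have "\<dots> = (\<integral>\<^sup>+x. ennreal (vol_density c x) * indicator S x \<partial>lborel)"
    using S by (intro nn_integral_cong) (auto simp: indicator_def)
  finally show ?thesis .
qed

text \<open>By the transformation law, \<open>g c\<close> and \<open>g d\<close> differ by the derivative of the transition map on both sides, so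
  the determinants differ by the square of the Jacobian: this is the factor in the change of variables.\<close>

lemma chart_measure_overlap:
  assumes c: "c \<in> A" and d: "d \<in> A" and E: "E \<in> sets (borel_on X)" "E \<subseteq> chart_dom c \<inter> chart_dom d"
  shows "emeasure (chart_measure c) (coord c ` E) = emeasure (chart_measure d) (coord d ` E)"
proof -
  let ?T = "transition c d" and ?S = "coord c ` E"
  let ?W = "coord c ` (chart_dom c \<inter> chart_dom d)"
  have "\<exists>J. (?T has_derivative J) (at x within ?W)" if "x \<in> ?S" for x
    using transition_has_derivative[OF c d] that E by blast
  then obtain J where J: "\<And>x. x \<in> ?S \<Longrightarrow> (?T has_derivative J x) (at x within ?W)" by metis
  have TS: "?T ` ?S = coord d ` E"
    unfolding image_image using E transition_coord[OF c, of _ d] by (intro image_cong) auto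
  have bor: "coord c ` E \<in> sets borel" "coord c ` E \<subseteq> chart_img c"
    "coord d ` E \<in> sets borel" "coord d ` E \<subseteq> chart_img d"
    using coord_image_borel[OF c E(1)] coord_image_borel[OF d E(1)] E by (auto simp: chart_img_def)
  have dens: "\<bar>det (matrix (J x))\<bar> * vol_density d (?T x) = vol_density c x" if "x \<in> ?S" for x
  proof -
    from that obtain p where p: "p \<in> E" "x = coord c p" by blast
    then have pc: "p \<in> chart_dom c" "p \<in> chart_dom d" using E by auto
    let ?M = "matrix (J x)"
    have lin: "linear (J x)" using J[OF that] by (rule has_derivative_linear)
    have "v \<bullet> (g c p *v w) = v \<bullet> ((transpose ?M ** (g d p ** ?M)) *v w)" for v w
    proof -
      have "v \<bullet> (g c p *v w) = J x v \<bullet> (g d p *v J x w)"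
        using transform[OF c d _ J[OF that, unfolded p(2)]] pc p(2) by blast
      also have "\<dots> = (?M *v v) \<bullet> (g d p *v (?M *v w))"
        using lin by (simp add: matrix_works)
      also have "\<dots> = v \<bullet> (transpose ?M *v (g d p *v (?M *v w)))"
        by (rule inner_matrix_left)
      finally show ?thesis by (simp add: matrix_vector_mul_assoc)
    qed
    then have "\<forall>v. v \<bullet> (g c p *v w) = v \<bullet> ((transpose ?M ** (g d p ** ?M)) *v w)" for w
      by blast
    then have "g c p *v w = (transpose ?M ** (g d p ** ?M)) *v w" for w
      by (simp only: vector_eq_ldot)
    then have "g c p = transpose ?M ** (g d p ** ?M)"
      by (simp add: matrix_eq)
    then have "det (g c p) = (det ?M)\<^sup>2 * det (g d p)"
      by (simp add: det_mul det_transpose power2_eq_square)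
    then show ?thesis
      using pc p transition_coord[OF c pc(1)]
      by (simp add: vol_density_def coord_inv_coord c d real_sqrt_mult)
  qed
  have "(\<integral>\<^sup>+y. ennreal (vol_density d y) * indicator (?T ` ?S) y \<partial>lborel) =
    (\<integral>\<^sup>+x. ennreal (\<bar>det (matrix (J x))\<bar> * vol_density d (?T x)) * indicator ?S x \<partial>lborel)"
  proof (rule nn_integral_change_of_variables)
    show "(?T has_derivative J x) (at x within ?S)" if "x \<in> ?S" for x
      using J[OF that] by (rule has_derivative_subset) (use E in blast)
    show "inj_on ?T ?S"
      using E coord_inj[OF d] transition_coord[OF c, of _ d] by (auto simp: inj_on_def subset_iff)
    show "0 \<le> vol_density d (?T x)" if "x \<in> ?S" for x
    proof -
      have "?T x \<in> chart_img d" using that bor(4) TS by blast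
      then show ?thesis using vol_density_pos[OF d] by force
    qed
    show "(\<lambda>y. indicator (?T ` ?S) y * vol_density d y) \<in> borel_measurable borel"
      unfolding TS by (rule measurable_vol_density[OF d bor(3,4)])
    have "(\<lambda>x. indicator ?S x * (\<bar>det (matrix (J x))\<bar> * vol_density d (?T x))) =
        (\<lambda>x. indicator ?S x * vol_density c x)"
      using dens by (auto simp: fun_eq_iff indicator_def)
    then show "(\<lambda>x. indicator ?S x * (\<bar>det (matrix (J x))\<bar> * vol_density d (?T x))) \<in> borel_measurable borel"
      using measurable_vol_density[OF c bor(1,2)] by simp
  qed (use bor in auto)
  also have "\<dots> = (\<integral>\<^sup>+x. ennreal (vol_density c x) * indicator ?S x \<partial>lborel)"
    using dens by (intro nn_integral_cong) (auto simp: indicator_def)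
  finally show ?thesis
    unfolding TS emeasure_chart_measure[OF c bor(1,2)] emeasure_chart_measure[OF d bor(3,4)] by simp
qed

text \<open>The property that the description in \<open>riemannian_volume\<close> refers to, with the integral over the
  chart image written as \<open>chart_measure\<close>.\<close>

definition is_volume :: "'a measure \<Rightarrow> bool" where
  "is_volume \<mu> \<longleftrightarrow> sets \<mu> = sets (borel_on X) \<and>
     (\<forall>c\<in>A. \<forall>E\<in>sets (borel_on X). E \<subseteq> chart_dom c \<longrightarrow>
        emeasure \<mu> E = emeasure (chart_measure c) (coord c ` E))"

lemma chart_measure_suminf:
  assumes c: "c \<in> A" and E: "\<And>i::nat. E i \<in> sets (borel_on X)" "\<And>i. E i \<subseteq> chart_dom c" "disjoint_family E"
  shows "(\<Sum>i. emeasure (chart_measure c) (coord c ` E i)) = emeasure (chart_measure c) (coord c ` (\<Union>i. E i))"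
proof -
  have "disjoint_family (\<lambda>i. coord c ` E i)"
    using E(2,3) coord_inj[OF c] by (auto simp: disjoint_family_on_def inj_on_def) blast
  moreover have "range (\<lambda>i. coord c ` E i) \<subseteq> sets (chart_measure c)"
    using coord_image_borel[OF c E(1,2)] by (auto simp: chart_measure_def)
  ultimately show ?thesis
    by (simp add: suminf_emeasure image_UN)
qed

lemma disjoint_chart_pieces:
  obtains C :: "nat \<Rightarrow> ('a, 'n) chart" and D where "\<And>i. C i \<in> A" "\<And>i. D i \<subseteq> chart_dom (C i)"
    "\<And>i. D i \<in> sets (borel_on X)" "disjoint_family D" "(\<Union>i. D i) = topspace X"
proof -
  obtain C :: "nat \<Rightarrow> ('a, 'n) chart" where C: "\<And>i. C i \<in> A" "(\<Union>i. chart_dom (C i)) = topspace X"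
    by (rule countable_atlas) blast
  let ?D = "disjointed (\<lambda>i. chart_dom (C i))"
  show ?thesis
  proof (rule that[of C ?D])
    show "?D i \<in> sets (borel_on X)" for i
    proof -
      have "range (\<lambda>i. chart_dom (C i)) \<subseteq> sets (borel_on X)" using chart_dom_borel[OF C(1)] by blast
      from sets.range_disjointed_sets[OF this] show ?thesis by blast
    qed
    show "?D i \<subseteq> chart_dom (C i)" for i by (rule disjointed_subset)
    show "(\<Union>i. ?D i) = topspace X" using C(2) by (simp add: UN_disjointed_eq)
  qed (rule C(1) disjoint_family_disjointed)+
qed

text \<open>Every Borel set is a countable disjoint union of sets that lie in one chart domain each.\<close>

lemma is_volume_unique:
  assumes "is_volume \<mu>" "is_volume \<nu>"
  shows "\<mu> = \<nu>"
proof (rule measure_eqI)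
  show s: "sets \<mu> = sets \<nu>" using assms by (simp add: is_volume_def)
  fix E assume "E \<in> sets \<mu>"
  then have E: "E \<in> sets (borel_on X)" using assms by (simp add: is_volume_def)
  obtain C :: "nat \<Rightarrow> ('a, 'n) chart" and D where D: "\<And>i. C i \<in> A" "\<And>i. D i \<subseteq> chart_dom (C i)"
    "\<And>i. D i \<in> sets (borel_on X)" "disjoint_family D" "(\<Union>i. D i) = topspace X"
    by (rule disjoint_chart_pieces) blast
  have "emeasure \<kappa> E = (\<Sum>i. emeasure (chart_measure (C i)) (coord (C i) ` (E \<inter> D i)))" if "is_volume \<kappa>" for \<kappa>
  proof -
    have "emeasure \<kappa> (E \<inter> D i) = emeasure (chart_measure (C i)) (coord (C i) ` (E \<inter> D i))" for i
    proof -
      have "E \<inter> D i \<in> sets (borel_on X)" "E \<inter> D i \<subseteq> chart_dom (C i)" using E D by auto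
      then show ?thesis using that D(1) unfolding is_volume_def by blast
    qed
    then have "(\<Sum>i. emeasure (chart_measure (C i)) (coord (C i) ` (E \<inter> D i))) = (\<Sum>i. emeasure \<kappa> (E \<inter> D i))"
      by simp
    also have "\<dots> = emeasure \<kappa> (\<Union>i. E \<inter> D i)"
      using that E D(3,4) by (intro suminf_emeasure) (auto simp: is_volume_def disjoint_family_on_def)
    also have "(\<Union>i. E \<inter> D i) = E" using D(5) sets.sets_into_space[OF E] by auto
    finally show ?thesis by simp
  qed
  then show "emeasure \<mu> E = emeasure \<nu> E" using assms by simp
qed

text \<open>The measure is the sum over disjoint pieces of a countable atlas. That it agrees with the measure of
  every chart, and not only of those in the selection, is \<open>chart_measure_overlap\<close> on each piece.\<close>

lemma is_volume_exists: "\<exists>\<mu>. is_volume \<mu>"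
proof -
  obtain C :: "nat \<Rightarrow> ('a, 'n) chart" and D where D: "\<And>i. C i \<in> A" "\<And>i. D i \<subseteq> chart_dom (C i)"
    "\<And>i. D i \<in> sets (borel_on X)" "disjoint_family D" "(\<Union>i. D i) = topspace X"
    by (rule disjoint_chart_pieces) blast
  define m where "m E = (\<Sum>i. emeasure (chart_measure (C i)) (coord (C i) ` (E \<inter> D i)))" for E
  define \<mu> where "\<mu> = measure_of (topspace X) (sets (borel_on X)) m"
  have sets: "sets \<mu> = sets (borel_on X)"
    unfolding \<mu>_def using sets.sets_measure_of_eq[of "borel_on X"] by simp
  have ca: "countably_additive (sets (borel_on X)) m"
    unfolding countably_additive_def
  proof (intro allI impI)
    fix F :: "nat \<Rightarrow> 'a set"
    assume F: "range F \<subseteq> sets (borel_on X)" "disjoint_family F"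
    \<comment> \<open>the two sums are interchanged by writing one of them as an integral over the counting measure\<close>
    have "(\<Sum>k. m (F k)) = (\<Sum>k. \<integral>\<^sup>+i. emeasure (chart_measure (C i)) (coord (C i) ` (F k \<inter> D i)) \<partial>count_space UNIV)"
      by (simp add: m_def nn_integral_count_space_nat)
    also have "\<dots> = (\<integral>\<^sup>+i. (\<Sum>k. emeasure (chart_measure (C i)) (coord (C i) ` (F k \<inter> D i))) \<partial>count_space UNIV)"
      by (rule nn_integral_suminf[symmetric]) simp
    also have "\<dots> = (\<integral>\<^sup>+i. emeasure (chart_measure (C i)) (coord (C i) ` (\<Union>k. F k \<inter> D i)) \<partial>count_space UNIV)"
    proof (rule nn_integral_cong)
      fix i
      show "(\<Sum>k. emeasure (chart_measure (C i)) (coord (C i) ` (F k \<inter> D i))) =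
          emeasure (chart_measure (C i)) (coord (C i) ` (\<Union>k. F k \<inter> D i))"
      proof (rule chart_measure_suminf[OF D(1)])
        show "F k \<inter> D i \<in> sets (borel_on X)" for k using F(1) D(3)[of i] by (intro sets.Int) auto
        show "F k \<inter> D i \<subseteq> chart_dom (C i)" for k using D(2)[of i] by auto
        show "disjoint_family (\<lambda>k. F k \<inter> D i)" using F(2) by (fastforce simp: disjoint_family_on_def)
      qed
    qed
    also have "\<dots> = m (\<Union>(range F))"
      by (simp add: m_def nn_integral_count_space_nat)
    finally show "(\<Sum>k. m (F k)) = m (\<Union>(range F))" .
  qed
  have em: "emeasure \<mu> E = m E" if "E \<in> sets (borel_on X)" for E
    unfolding \<mu>_def
  proof (rule emeasure_measure_of_sigma[OF _ _ ca that])
    show "sigma_algebra (topspace X) (sets (borel_on X))"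
      using sets.sigma_algebra_axioms[of "borel_on X"] by simp
    show "positive (sets (borel_on X)) m" by (simp add: positive_def m_def)
  qed
  have "emeasure \<mu> E = emeasure (chart_measure c) (coord c ` E)"
    if c: "c \<in> A" and E: "E \<in> sets (borel_on X)" "E \<subseteq> chart_dom c" for c E
  proof -
    have "m E = (\<Sum>i. emeasure (chart_measure c) (coord c ` (E \<inter> D i)))"
      unfolding m_def
    proof (rule suminf_cong)
      show "emeasure (chart_measure (C i)) (coord (C i) ` (E \<inter> D i)) = emeasure (chart_measure c) (coord c ` (E \<inter> D i))" for i
        by (rule chart_measure_overlap[OF D(1) c]) (use E D(2)[of i] D(3) in auto)
    qed
    also have "\<dots> = emeasure (chart_measure c) (coord c ` (\<Union>i. E \<inter> D i))"
    proof (rule chart_measure_suminf[OF c])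
      show "E \<inter> D i \<in> sets (borel_on X)" "E \<inter> D i \<subseteq> chart_dom c" for i using E D(3)[of i] by auto
      show "disjoint_family (\<lambda>i. E \<inter> D i)" using D(4) by (fastforce simp: disjoint_family_on_def)
    qed
    also have "(\<Union>i. E \<inter> D i) = E" using D(5) sets.sets_into_space[OF E(1)] by auto
    finally show ?thesis using em[OF E(1)] by simp
  qed
  then have "is_volume \<mu>" using sets by (simp add: is_volume_def)
  then show ?thesis ..
qed

abbreviation vol :: "'a measure" where "vol \<equiv> riemannian_volume X A g"

lemma is_volume_riemannian_volume: "is_volume vol"
proof -
  have "is_volume = (\<lambda>\<mu>. sets \<mu> = sets (borel_on X) \<and>
        (\<forall>c\<in>A. \<forall>E\<in>sets (borel_on X). E \<subseteq> chart_dom c \<longrightarrow>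
           emeasure \<mu> E =
             (\<integral>\<^sup>+x. ennreal (sqrt (det (g c (coord_inv c x)))) * indicator (coord c ` E) x \<partial>lborel)))"
  proof (rule ext)
    have "emeasure (chart_measure c) (coord c ` E) =
        (\<integral>\<^sup>+x. ennreal (sqrt (det (g c (coord_inv c x)))) * indicator (coord c ` E) x \<partial>lborel)"
      if "c \<in> A" "E \<in> sets (borel_on X)" "E \<subseteq> chart_dom c" for c E
    proof -
      have "coord c ` E \<subseteq> chart_img c" using that(3) by (auto simp: chart_img_def)
      from emeasure_chart_measure[OF that(1) coord_image_borel[OF that] this]
      show ?thesis by (simp add: vol_density_def)
    qed
    then show "is_volume \<mu> = (sets \<mu> = sets (borel_on X) \<and>
        (\<forall>c\<in>A. \<forall>E\<in>sets (borel_on X). E \<subseteq> chart_dom c \<longrightarrow>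
           emeasure \<mu> E =
             (\<integral>\<^sup>+x. ennreal (sqrt (det (g c (coord_inv c x)))) * indicator (coord c ` E) x \<partial>lborel)))" for \<mu>
      unfolding is_volume_def by simp
  qed
  then have "vol = (THE \<mu>. is_volume \<mu>)"
    by (simp add: riemannian_volume_def)
  moreover have "is_volume (THE \<mu>. is_volume \<mu>)"
    using is_volume_exists is_volume_unique by (metis theI)
  ultimately show ?thesis by simp
qed

lemma sets_riemannian_volume [simp]: "sets vol = sets (borel_on X)"
  using is_volume_riemannian_volume by (simp add: is_volume_def)

lemma space_riemannian_volume [simp]: "space vol = topspace X"
  using sets_eq_imp_space_eq[OF sets_riemannian_volume] by simp

text \<open>On the domain of a chart the volume is the image of the chart measure under the inverse
  coordinate map.\<close>

lemma nn_integral_riemannian_volume_chart: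
  assumes c: "c \<in> A" and f: "f \<in> borel_measurable (borel_on X)"
  shows "(\<integral>\<^sup>+p. f p * indicator (chart_dom c) p \<partial>vol) =
    (\<integral>\<^sup>+x. f (coord_inv c x) * ennreal (vol_density c x) * indicator (chart_img c) x \<partial>lborel)"
proof -
  let ?\<mu> = "vol" and ?R = "restrict_space (chart_measure c) (chart_img c)"
  have dom: "chart_dom c \<inter> space ?\<mu> \<in> sets ?\<mu>"
    using chart_dom_space[OF c] by simp
  have img: "chart_img c \<inter> space (chart_measure c) \<in> sets (chart_measure c)"
    using chart_img_borel[OF c] by (auto simp: chart_measure_def)
  have setsR: "sets ?R = sets (restrict_space borel (chart_img c))"
    by (rule sets_restrict_space_cong) (simp add: chart_measure_def)
  have setsM: "sets (restrict_space ?\<mu> (chart_dom c)) = sets (restrict_space (borel_on X) (chart_dom c))"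
    by (rule sets_restrict_space_cong) simp
  have inv: "coord_inv c \<in> measurable ?R (restrict_space ?\<mu> (chart_dom c))"
    using measurable_coord_inv[OF c] by (simp add: measurable_cong_sets[OF setsR setsM])
  have "restrict_space ?\<mu> (chart_dom c) = distr ?R (restrict_space ?\<mu> (chart_dom c)) (coord_inv c)"
  proof (rule measure_eqI)
    fix E assume E': "E \<in> sets (restrict_space ?\<mu> (chart_dom c))"
    then have E: "E \<in> sets (borel_on X)" "E \<subseteq> chart_dom c"
      using sets_restrict_space_iff[OF dom] by auto
    have "emeasure (distr ?R (restrict_space ?\<mu> (chart_dom c)) (coord_inv c)) E =
        emeasure ?R (coord_inv c -` E \<inter> space ?R)"
      by (rule emeasure_distr[OF inv E'])
    also have "coord_inv c -` E \<inter> space ?R = coord c ` E"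
      using coord_image_eq[OF c E(2)] by (auto simp: space_restrict_space chart_measure_def)
    also have "emeasure ?R (coord c ` E) = emeasure (chart_measure c) (coord c ` E)"
      using E by (intro emeasure_restrict_space[OF img]) (auto simp: chart_img_def)
    also have "\<dots> = emeasure ?\<mu> E"
      using is_volume_riemannian_volume c E by (simp add: is_volume_def)
    also have "\<dots> = emeasure (restrict_space ?\<mu> (chart_dom c)) E"
      using E by (intro emeasure_restrict_space[OF dom, symmetric]) auto
    finally show "emeasure (restrict_space ?\<mu> (chart_dom c)) E =
        emeasure (distr ?R (restrict_space ?\<mu> (chart_dom c)) (coord_inv c)) E" by simp
  qed simp
  moreover have fm: "f \<in> borel_measurable (restrict_space ?\<mu> (chart_dom c))"
    using f by (intro measurable_restrict_space1) (simp add: measurable_cong_sets[OF sets_riemannian_volume refl])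
  ultimately have "(\<integral>\<^sup>+p. f p \<partial>restrict_space ?\<mu> (chart_dom c)) = (\<integral>\<^sup>+x. f (coord_inv c x) \<partial>?R)"
    by (metis nn_integral_distr inv measurable_distr_eq1)
  then have "(\<integral>\<^sup>+p. f p * indicator (chart_dom c) p \<partial>?\<mu>) =
      (\<integral>\<^sup>+x. f (coord_inv c x) * indicator (chart_img c) x \<partial>chart_measure c)"
    by (simp add: nn_integral_restrict_space[OF dom] nn_integral_restrict_space[OF img])
  also have "\<dots> = (\<integral>\<^sup>+x. ennreal (indicator (chart_img c) x * vol_density c x) *
      (f (coord_inv c x) * indicator (chart_img c) x) \<partial>lborel)"
    unfolding chart_measure_def
  proof (rule nn_integral_density)
    show "(\<lambda>x. ennreal (indicator (chart_img c) x * vol_density c x)) \<in> borel_measurable lborel"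
      using measurable_vol_density[OF c chart_img_borel[OF c]] by simp
    have "(\<lambda>x. f (coord_inv c x)) \<in> borel_measurable (restrict_space borel (chart_img c))"
      using measurable_compose[OF inv fm] by (simp add: measurable_cong_sets[OF setsR refl])
    then show "(\<lambda>x. f (coord_inv c x) * indicator (chart_img c) x) \<in> borel_measurable lborel"
      using chart_img_borel[OF c] by (subst (asm) borel_measurable_restrict_space_iff_ennreal) auto
  qed
  also have "\<dots> = (\<integral>\<^sup>+x. f (coord_inv c x) * ennreal (vol_density c x) * indicator (chart_img c) x \<partial>lborel)"
    by (intro nn_integral_cong) (auto simp: indicator_def mult.commute)
  finally show ?thesis .
qed

end

section \<open>Integration by parts\<close>

lemma has_derivative_zero_outside:
  fixes f :: "'a::real_normed_vector \<Rightarrow> 'b::real_normed_vector"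
  assumes "closed K" "\<And>x. x \<notin> K \<Longrightarrow> f x = 0" "x \<notin> K"
  shows "(f has_derivative (\<lambda>_. 0)) (at x)"
  by (rule has_derivative_transform_within_open[OF has_derivative_const, of "- K"])
    (use assms in \<open>auto simp: open_Compl\<close>)

text \<open>Difference quotients in direction \<open>e\<close> have integral 0, because Lebesgue measure is invariant under
  translations. They are bounded by the maximum of the derivative and vanish outside a fixed ball, so
  dominated convergence applies.\<close>

lemma integral_derivative_compact_support:
  fixes h :: "'a::euclidean_space \<Rightarrow> real"
  assumes h: "\<And>x. (h has_derivative h' x) (at x)"
    and cont: "continuous_on UNIV (\<lambda>x. h' x e)"
    and K: "compact K" "\<And>x. x \<notin> K \<Longrightarrow> h x = 0"
  shows "(\<integral>x. h' x e \<partial>lborel) = 0"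
proof -
  have hc: "continuous_on UNIV h"
    by (intro continuous_at_imp_continuous_on ballI has_derivative_continuous[OF h])
  have h'0: "h' x e = 0" if "x \<notin> K" for x
    using has_derivative_unique[OF has_derivative_zero_outside[OF compact_imp_closed[OF K(1)] K(2) that] h]
    by metis
  obtain M where M: "\<And>x. \<bar>h' x e\<bar> \<le> M"
  proof -
    have "bounded ((\<lambda>x. h' x e) ` K)"
      by (intro compact_imp_bounded compact_continuous_image K(1) continuous_on_subset[OF cont]) simp
    then obtain M where "\<forall>x\<in>K. \<bar>h' x e\<bar> \<le> M" by (auto simp: bounded_iff)
    then have "\<bar>h' x e\<bar> \<le> max M 0" for x using h'0[of x] by (cases "x \<in> K") auto
    then show ?thesis by (rule that)
  qed
  obtain R where R: "\<And>x. x \<in> K \<Longrightarrow> norm x \<le> R"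
    using compact_imp_bounded[OF K(1)] by (auto simp: bounded_iff)
  define q where "q m x = (h (x + e /\<^sub>R real (Suc m)) - h x) * real (Suc m)" for m x
  have deriv: "((\<lambda>t. h (x + t *\<^sub>R e)) has_real_derivative h' (x + t *\<^sub>R e) e) (at t)" for x t
  proof -
    have "((\<lambda>t. h (x + t *\<^sub>R e)) has_derivative (\<lambda>s. h' (x + t *\<^sub>R e) (s *\<^sub>R e))) (at t)"
      by (rule has_derivative_compose[OF _ h]) (auto intro!: derivative_eq_intros)
    moreover have "(\<lambda>s. h' (x + t *\<^sub>R e) (s *\<^sub>R e)) = (*) (h' (x + t *\<^sub>R e) e)"
      using linear_scale[OF has_derivative_linear[OF h]] by (simp add: fun_eq_iff mult.commute)
    ultimately show ?thesis by (simp add: has_field_derivative_def)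
  qed
  have lim: "(\<lambda>m. q m x) \<longlonglongrightarrow> h' x e" for x
  proof -
    have "((\<lambda>t. (h (x + t *\<^sub>R e) - h x) / t) \<longlongrightarrow> h' x e) (at 0)"
      using deriv[of x 0] by (simp add: DERIV_def)
    moreover have "filterlim (\<lambda>m. inverse (real (Suc m))) (at 0) sequentially"
      by (intro filterlim_atI LIMSEQ_inverse_real_of_nat) (simp add: eventually_sequentially)
    ultimately have "(\<lambda>m. (h (x + inverse (real (Suc m)) *\<^sub>R e) - h x) / inverse (real (Suc m))) \<longlonglongrightarrow> h' x e"
      by (rule filterlim_compose)
    then show ?thesis by (simp add: q_def divide_inverse)
  qed
  have bound: "\<bar>q m x\<bar> \<le> M" for m x
  proof -
    let ?t = "inverse (real (Suc m))"
    have "\<exists>z. 0 < z \<and> z < ?t \<and> h (x + ?t *\<^sub>R e) - h (x + 0 *\<^sub>R e) = (?t - 0) * h' (x + z *\<^sub>R e) e"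
      by (rule MVT2) (auto intro: deriv)
    then obtain z where "h (x + ?t *\<^sub>R e) - h x = ?t * h' (x + z *\<^sub>R e) e" by auto
    then have "q m x = h' (x + z *\<^sub>R e) e" by (simp add: q_def del: of_nat_Suc)
    then show ?thesis using M by simp
  qed
  have supp: "q m x = 0" if "x \<notin> cball 0 (R + norm e)" for m x
  proof -
    have n: "R + norm e < norm x" using that by simp
    have "inverse (real (Suc m)) * norm e \<le> 1 * norm e"
      by (intro mult_right_mono) (auto simp: divide_simps)
    then have "norm (e /\<^sub>R real (Suc m)) \<le> norm e" by simp
    then have "R < norm (x + e /\<^sub>R real (Suc m))"
      using n norm_triangle_ineq4[of "x + e /\<^sub>R real (Suc m)" "e /\<^sub>R real (Suc m)"] by simp
    then have "x + e /\<^sub>R real (Suc m) \<notin> K" using R by force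
    moreover have "x \<notin> K" using R[of x] n norm_ge_zero[of e] by linarith
    ultimately show ?thesis using K(2) by (simp add: q_def)
  qed
  have hb: "h \<in> borel_measurable borel" using hc by (rule borel_measurable_continuous_onI)
  have "(\<lambda>m. \<integral>x. q m x \<partial>lborel) \<longlonglongrightarrow> (\<integral>x. h' x e \<partial>lborel)"
  proof (rule integral_dominated_convergence[where w = "\<lambda>x. indicator (cball 0 (R + norm e)) x *\<^sub>R M"])
    show "(\<lambda>x. h' x e) \<in> borel_measurable lborel"
      using borel_measurable_continuous_onI[OF cont] by simp
    show "q m \<in> borel_measurable lborel" for m
      unfolding q_def using hb by measurable
    show "integrable lborel (\<lambda>x. indicator (cball 0 (R + norm e)) x *\<^sub>R M)"
      by (intro borel_integrable_compact) auto
    show "AE x in lborel. (\<lambda>m. q m x) \<longlonglongrightarrow> h' x e" using lim by simp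
    have "norm (q m x) \<le> indicator (cball 0 (R + norm e)) x *\<^sub>R M" for m x
      using bound[of m x] supp[of x m] by (cases "x \<in> cball 0 (R + norm e)") simp_all
    then show "AE x in lborel. norm (q m x) \<le> indicator (cball 0 (R + norm e)) x *\<^sub>R M" for m
      by simp
  qed
  moreover have "(\<integral>x. q m x \<partial>lborel) = 0" for m
  proof -
    have ih: "integrable lborel h"
    proof -
      have "h = (\<lambda>x. indicator K x *\<^sub>R h x)" using K(2) by (auto simp: fun_eq_iff indicator_def)
      moreover have "integrable lborel (\<lambda>x. indicator K x *\<^sub>R h x)"
        by (intro borel_integrable_compact K(1) continuous_on_subset[OF hc]) simp
      ultimately show ?thesis by simp
    qed
    let ?c = "e /\<^sub>R real (Suc m)"
    have d: "lborel = distr lborel borel ((+) ?c)" by (rule lborel_distr_plus[symmetric])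
    have "integrable (distr lborel borel ((+) ?c)) h" using ih d by simp
    then have i2: "integrable lborel (\<lambda>x. h (?c + x))"
      using hb by (subst (asm) integrable_distr_eq) auto
    have "(\<integral>x. h x \<partial>lborel) = (\<integral>x. h x \<partial>distr lborel borel ((+) ?c))" using d by simp
    also have "\<dots> = (\<integral>x. h (?c + x) \<partial>lborel)" using hb by (subst integral_distr) auto
    finally show ?thesis using ih i2 by (simp add: q_def add.commute del: of_nat_Suc)
  qed
  ultimately show ?thesis by (simp add: LIMSEQ_const_iff)
qed

lemma integrable_supported:
  fixes f :: "'a::euclidean_space \<Rightarrow> real"
  assumes "open \<Omega>" "compact K" "K \<subseteq> \<Omega>" "continuous_on \<Omega> f" "\<And>x. x \<in> \<Omega> \<Longrightarrow> x \<notin> K \<Longrightarrow> f x = 0"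
  shows "integrable lborel (\<lambda>x. indicator \<Omega> x *\<^sub>R f x)"
proof -
  have "(\<lambda>x. indicator \<Omega> x *\<^sub>R f x) = (\<lambda>x. indicator K x *\<^sub>R f x)"
    using assms by (auto simp: fun_eq_iff indicator_def)
  then show ?thesis
    using borel_integrable_compact[OF assms(2) continuous_on_subset[OF assms(4,3)]] by simp
qed

lemma smooth_on_subset:
  assumes "smooth_on f S" "T \<subseteq> S"
  shows "smooth_on f T"
  unfolding smooth_on_def
proof
  fix x assume "x \<in> T"
  then have "x \<in> S" using assms(2) by blast
  with assms(1) obtain U F where U: "open U" "x \<in> U" "\<forall>k. Ck_on k F U" "\<forall>y\<in>S \<inter> U. F y = f y"
    unfolding smooth_on_def by blast
  have "\<forall>y\<in>T \<inter> U. F y = f y" using U(4) assms(2) by blast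
  with U(1-3) show "\<exists>U F. open U \<and> x \<in> U \<and> (\<forall>k. Ck_on k F U) \<and> (\<forall>y\<in>T \<inter> U. F y = f y)"
    by (intro exI[of _ U] exI[of _ F] conjI)
qed

lemma smooth_on_openD:
  assumes "smooth_on f S" "open S"
  shows "Ck_on k f S"
proof (rule Ck_on_local)
  fix x assume "x \<in> S"
  with assms(1) obtain U F where U: "open U" "x \<in> U" "\<forall>k. Ck_on k F U" "\<forall>y\<in>S \<inter> U. F y = f y"
    unfolding smooth_on_def by blast
  have "Ck_on k F (S \<inter> U)" using U(3) by (auto intro: Ck_on_subset)
  then have "Ck_on k f (S \<inter> U)"
    using U(1,4) assms(2) by (intro Ck_on_cong[of "S \<inter> U" F f]) auto
  then show "\<exists>W. open W \<and> x \<in> W \<and> Ck_on k f W"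
    using U assms(2) \<open>x \<in> S\<close> by (intro exI[of _ "S \<inter> U"]) auto
qed

lemma Ck_on_frechet:
  assumes "Ck_on (Suc k) f S" "x \<in> S"
  shows "(f has_derivative frechet_derivative f (at x)) (at x)"
  using assms by (simp add: frechet_derivative_works[symmetric])

text \<open>The product \<open>u * \<eta>\<close>, extended by 0 outside \<open>\<Omega>\<close>, is continuously differentiable on the whole space with compact
  support, hence its derivative has integral 0.\<close>

lemma integration_by_parts_test_function:
  fixes u :: "'a::euclidean_space \<Rightarrow> real"
  assumes \<Omega>: "open \<Omega>" and u: "\<And>x. x \<in> \<Omega> \<Longrightarrow> (u has_derivative u' x) (at x)"
    and cont: "continuous_on \<Omega> (\<lambda>x. u' x e)" and \<eta>: "test_function \<Omega> \<eta>"
  shows "(LINT x:\<Omega>|lborel. u x * frechet_derivative \<eta> (at x) e) = - (LINT x:\<Omega>|lborel. u' x e * \<eta> x)"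
proof -
  define K where "K = closure {x. \<eta> x \<noteq> 0}"
  have K: "compact K" "K \<subseteq> \<Omega>" and sm: "smooth_on \<eta> UNIV"
    using \<eta> by (auto simp: K_def test_function_def)
  have out: "\<eta> x = 0" if "x \<notin> K" for x
    using that closure_subset[of "{x. \<eta> x \<noteq> 0}"] by (auto simp: K_def)
  have clK: "closed K" by (rule compact_imp_closed) fact
  let ?\<eta>' = "\<lambda>x. frechet_derivative \<eta> (at x)"
  have C1: "Ck_on (Suc 0) \<eta> UNIV" by (rule smooth_on_openD[OF sm]) simp
  have d\<eta>: "(\<eta> has_derivative ?\<eta>' x) (at x)" for x
    using Ck_on_frechet[OF C1] by simp
  have c\<eta>': "continuous_on UNIV (\<lambda>x. ?\<eta>' x e)" using C1 by simp
  have c\<eta>: "continuous_on UNIV \<eta>" using Ck_on_SucD[OF C1] by simp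
  have \<eta>'0: "?\<eta>' x e = 0" if "x \<notin> K" for x
    using has_derivative_unique[OF has_derivative_zero_outside[OF clK out that] d\<eta>] by metis
  have cu: "continuous_on \<Omega> u"
    by (intro continuous_at_imp_continuous_on ballI has_derivative_continuous[OF u])
  define h where "h x = (if x \<in> \<Omega> then u x * \<eta> x else 0)" for x
  define h' where "h' x v = (if x \<in> \<Omega> then u x * ?\<eta>' x v + u' x v * \<eta> x else 0)" for x v
  have h0: "h x = 0" if "x \<notin> K" for x using out[OF that] by (simp add: h_def)
  have h'0: "h' x e = 0" if "x \<notin> K" for x using out[OF that] \<eta>'0[OF that] by (simp add: h'_def)
  have dh: "(h has_derivative h' x) (at x)" for x
  proof (cases "x \<in> \<Omega>")
    case True
    have "((\<lambda>x. u x * \<eta> x) has_derivative (\<lambda>v. u x * ?\<eta>' x v + u' x v * \<eta> x)) (at x)"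
      by (rule has_derivative_mult[OF u[OF True] d\<eta>])
    then have "(h has_derivative (\<lambda>v. u x * ?\<eta>' x v + u' x v * \<eta> x)) (at x)"
      by (rule has_derivative_transform_within_open[OF _ \<Omega> True]) (simp add: h_def)
    then show ?thesis using True by (simp add: h'_def[abs_def])
  next
    case False
    then have "x \<notin> K" using K by auto
    have "(h has_derivative (\<lambda>_. 0)) (at x)"
      by (rule has_derivative_zero_outside[OF clK h0 \<open>x \<notin> K\<close>])
    then show ?thesis using False by (simp add: h'_def[abs_def])
  qed
  have ch': "continuous_on UNIV (\<lambda>x. h' x e)"
  proof -
    have "continuous_on \<Omega> (\<lambda>x. u x * ?\<eta>' x e + u' x e * \<eta> x)"
      using cont cu continuous_on_subset[OF c\<eta>] continuous_on_subset[OF c\<eta>']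
      by (intro continuous_intros) auto
    then have "continuous_on \<Omega> (\<lambda>x. h' x e)" by (rule continuous_on_eq) (simp add: h'_def)
    moreover have "continuous_on (- K) (\<lambda>x. h' x e)"
      by (rule continuous_on_eq[OF continuous_on_const[of _ 0]]) (simp add: h'0)
    ultimately have "continuous_on (\<Omega> \<union> - K) (\<lambda>x. h' x e)"
      using \<Omega> clK by (intro continuous_on_open_Un) auto
    moreover have "\<Omega> \<union> - K = UNIV" using K by auto
    ultimately show ?thesis by simp
  qed
  have i1: "integrable lborel (\<lambda>x. indicator \<Omega> x *\<^sub>R (u x * ?\<eta>' x e))"
    by (rule integrable_supported[OF \<Omega> K])
      (use cu continuous_on_subset[OF c\<eta>'] \<eta>'0 in \<open>auto intro!: continuous_intros\<close>)
  have i2: "integrable lborel (\<lambda>x. indicator \<Omega> x *\<^sub>R (u' x e * \<eta> x))"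
    by (rule integrable_supported[OF \<Omega> K])
      (use cont continuous_on_subset[OF c\<eta>] out in \<open>auto intro!: continuous_intros\<close>)
  have "0 = (\<integral>x. h' x e \<partial>lborel)"
    using integral_derivative_compact_support[OF dh ch' K(1) h0] by simp
  also have "\<dots> = (\<integral>x. indicator \<Omega> x *\<^sub>R (u x * ?\<eta>' x e) + indicator \<Omega> x *\<^sub>R (u' x e * \<eta> x) \<partial>lborel)"
    by (intro Bochner_Integration.integral_cong) (auto simp: h'_def indicator_def)
  also have "\<dots> = (LINT x:\<Omega>|lborel. u x * ?\<eta>' x e) + (LINT x:\<Omega>|lborel. u' x e * \<eta> x)"
    unfolding set_lebesgue_integral_def by (rule Bochner_Integration.integral_add[OF i1 i2])
  finally show ?thesis by linarith
qed

section \<open>Functions supported in one chart\<close>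

definition chart_push :: "('a, 'n::finite) chart \<Rightarrow> (real^'n \<Rightarrow> 'b::zero) \<Rightarrow> 'a \<Rightarrow> 'b" where
  "chart_push c f p = (if p \<in> chart_dom c then f (coord c p) else 0)"

context smooth_manifold
begin

lemma measurable_chart_push:
  fixes f :: "real^'n \<Rightarrow> 'b::{zero, topological_space}"
  assumes c: "c \<in> A" and f: "f \<in> borel_measurable borel"
  shows "chart_push c f \<in> borel_measurable (borel_on X)"
proof -
  have "(\<lambda>p. f (coord c p)) \<in> borel_measurable (restrict_space (borel_on X) (chart_dom c))"
    by (rule measurable_compose[OF measurable_coord[OF c] f])
  then show ?thesis
    unfolding chart_push_def using chart_dom_space[OF c]
    by (subst (asm) measurable_restrict_space_iff) auto
qed

lemma chart_preimage_relopen: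
  assumes c: "c \<in> A" and W: "openin X W"
  obtains T where "open T" "\<And>x. x \<in> chart_img c \<Longrightarrow> coord_inv c x \<in> W \<longleftrightarrow> x \<in> T"
proof -
  have "openin (top_of_set (chart_img c)) (coord c ` (W \<inter> chart_dom c))"
    using c W by (intro openin_coord_image openin_Int chart_dom_open) auto
  then obtain T where T: "open T" "coord c ` (W \<inter> chart_dom c) = chart_img c \<inter> T"
    by (auto simp: openin_open)
  have "coord_inv c x \<in> W \<longleftrightarrow> x \<in> T" if "x \<in> chart_img c" for x
  proof -
    have "coord c ` (W \<inter> chart_dom c) = {x \<in> chart_img c. coord_inv c x \<in> W \<inter> chart_dom c}"
      by (rule coord_image_eq[OF c]) simp
    then show ?thesis using T(2) that coord_inv_in[OF that] by auto
  qed
  with T(1) show ?thesis by (rule that)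
qed

lemma chart_preimage_open:
  assumes "c \<in> A" "openin X W"
  shows "open {x \<in> interior (chart_img c). coord_inv c x \<in> W}"
proof -
  obtain T where T: "open T" "\<And>x. x \<in> chart_img c \<Longrightarrow> coord_inv c x \<in> W \<longleftrightarrow> x \<in> T"
    by (rule chart_preimage_relopen[OF assms]) blast
  have "{x \<in> interior (chart_img c). coord_inv c x \<in> W} = interior (chart_img c) \<inter> T"
    using T(2) interior_subset[of "chart_img c"] by blast
  then show ?thesis using T(1) by auto
qed

text \<open>Only points in the interior of the image of \<open>c\<close> are taken, so that the set is open and the
  derivatives of transition maps on it are unique.\<close>

definition overlap :: "('a, 'n) chart \<Rightarrow> ('a, 'n) chart \<Rightarrow> (real^'n) set" where
  "overlap c d = {x \<in> interior (chart_img c). coord_inv c x \<in> chart_dom d}"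

lemma open_overlap: "c \<in> A \<Longrightarrow> d \<in> A \<Longrightarrow> open (overlap c d)"
  unfolding overlap_def by (intro chart_preimage_open chart_dom_open)

lemma overlap_subset: "overlap c d \<subseteq> coord c ` (chart_dom c \<inter> chart_dom d)"
proof
  fix x assume "x \<in> overlap c d"
  then have x: "x \<in> chart_img c" "coord_inv c x \<in> chart_dom d"
    using interior_subset[of "chart_img c"] by (auto simp: overlap_def)
  then show "x \<in> coord c ` (chart_dom c \<inter> chart_dom d)"
    using coord_coord_inv[OF x(1)] coord_inv_in[OF x(1)] by (intro image_eqI[of _ _ "coord_inv c x"]) auto
qed

lemma coord_in_overlap:
  "c \<in> A \<Longrightarrow> p \<in> chart_dom c \<Longrightarrow> p \<in> chart_dom d \<Longrightarrow> coord c p \<in> interior (chart_img c) \<Longrightarrow>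
    coord c p \<in> overlap c d"
  by (simp add: overlap_def coord_inv_coord)

lemma Ck_on_transition:
  assumes "c \<in> A" "d \<in> A"
  shows "Ck_on k (transition c d) (overlap c d)"
  by (intro smooth_on_openD open_overlap smooth_on_subset[OF compatible overlap_subset] assms)

lemma transition_frechet:
  assumes "c \<in> A" "d \<in> A" "x \<in> overlap c d"
  shows "(transition c d has_derivative frechet_derivative (transition c d) (at x)) (at x)"
  by (rule Ck_on_frechet[OF Ck_on_transition assms(3)]) (rule assms)+

lemma transition_inverse_derivative:
  assumes c: "c \<in> A" and d: "d \<in> A" and p: "p \<in> chart_dom c" "p \<in> chart_dom d"
    and int: "coord c p \<in> interior (chart_img c)" "coord d p \<in> interior (chart_img d)"
  shows "frechet_derivative (transition c d) (at (coord c p))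
    (frechet_derivative (transition d c) (at (coord d p)) v) = v"
proof -
  have x: "coord d p \<in> overlap d c" and y: "coord c p \<in> overlap c d"
    by (rule coord_in_overlap; fact)+
  have "((\<lambda>x. transition c d (transition d c x)) has_derivative
      (\<lambda>v. frechet_derivative (transition c d) (at (coord c p))
        (frechet_derivative (transition d c) (at (coord d p)) v))) (at (coord d p))"
    by (rule has_derivative_compose[OF transition_frechet[OF d c x]])
      (use transition_frechet[OF c d y] transition_coord[OF d p(2), of c] in simp)
  then have "((\<lambda>x. x) has_derivative
      (\<lambda>v. frechet_derivative (transition c d) (at (coord c p))
        (frechet_derivative (transition d c) (at (coord d p)) v))) (at (coord d p))"
  proof (rule has_derivative_transform_within_open[OF _ open_overlap[OF d c] x])
    fix z assume "z \<in> overlap d c"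
    then obtain q where q: "q \<in> chart_dom d" "q \<in> chart_dom c" "z = coord d q"
      using overlap_subset by blast
    then show "transition c d (transition d c z) = z"
      using transition_coord[OF d q(1), of c] transition_coord[OF c q(2), of d] by simp
  qed
  from has_derivative_unique[OF this has_derivative_ident] show ?thesis by metis
qed

lemma smooth_function_derivative:
  assumes d: "d \<in> A" and f: "smooth_on (f \<circ> coord_inv d) (chart_img d)"
  shows "Ck_on k (\<lambda>x. f (coord_inv d x)) (interior (chart_img d))"
  using smooth_on_openD[OF smooth_on_subset[OF f interior_subset]] by (simp add: o_def)

end

text \<open>A smooth function \<open>U\<close> on the coordinate space with compact support in the interior of a chart
  image. It is transported to the manifold as \<open>chart_push c0 U\<close>.\<close>

locale chart_bump = riemannian_manifold X A g
  for X :: "'a topology" and A :: "('a, 'n::finite) chart set" and g :: "('a, 'n) chart \<Rightarrow> 'a \<Rightarrow> real^'n^'n" +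
  fixes c0 :: "('a, 'n) chart" and U :: "real^'n \<Rightarrow> real" and K :: "(real^'n) set"
  assumes c0: "c0 \<in> A" and K_compact: "compact K" and K_int: "K \<subseteq> interior (chart_img c0)"
    and U_smooth: "\<And>k. Ck_on k U UNIV" and U_supp: "\<And>x. x \<notin> K \<Longrightarrow> U x = 0"
begin

abbreviation "dU x \<equiv> frechet_derivative U (at x)"

definition grad_coord :: "real^'n \<Rightarrow> real^'n" where
  "grad_coord x = (\<chi> i. dU x (axis i 1))"

definition metric_at :: "real^'n \<Rightarrow> real^'n^'n" where
  "metric_at x = g c0 (coord_inv c0 x)"

text \<open>Cramer's rule gives the components of the gradient with an evident continuity.\<close>

definition grad_vec :: "real^'n \<Rightarrow> real^'n" where
  "grad_vec x = (if x \<in> K then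
     (\<chi> k. det (\<chi> i j. if j = k then grad_coord x $ i else metric_at x $ i $ j) / det (metric_at x))
     else 0)"

text \<open>The gradient is computed in the chart \<open>c0\<close> and transported to the other charts. With this
  definition its transformation law is the chain rule for transition maps.\<close>

definition grad_field :: "('a, 'n) chart \<Rightarrow> 'a \<Rightarrow> real^'n" where
  "grad_field d p = (if p \<in> chart_dom c0 \<and> coord c0 p \<in> K
     then frechet_derivative (transition c0 d) (at (coord c0 p)) (grad_vec (coord c0 p)) else 0)"

definition supp :: "'a set" where
  "supp = {p \<in> chart_dom c0. coord c0 p \<in> K}"

lemma K_img: "K \<subseteq> chart_img c0" using K_int interior_subset by blast

lemma K_closed: "closed K" by (rule compact_imp_closed[OF K_compact])

lemma dU: "(U has_derivative dU x) (at x)"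
  by (rule Ck_on_frechet[OF U_smooth]) simp

lemma continuous_dU: "continuous_on S (\<lambda>x. dU x v)"
  using U_smooth[of "Suc 0"] by (intro continuous_on_subset[of UNIV _ S]) auto

lemma continuous_U: "continuous_on S U"
  using U_smooth[of 0] by (intro continuous_on_subset[of UNIV _ S]) auto

lemma dU_grad: "dU x v = v \<bullet> grad_coord x"
proof -
  have lin: "linear (dU x)" by (rule has_derivative_linear[OF dU])
  have "dU x v = dU x (\<Sum>i\<in>UNIV. v $ i *\<^sub>R axis i 1)"
    using basis_expansion[of v] by (simp add: scalar_mult_eq_scaleR)
  also have "\<dots> = (\<Sum>i\<in>UNIV. v $ i * dU x (axis i 1))"
    by (simp add: linear_sum[OF lin] linear_scale[OF lin])
  finally show ?thesis by (simp add: inner_vec_def grad_coord_def)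
qed

lemma dU_outside: "x \<notin> K \<Longrightarrow> dU x v = 0"
  using has_derivative_unique[OF has_derivative_zero_outside[OF K_closed U_supp] dU] by metis

lemma grad_coord_outside: "x \<notin> K \<Longrightarrow> grad_coord x = 0"
  by (simp add: grad_coord_def dU_outside vec_eq_iff)

lemma continuous_grad_coord: "continuous_on S grad_coord"
  unfolding grad_coord_def by (intro continuous_intros continuous_dU)

lemma metric_grad_vec:
  assumes "x \<in> chart_img c0"
  shows "metric_at x *v grad_vec x = grad_coord x"
proof (cases "x \<in> K")
  case True
  have "det (metric_at x) \<noteq> 0"
    using det_metric_pos[OF c0 coord_inv_in[OF assms]] by (simp add: metric_at_def)
  then show ?thesis using True by (simp add: grad_vec_def cramer)
qed (simp add: grad_vec_def grad_coord_outside)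

lemma continuous_metric_at: "continuous_on K metric_at"
  unfolding metric_at_def by (rule continuous_on_subset[OF continuous_on_metric[OF c0] K_img])

lemma det_metric_at: "x \<in> K \<Longrightarrow> det (metric_at x) \<noteq> 0"
  using det_metric_pos[OF c0 coord_inv_in, of x] K_img by (auto simp: metric_at_def)

lemma continuous_grad_vec: "continuous_on K grad_vec"
proof -
  have "continuous_on K (\<lambda>x. \<chi> k. det (\<chi> i j. if j = k then grad_coord x $ i else metric_at x $ i $ j) / det (metric_at x))"
  proof (intro continuous_on_vec_lambda continuous_on_divide continuous_on_det continuous_metric_at ballI det_metric_at)
    fix k i j
    show "continuous_on K (\<lambda>x. if j = k then grad_coord x $ i else metric_at x $ i $ j)"
      by (cases "j = k") (auto intro!: continuous_intros continuous_grad_coord continuous_metric_at)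
  qed
  then show ?thesis by (rule continuous_on_eq) (simp add: grad_vec_def)
qed

lemma supp_eq: "supp = coord_inv c0 ` K"
proof (intro set_eqI iffI)
  fix p assume "p \<in> supp"
  then show "p \<in> coord_inv c0 ` K"
    by (intro image_eqI[of _ _ "coord c0 p"]) (auto simp: supp_def coord_inv_coord[OF c0])
next
  fix p assume "p \<in> coord_inv c0 ` K"
  then obtain x where "x \<in> K" "p = coord_inv c0 x" by blast
  with K_img show "p \<in> supp"
    using coord_inv_in[of x c0] coord_coord_inv[of x c0] by (auto simp: supp_def)
qed

lemma supp_compact: "compactin X supp"
proof -
  have "homeomorphic_map (subtopology X (chart_dom c0)) (top_of_set (chart_img c0)) (coord c0)"
    using charts[OF c0] by (simp add: is_chart_def)
  then obtain h where h: "homeomorphic_maps (subtopology X (chart_dom c0)) (top_of_set (chart_img c0)) (coord c0) h"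
    by (auto simp: homeomorphic_map_maps)
  have "compactin (subtopology X (chart_dom c0)) (h ` K)"
  proof (rule image_compactin)
    show "compactin (top_of_set (chart_img c0)) K"
      using K_compact K_img by (simp add: compactin_subtopology)
    show "continuous_map (top_of_set (chart_img c0)) (subtopology X (chart_dom c0)) h"
      using h by (simp add: homeomorphic_maps_def)
  qed
  moreover have "h ` K = coord_inv c0 ` K"
  proof (rule image_cong)
    fix x assume "x \<in> K"
    then have x: "x \<in> chart_img c0" using K_img by blast
    have "h (coord c0 p) = p" if "p \<in> chart_dom c0" for p
      using h that chart_dom_subset[OF c0] by (auto simp: homeomorphic_maps_def)
    from this[OF coord_inv_in[OF x]] show "h x = coord_inv c0 x" using coord_coord_inv[OF x] by simp
  qed simp
  ultimately show ?thesis by (simp add: compactin_subtopology supp_eq)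
qed

lemma supp_complement_open: "openin X (topspace X - supp)"
  by (intro openin_diff openin_topspace compactin_imp_closedin[OF Hausdorff supp_compact])

lemma push_outside: "p \<notin> supp \<Longrightarrow> chart_push c0 U p = 0"
  by (auto simp: chart_push_def supp_def U_supp)

lemma grad_field_outside: "p \<notin> supp \<Longrightarrow> grad_field d p = 0"
  by (auto simp: grad_field_def supp_def)

lemma grad_field_supp: "p \<in> supp \<Longrightarrow>
    grad_field d p = frechet_derivative (transition c0 d) (at (coord c0 p)) (grad_vec (coord c0 p))"
  by (simp add: grad_field_def supp_def)

lemma supp_overlap: "p \<in> supp \<Longrightarrow> p \<in> chart_dom d \<Longrightarrow> coord c0 p \<in> overlap c0 d"
  using K_int by (auto simp: supp_def intro!: coord_in_overlap[OF c0])

text \<open>The transformation law of the metric moves the defining property of the gradient from \<open>c0\<close> to \<open>d\<close>.\<close>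

lemma grad_field_metric:
  assumes d: "d \<in> A" and p: "p \<in> chart_dom d" "p \<in> supp"
  shows "frechet_derivative (transition c0 d) (at (coord c0 p)) w \<bullet> (g d p *v grad_field d p) = dU (coord c0 p) w"
proof -
  let ?J = "frechet_derivative (transition c0 d) (at (coord c0 p))"
  have pc: "p \<in> chart_dom c0" "coord c0 p \<in> K" using p by (auto simp: supp_def)
  have "(transition c0 d has_derivative ?J) (at (coord c0 p) within coord c0 ` (chart_dom c0 \<inter> chart_dom d))"
    by (rule has_derivative_at_withinI[OF transition_frechet[OF c0 d supp_overlap[OF p(2,1)]]])
  from transform[OF c0 d _ this] pc p
  have "?J w \<bullet> (g d p *v ?J (grad_vec (coord c0 p))) = w \<bullet> (g c0 p *v grad_vec (coord c0 p))" by simp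
  also have "g c0 p = metric_at (coord c0 p)" by (simp add: metric_at_def coord_inv_coord[OF c0 pc(1)])
  also have "w \<bullet> (metric_at (coord c0 p) *v grad_vec (coord c0 p)) = dU (coord c0 p) w"
    using K_img pc by (subst metric_grad_vec) (auto simp: dU_grad)
  finally show ?thesis by (simp add: grad_field_supp[OF p(2)])
qed

text \<open>Near a point of the support, \<open>transition c0 d\<close> is the composition of \<open>transition c d\<close> and \<open>transition c0 c\<close>.
  The point is interior for \<open>c0\<close>, so the derivative of the composition is unique; \<open>J\<close> may be any
  derivative of \<open>transition c d\<close>, also at a boundary point.\<close>

lemma grad_field_transform:
  assumes c: "c \<in> A" and d: "d \<in> A" and p: "p \<in> chart_dom c \<inter> chart_dom d"
    and J: "(transition c d has_derivative J) (at (coord c p) within coord c ` (chart_dom c \<inter> chart_dom d))"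
  shows "grad_field d p = J (grad_field c p)"
proof (cases "p \<in> supp")
  case False
  then show ?thesis using linear_0[OF has_derivative_linear[OF J]] by (simp add: grad_field_outside)
next
  case True
  let ?x = "coord c0 p" and ?W = "overlap c0 c \<inter> overlap c0 d"
  have pc: "p \<in> chart_dom c0" using True by (simp add: supp_def)
  have x: "?x \<in> overlap c0 c" "?x \<in> overlap c0 d" using supp_overlap[OF True] p by auto
  have W: "open ?W" by (intro open_Int open_overlap c0 c d)
  have T: "transition c0 c z \<in> coord c ` (chart_dom c \<inter> chart_dom d)"
    "transition c0 d z = transition c d (transition c0 c z)" if z: "z \<in> ?W" for z
  proof -
    obtain q where q: "q \<in> chart_dom c0" "q \<in> chart_dom c" "z = coord c0 q"
      using z overlap_subset[of c0 c] by blast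
    have qd: "q \<in> chart_dom d" using z coord_inv_coord[OF c0 q(1)] q(3) by (auto simp: overlap_def)
    show "transition c0 c z \<in> coord c ` (chart_dom c \<inter> chart_dom d)"
      "transition c0 d z = transition c d (transition c0 c z)"
      using transition_coord[OF c0 q(1)] transition_coord[OF c q(2)] q qd by auto
  qed
  have "((\<lambda>z. transition c d (transition c0 c z)) has_derivative
      (\<lambda>v. J (frechet_derivative (transition c0 c) (at ?x) v))) (at ?x within ?W)"
  proof (rule has_derivative_in_compose[where g = "transition c d" and g' = J])
    show "(transition c0 c has_derivative frechet_derivative (transition c0 c) (at ?x)) (at ?x within ?W)"
      by (rule has_derivative_at_withinI[OF transition_frechet[OF c0 c x(1)]])
    show "(transition c d has_derivative J) (at (transition c0 c ?x) within transition c0 c ` ?W)"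
      using has_derivative_subset[OF J, of "transition c0 c ` ?W"] T(1) transition_coord[OF c0 pc, of c] by auto
  qed
  then have "((\<lambda>z. transition c d (transition c0 c z)) has_derivative
      (\<lambda>v. J (frechet_derivative (transition c0 c) (at ?x) v))) (at ?x)"
    using at_within_open[OF _ W, of ?x] x by simp
  then have "(transition c0 d has_derivative
      (\<lambda>v. J (frechet_derivative (transition c0 c) (at ?x) v))) (at ?x)"
    by (rule has_derivative_transform_within_open[OF _ W]) (use x T(2) in auto)
  from has_derivative_unique[OF this transition_frechet[OF c0 d x(2)]]
  show ?thesis unfolding grad_field_supp[OF True] by metis
qed

lemma grad_field_measurable:
  assumes d: "d \<in> A"
  shows "grad_field d \<in> borel_measurable (restrict_space (borel_on X) (chart_dom d))"
proof -
  let ?W = "overlap c0 d"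
  let ?T = "\<lambda>x. frechet_derivative (transition c0 d) (at x)"
  define H where "H x = indicator (K \<inter> ?W) x *\<^sub>R (\<Sum>k\<in>UNIV. (grad_vec x $ k) *\<^sub>R ?T x (axis k 1))" for x
  have "H \<in> borel_measurable borel"
    unfolding H_def
  proof (rule borel_measurable_continuous_on_indicator)
    show "K \<inter> ?W \<in> sets borel"
      using K_closed open_overlap[OF c0 d] by (intro sets.Int borel_closed borel_open)
    have T: "continuous_on ?W (\<lambda>x. ?T x v)" for v
      using Ck_on_transition[OF c0 d, of "Suc 0"] by simp
    show "continuous_on (K \<inter> ?W) (\<lambda>x. \<Sum>k\<in>UNIV. grad_vec x $ k *\<^sub>R ?T x (axis k 1))"
      by (intro continuous_intros continuous_on_subset[OF T] continuous_on_subset[OF continuous_grad_vec]) auto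
  qed
  from measurable_chart_push[OF c0 this]
  have "chart_push c0 H \<in> borel_measurable (restrict_space (borel_on X) (chart_dom d))"
    by (rule measurable_restrict_space1)
  then show ?thesis
  proof (rule measurable_cong[THEN iffD1, rotated])
    fix p assume "p \<in> space (restrict_space (borel_on X) (chart_dom d))"
    then have pd: "p \<in> chart_dom d" by (simp add: space_restrict_space)
    show "chart_push c0 H p = grad_field d p"
    proof (cases "p \<in> supp")
      case True
      have x: "coord c0 p \<in> ?W" by (rule supp_overlap[OF True pd])
      have lin: "linear (?T (coord c0 p))" by (rule has_derivative_linear[OF transition_frechet[OF c0 d x]])
      have "?T (coord c0 p) (grad_vec (coord c0 p)) =
          ?T (coord c0 p) (\<Sum>k\<in>UNIV. (grad_vec (coord c0 p) $ k) *\<^sub>R axis k 1)"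
        using basis_expansion[of "grad_vec (coord c0 p)"] by (simp add: scalar_mult_eq_scaleR)
      also have "\<dots> = (\<Sum>k\<in>UNIV. (grad_vec (coord c0 p) $ k) *\<^sub>R ?T (coord c0 p) (axis k 1))"
        by (simp add: linear_sum[OF lin] linear_scale[OF lin])
      finally show ?thesis
        using True x by (simp add: grad_field_supp chart_push_def H_def supp_def)
    next
      case False
      then show ?thesis by (auto simp: grad_field_outside chart_push_def H_def supp_def)
    qed
  qed
qed

lemma vector_field_grad: "vector_field X A grad_field"
  unfolding vector_field_def
  by (intro conjI ballI allI impI grad_field_measurable grad_field_transform)

text \<open>A point of the chart \<open>d\<close> lies in the domain of \<open>c0\<close>, where the function is the composition of \<open>U\<close> with
  a smooth extension of the transition map, or in the complement of the compact support, where
  it is 0. Both sets are open.\<close>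

lemma push_smooth:
  assumes d: "d \<in> A"
  shows "smooth_on (chart_push c0 U \<circ> coord_inv d) (chart_img d)"
  unfolding smooth_on_def
proof
  fix x assume x: "x \<in> chart_img d"
  let ?p = "coord_inv d x"
  show "\<exists>V F. open V \<and> x \<in> V \<and> (\<forall>k. Ck_on k F V) \<and> (\<forall>y\<in>chart_img d \<inter> V. F y = (chart_push c0 U \<circ> coord_inv d) y)"
  proof (cases "?p \<in> chart_dom c0")
    case True
    obtain T where T: "open T" "\<And>x. x \<in> chart_img d \<Longrightarrow> coord_inv d x \<in> chart_dom c0 \<longleftrightarrow> x \<in> T"
      by (rule chart_preimage_relopen[OF d chart_dom_open[OF c0]]) blast
    have mem: "y \<in> coord d ` (chart_dom d \<inter> chart_dom c0)" if "y \<in> chart_img d" "y \<in> T" for y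
      using that T(2)[OF that(1)] coord_inv_in[OF that(1)] coord_coord_inv[OF that(1)]
      by (intro image_eqI[of _ _ "coord_inv d y"]) auto
    have "x \<in> T" using T(2)[OF x] True by simp
    obtain Q F where Q: "open Q" "x \<in> Q" "\<forall>k. Ck_on k F Q"
      "\<forall>y\<in>coord d ` (chart_dom d \<inter> chart_dom c0) \<inter> Q. F y = transition d c0 y"
      using compatible[OF d c0] mem[OF x \<open>x \<in> T\<close>] unfolding smooth_on_def by blast
    have QT: "open (Q \<inter> T)" using Q(1) T(1) by blast
    have "Ck_on k (\<lambda>y. U (F y)) (Q \<inter> T)" for k
      by (rule Ck_on_compose[OF QT _ U_smooth Ck_on_subset]) (use Q(3) in auto)
    moreover have "U (F y) = (chart_push c0 U \<circ> coord_inv d) y" if y: "y \<in> chart_img d \<inter> (Q \<inter> T)" for y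
    proof -
      have "F y = transition d c0 y" using Q(4) mem y by blast
      then show ?thesis using y T(2)[of y] by (simp add: transition_def chart_push_def)
    qed
    ultimately show ?thesis using QT Q(2) \<open>x \<in> T\<close>
      by (intro exI[of _ "Q \<inter> T"] exI[of _ "\<lambda>y. U (F y)"]) simp
  next
    case False
    obtain T where T: "open T" "\<And>x. x \<in> chart_img d \<Longrightarrow> coord_inv d x \<in> topspace X - supp \<longleftrightarrow> x \<in> T"
      by (rule chart_preimage_relopen[OF d supp_complement_open]) blast
    have "?p \<in> topspace X - supp"
      using coord_inv_in[OF x] chart_dom_subset[OF d] False by (auto simp: supp_def)
    then have "x \<in> T" using T(2)[OF x] by simp
    moreover have "0 = (chart_push c0 U \<circ> coord_inv d) y" if "y \<in> chart_img d \<inter> T" for y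
    proof -
      have "coord_inv d y \<notin> supp" using T(2)[of y] that by blast
      then show ?thesis by (simp add: push_outside)
    qed
    ultimately show ?thesis using T(1) Ck_on_const
      by (intro exI[of _ T] exI[of _ "\<lambda>y. 0"]) auto
  qed
qed

lemma push_C0_inf: "chart_push c0 U \<in> C0_inf X A"
proof -
  let ?S = "{p \<in> topspace X. chart_push c0 U p \<noteq> 0}"
  have cl: "X closure_of ?S \<subseteq> supp"
    by (rule closure_of_minimal[OF _ compactin_imp_closedin[OF Hausdorff supp_compact]]) (use push_outside in auto)
  moreover have "compactin X (X closure_of ?S)"
    by (rule closed_compactin[OF supp_compact cl closedin_closure_of])
  moreover have "supp \<subseteq> manifold_interior A"
    using K_int c0 by (auto simp: supp_def manifold_interior_def)
  ultimately show ?thesis using push_smooth by (auto simp: C0_inf_def)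
qed

text \<open>In the chart \<open>d\<close> the function is \<open>U\<close> composed with \<open>transition d c0\<close>. As the derivatives of the two transition
  maps between \<open>c0\<close> and \<open>d\<close> are inverse to each other, \<open>grad_field_metric\<close> identifies the
  differential.\<close>

lemma push_has_derivative:
  assumes d: "d \<in> A" and x: "x \<in> interior (chart_img d)"
  shows "((\<lambda>y. chart_push c0 U (coord_inv d y)) has_derivative
    (\<lambda>v. v \<bullet> (g d (coord_inv d x) *v grad_field d (coord_inv d x)))) (at x)"
proof -
  let ?p = "coord_inv d x"
  have xi: "x \<in> chart_img d" using x interior_subset by blast
  have pd: "?p \<in> chart_dom d" by (rule coord_inv_in[OF xi])
  have cx: "coord d ?p = x" by (rule coord_coord_inv[OF xi])
  show ?thesis
  proof (cases "?p \<in> supp")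
    case True
    have pc: "?p \<in> chart_dom c0" "coord c0 ?p \<in> K" using True by (auto simp: supp_def)
    have xo: "x \<in> overlap d c0" using x pc by (simp add: overlap_def)
    let ?L = "frechet_derivative (transition d c0) (at x)"
    have "((\<lambda>y. U (transition d c0 y)) has_derivative (\<lambda>v. dU (transition d c0 x) (?L v))) (at x)"
      by (rule has_derivative_compose[OF transition_frechet[OF d c0 xo] dU])
    also have "transition d c0 x = coord c0 ?p" using transition_coord[OF d pd, of c0] cx by simp
    also have "(\<lambda>v. dU (coord c0 ?p) (?L v)) = (\<lambda>v. v \<bullet> (g d ?p *v grad_field d ?p))"
    proof
      fix v
      have "frechet_derivative (transition c0 d) (at (coord c0 ?p)) (?L v) = v"
        using transition_inverse_derivative[OF c0 d pc(1) pd, of v] pc(2) K_int x cx by auto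
      then show "dU (coord c0 ?p) (?L v) = v \<bullet> (g d ?p *v grad_field d ?p)"
        using grad_field_metric[OF d pd True, of "?L v"] by simp
    qed
    finally show ?thesis
      by (rule has_derivative_transform_within_open[OF _ open_overlap[OF d c0] xo])
        (auto simp: overlap_def chart_push_def transition_def)
  next
    case False
    let ?V = "{x \<in> interior (chart_img d). coord_inv d x \<in> topspace X - supp}"
    have V: "open ?V" by (rule chart_preimage_open[OF d supp_complement_open])
    have xV: "x \<in> ?V" using x False pd chart_dom_subset[OF d] by auto
    have "((\<lambda>y. chart_push c0 U (coord_inv d y)) has_derivative (\<lambda>_. 0)) (at x)"
      by (rule has_derivative_transform_within_open[OF has_derivative_const V xV]) (simp add: push_outside)
    then show ?thesis using False by (simp add: grad_field_outside)
  qed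
qed

text \<open>The weak derivatives are classical ones, and the integral identity is integration by parts in
  each chart.\<close>

lemma push_has_weak_gradient: "has_weak_gradient X A g (chart_push c0 U) grad_field"
proof -
  have chart: "(\<forall>K'. compact K' \<and> K' \<subseteq> \<Omega> \<longrightarrow> set_integrable lborel K' u' \<and> set_integrable lborel K' du) \<and>
      (\<forall>\<eta> i. test_function \<Omega> \<eta> \<longrightarrow>
         (LINT x:\<Omega>|lborel. u' x * frechet_derivative \<eta> (at x) (axis i 1)) =
         - (LINT x:\<Omega>|lborel. du x $ i * \<eta> x))"
    if d: "d \<in> A" and defs: "\<Omega> = interior (chart_img d)" "u' = (\<lambda>x. chart_push c0 U (coord_inv d x))"
      "du = (\<lambda>x. g d (coord_inv d x) *v grad_field d (coord_inv d x))" for d \<Omega> u' du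
  proof -
    have \<Omega>: "open \<Omega>" by (simp add: defs)
    have der: "(u' has_derivative (\<lambda>v. v \<bullet> du x)) (at x)" if "x \<in> \<Omega>" for x
      using push_has_derivative[OF d, of x] that by (simp add: defs)
    have C1: "Ck_on (Suc 0) u' \<Omega>"
      using smooth_function_derivative[OF d push_smooth[OF d]] by (simp only: defs)
    have cu: "continuous_on \<Omega> u'" using Ck_on_SucD[OF C1] by simp
    have cd: "continuous_on \<Omega> (\<lambda>x. v \<bullet> du x)" for v
    proof -
      have "continuous_on \<Omega> (\<lambda>x. frechet_derivative u' (at x) v)" using C1 by simp
      then show ?thesis
        by (rule continuous_on_eq) (simp add: frechet_derivative_at[OF der, symmetric])
    qed
    have cdu: "continuous_on \<Omega> du"
    proof -
      have "continuous_on \<Omega> (\<lambda>x. \<chi> i. axis i 1 \<bullet> du x)" by (intro continuous_on_vec_lambda cd)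
      then show ?thesis by (simp add: inner_axis' )
    qed
    have "(LINT x:\<Omega>|lborel. u' x * frechet_derivative \<eta> (at x) (axis i 1)) =
         - (LINT x:\<Omega>|lborel. du x $ i * \<eta> x)" if "test_function \<Omega> \<eta>" for \<eta> i
      using integration_by_parts_test_function[OF \<Omega> der cd that, of "axis i 1"] by (simp add: inner_axis')
    moreover have "set_integrable lborel K' u'" "set_integrable lborel K' du"
      if "compact K'" "K' \<subseteq> \<Omega>" for K'
      unfolding set_integrable_def
      using borel_integrable_compact[OF that(1) continuous_on_subset[OF cu that(2)]]
        borel_integrable_compact[OF that(1) continuous_on_subset[OF cdu that(2)]] by simp_all
    ultimately show ?thesis by blast
  qed
  have "chart_push c0 U \<in> borel_measurable (borel_on X)"
    by (intro measurable_chart_push c0 borel_measurable_continuous_onI continuous_U)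
  then show ?thesis
    unfolding has_weak_gradient_def Let_def using vector_field_grad chart by blast
qed

definition grad_norm :: "real^'n \<Rightarrow> real" where
  "grad_norm x = sqrt (grad_vec x \<bullet> (metric_at x *v grad_vec x))"

lemma grad_norm_outside: "x \<notin> K \<Longrightarrow> grad_norm x = 0"
  by (simp add: grad_norm_def grad_vec_def)

lemma continuous_grad_norm: "continuous_on K grad_norm"
proof -
  have "continuous_on K (\<lambda>x. metric_at x *v grad_vec x)"
    using continuous_metric_at continuous_grad_vec
    unfolding matrix_vector_mult_def by (intro continuous_intros)
  then show ?thesis
    unfolding grad_norm_def using continuous_grad_vec by (intro continuous_intros)
qed

lemma grad_norm_sq:
  assumes "x \<in> K"
  shows "(grad_norm x)\<^sup>2 = grad_vec x \<bullet> (metric_at x *v grad_vec x)" "(grad_norm x)\<^sup>2 = dU x (grad_vec x)"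
proof -
  have xi: "x \<in> chart_img c0" using assms K_img by blast
  have "0 \<le> grad_vec x \<bullet> (metric_at x *v grad_vec x)"
    using positive[OF c0 coord_inv_in[OF xi], of "grad_vec x"]
    by (cases "grad_vec x = 0") (auto simp: metric_at_def intro: less_imp_le)
  then show 1: "(grad_norm x)\<^sup>2 = grad_vec x \<bullet> (metric_at x *v grad_vec x)"
    by (simp add: grad_norm_def)
  show "(grad_norm x)\<^sup>2 = dU x (grad_vec x)"
    unfolding 1 by (simp add: metric_grad_vec[OF xi] dU_grad)
qed

lemma vf_norm_grad:
  assumes "p \<in> topspace X"
  shows "vf_norm A g grad_field p = chart_push c0 grad_norm p"
proof -
  have "\<exists>c. c \<in> A \<and> p \<in> chart_dom c" using assms cover by blast
  then have c: "(SOME c. c \<in> A \<and> p \<in> chart_dom c) \<in> A" "p \<in> chart_dom (SOME c. c \<in> A \<and> p \<in> chart_dom c)"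
    using someI_ex[of "\<lambda>c. c \<in> A \<and> p \<in> chart_dom c"] by auto
  define c where "c = (SOME c. c \<in> A \<and> p \<in> chart_dom c)"
  note c = c[folded c_def]
  have v: "vf_norm A g grad_field p = sqrt (grad_field c p \<bullet> (g c p *v grad_field c p))"
    by (simp add: vf_norm_def Let_def c_def)
  show ?thesis
  proof (cases "p \<in> supp")
    case True
    then have pc: "p \<in> chart_dom c0" "coord c0 p \<in> K" by (auto simp: supp_def)
    have "grad_field c p \<bullet> (g c p *v grad_field c p) = dU (coord c0 p) (grad_vec (coord c0 p))"
      using grad_field_metric[OF c True, of "grad_vec (coord c0 p)"] by (simp add: grad_field_supp[OF True])
    also have "\<dots> = (grad_norm (coord c0 p))\<^sup>2" using grad_norm_sq[OF pc(2)] by simp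
    finally have "vf_norm A g grad_field p = \<bar>grad_norm (coord c0 p)\<bar>" by (simp add: v)
    moreover have "0 \<le> grad_norm (coord c0 p)"
      using grad_norm_sq(1)[OF pc(2)] unfolding grad_norm_def by (metis real_sqrt_ge_zero zero_le_power2)
    ultimately show ?thesis using pc by (simp add: chart_push_def)
  next
    case False
    then show ?thesis unfolding v
      by (auto simp: grad_field_outside chart_push_def supp_def grad_norm_outside)
  qed
qed

end

section \<open>Sobolev membership and norms in a chart\<close>

lemma Lp_norm_power_le:
  assumes "0 < p" "f \<in> Lp_space p M" "0 \<le> B" "(\<integral>\<^sup>+x. ennreal (\<bar>f x\<bar> ^ p) \<partial>M) \<le> ennreal B"
  shows "Lp_norm p M f ^ p \<le> B"
proof -
  have "(\<integral>\<^sup>+x. ennreal (\<bar>f x\<bar> ^ p) \<partial>M) = ennreal (\<integral>x. \<bar>f x\<bar> ^ p \<partial>M)"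
    using assms(2) by (intro nn_integral_eq_integral) (auto simp: Lp_space_def)
  with assms(3,4) have "(\<integral>x. \<bar>f x\<bar> ^ p \<partial>M) \<le> B" by simp
  moreover have "0 \<le> (\<integral>x. \<bar>f x\<bar> ^ p \<partial>M)" by simp
  ultimately show ?thesis using assms(1) by (simp add: Lp_norm_def)
qed

lemma chart_push_power: "0 < m \<Longrightarrow> \<bar>chart_push c f p\<bar> ^ m = chart_push c (\<lambda>x. \<bar>f x :: real\<bar> ^ m) p"
  by (simp add: chart_push_def)

context riemannian_manifold
begin

lemma nn_integral_chart_push:
  assumes c: "c \<in> A" and H: "H \<in> borel_measurable borel" "\<And>x. 0 \<le> H x"
  shows "(\<integral>\<^sup>+p. ennreal (chart_push c H p) \<partial>vol) =
    (\<integral>\<^sup>+x. ennreal (H x * vol_density c x) * indicator (chart_img c) x \<partial>lborel)"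
proof -
  have m: "(\<lambda>p. ennreal (chart_push c H p)) \<in> borel_measurable (borel_on X)"
    using measurable_chart_push[OF c H(1)] by measurable
  have "(\<integral>\<^sup>+p. ennreal (chart_push c H p) \<partial>vol) =
      (\<integral>\<^sup>+p. ennreal (chart_push c H p) * indicator (chart_dom c) p \<partial>vol)"
    by (intro nn_integral_cong) (simp add: chart_push_def)
  also have "\<dots> = (\<integral>\<^sup>+x. ennreal (chart_push c H (coord_inv c x)) * ennreal (vol_density c x) *
      indicator (chart_img c) x \<partial>lborel)"
    by (rule nn_integral_riemannian_volume_chart[OF c m])
  also have "\<dots> = (\<integral>\<^sup>+x. ennreal (H x * vol_density c x) * indicator (chart_img c) x \<partial>lborel)"
  proof (intro nn_integral_cong)
    fix x
    show "ennreal (chart_push c H (coord_inv c x)) * ennreal (vol_density c x) * indicator (chart_img c) x =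
        ennreal (H x * vol_density c x) * indicator (chart_img c) x"
      using coord_inv_in[of x c] coord_coord_inv[of x c] H(2)[of x]
      by (cases "x \<in> chart_img c") (auto simp: chart_push_def ennreal_mult')
  qed
  finally show ?thesis .
qed

end

context chart_bump
begin

lemma Lp_space_push:
  assumes H: "continuous_on K H" "\<And>x. x \<notin> K \<Longrightarrow> H x = 0" and m: "0 < m"
    and f: "\<And>p. p \<in> topspace X \<Longrightarrow> f p = chart_push c0 H p"
  shows "f \<in> Lp_space m vol"
proof -
  let ?\<mu> = "vol" and ?H = "\<lambda>x. \<bar>H x\<bar> ^ m"
  have Hb: "H \<in> borel_measurable borel"
  proof -
    have "(\<lambda>x. indicator K x *\<^sub>R H x) \<in> borel_measurable borel"
      by (rule borel_measurable_continuous_on_indicator[OF borel_closed[OF K_closed] H(1)])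
    moreover have "(\<lambda>x. indicator K x *\<^sub>R H x) = H"
      using H(2) by (auto simp: fun_eq_iff indicator_def)
    ultimately show ?thesis by simp
  qed
  have "chart_push c0 H \<in> borel_measurable (borel_on X)"
    by (rule measurable_chart_push[OF c0 Hb])
  then have fm: "f \<in> borel_measurable ?\<mu>"
    using f by (subst measurable_cong_sets[OF sets_riemannian_volume refl])
      (auto intro: measurable_cong[THEN iffD1, rotated])
  have "(\<integral>\<^sup>+p. ennreal (norm (\<bar>f p\<bar> ^ m)) \<partial>?\<mu>) = (\<integral>\<^sup>+p. ennreal (chart_push c0 ?H p) \<partial>?\<mu>)"
    using f by (intro nn_integral_cong) (simp add: chart_push_def m)
  also have "\<dots> = (\<integral>\<^sup>+x. ennreal (?H x * vol_density c0 x) * indicator (chart_img c0) x \<partial>lborel)"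
    by (rule nn_integral_chart_push[OF c0]) (use Hb in auto)
  also have "\<dots> = (\<integral>\<^sup>+x. ennreal (indicator K x *\<^sub>R (?H x * vol_density c0 x)) \<partial>lborel)"
    using H(2) K_img m by (intro nn_integral_cong) (auto simp: indicator_def zero_power)
  also have "\<dots> < \<infinity>"
  proof -
    have "integrable lborel (\<lambda>x. indicator K x *\<^sub>R (?H x * vol_density c0 x))"
      using H(1) continuous_on_subset[OF continuous_on_vol_density[OF c0] K_img]
      by (intro borel_integrable_compact K_compact continuous_intros)
    then have "(\<integral>\<^sup>+x. ennreal (norm (indicator K x *\<^sub>R (?H x * vol_density c0 x))) \<partial>lborel) < \<infinity>"
      by (simp add: integrable_iff_bounded)
    moreover have "norm (indicator K x *\<^sub>R (?H x * vol_density c0 x)) = indicator K x *\<^sub>R (?H x * vol_density c0 x)" for x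
      using vol_density_pos[OF c0, of x] K_img by (auto simp: indicator_def abs_mult less_imp_le)
    ultimately show ?thesis by simp
  qed
  finally show ?thesis
    using fm by (auto simp: Lp_space_def integrable_iff_bounded)
qed

lemma push_has_W1n_gradient: "has_W1n_gradient X A g (chart_push c0 U) grad_field"
  unfolding has_W1n_gradient_def
proof (intro conjI push_has_weak_gradient)
  show "chart_push c0 U \<in> Lp_space CARD('n) vol"
    by (rule Lp_space_push[OF continuous_U U_supp]) auto
  show "vf_norm A g grad_field \<in> Lp_space CARD('n) vol"
    by (rule Lp_space_push[OF continuous_grad_norm grad_norm_outside]) (auto simp: vf_norm_grad)
qed

text \<open>The approximating function is the function itself. A gradient of the difference, which is 0, comes from the
  same construction with \<open>U = 0\<close>.\<close>

lemma push_W1n_0: "chart_push c0 U \<in> W1n_0 X A g"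
proof -
  interpret zero: chart_bump X A g c0 "\<lambda>_. 0" K
    by unfold_locales (auto intro: c0 K_compact K_int Ck_on_const subsetD[OF K_int])
  have z: "(\<lambda>p. chart_push c0 U p - chart_push c0 U p) = chart_push c0 (\<lambda>_. 0)"
    by (simp add: fun_eq_iff chart_push_def)
  have norm0: "Lp_norm CARD('n) vol f = 0" if "\<And>p. p \<in> topspace X \<Longrightarrow> f p = 0" for f
  proof -
    have "(\<integral>x. \<bar>f x\<bar> ^ CARD('n) \<partial>vol) = (\<integral>x. 0 \<partial>vol)"
      by (rule Bochner_Integration.integral_cong) (use that in auto)
    then show ?thesis by (simp add: Lp_norm_def)
  qed
  have g0: "zero.grad_norm x = 0" for x
  proof (cases "x \<in> K")
    case True
    have "zero.dU x = (\<lambda>_. 0)" by (simp add: frechet_derivative_const)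
    then show ?thesis using zero.grad_norm_sq(2)[OF True] by simp
  qed (rule zero.grad_norm_outside)
  have "has_W1n_gradient X A g (\<lambda>p. chart_push c0 U p - chart_push c0 U p) zero.grad_field"
    unfolding z by (rule zero.push_has_W1n_gradient)
  moreover have "Lp_norm CARD('n) vol (\<lambda>p. chart_push c0 U p - chart_push c0 U p) = 0"
    by (rule norm0) simp
  moreover have "Lp_norm CARD('n) vol (vf_norm A g zero.grad_field) = 0"
    by (rule norm0) (simp add: zero.vf_norm_grad chart_push_def g0)
  ultimately have "\<forall>\<epsilon>>0. \<exists>f\<in>C0_inf X A. \<exists>V. has_W1n_gradient X A g (\<lambda>p. chart_push c0 U p - f p) V \<and>
        Lp_norm CARD('n) vol (\<lambda>p. chart_push c0 U p - f p) +
        Lp_norm CARD('n) vol (vf_norm A g V) < \<epsilon>"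
    using push_C0_inf by (intro allI impI bexI[of _ "chart_push c0 U"] exI[of _ zero.grad_field]) auto
  then show ?thesis
    unfolding W1n_0_def W1n_def using push_has_W1n_gradient by auto
qed

lemma Lp_norm_push_le:
  assumes "0 \<le> b" "(\<integral>\<^sup>+x. ennreal (\<bar>U x\<bar> ^ CARD('n) * vol_density c0 x) * indicator (chart_img c0) x \<partial>lborel) \<le> ennreal b"
  shows "Lp_norm CARD('n) vol (chart_push c0 U) ^ CARD('n) \<le> b"
proof (rule Lp_norm_power_le[OF _ _ assms(1)])
  show "chart_push c0 U \<in> Lp_space CARD('n) vol"
    using push_has_W1n_gradient by (simp add: has_W1n_gradient_def)
  have "(\<lambda>x. \<bar>U x\<bar> ^ CARD('n)) \<in> borel_measurable borel"
    by (intro borel_measurable_continuous_onI continuous_intros continuous_U)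
  from nn_integral_chart_push[OF c0 this] assms(2)
  show "(\<integral>\<^sup>+p. ennreal (\<bar>chart_push c0 U p\<bar> ^ CARD('n)) \<partial>vol) \<le> ennreal b"
    by (simp add: chart_push_power)
qed simp

lemma Lp_norm_grad_le:
  assumes "0 \<le> b" "(\<integral>\<^sup>+x. ennreal (grad_norm x ^ CARD('n) * vol_density c0 x) * indicator (chart_img c0) x \<partial>lborel) \<le> ennreal b"
    and nn: "\<And>x. 0 \<le> grad_norm x"
  shows "Lp_norm CARD('n) vol (vf_norm A g grad_field) ^ CARD('n) \<le> b"
proof (rule Lp_norm_power_le[OF _ _ assms(1)])
  show "vf_norm A g grad_field \<in> Lp_space CARD('n) vol"
    using push_has_W1n_gradient by (simp add: has_W1n_gradient_def)
  have "grad_norm = (\<lambda>x. indicator K x *\<^sub>R grad_norm x)"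
    using grad_norm_outside by (auto simp: fun_eq_iff indicator_def)
  then have "grad_norm \<in> borel_measurable borel"
    using borel_measurable_continuous_on_indicator[OF borel_closed[OF K_closed] continuous_grad_norm] by simp
  then have "(\<lambda>x. grad_norm x ^ CARD('n)) \<in> borel_measurable borel" by measurable
  from nn_integral_chart_push[OF c0 this] assms(2) nn
  have "(\<integral>\<^sup>+p. ennreal (chart_push c0 (\<lambda>x. grad_norm x ^ CARD('n)) p) \<partial>vol) \<le> ennreal b"
    by simp
  moreover have "(\<integral>\<^sup>+p. ennreal (\<bar>vf_norm A g grad_field p\<bar> ^ CARD('n)) \<partial>vol) =
      (\<integral>\<^sup>+p. ennreal (chart_push c0 (\<lambda>x. grad_norm x ^ CARD('n)) p) \<partial>vol)"
    by (rule nn_integral_cong) (simp add: vf_norm_grad chart_push_power nn)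
  ultimately show "(\<integral>\<^sup>+p. ennreal (\<bar>vf_norm A g grad_field p\<bar> ^ CARD('n)) \<partial>vol) \<le> ennreal b"
    by simp
qed simp

lemma grad_norm_nonneg: "0 \<le> grad_norm x"
proof (cases "x \<in> K")
  case True
  then show ?thesis
    using grad_norm_sq(1)[OF True] unfolding grad_norm_def by (metis real_sqrt_ge_zero zero_le_power2)
qed (simp add: grad_norm_outside)

end

section \<open>The radial profile\<close>

text \<open>A smooth substitute for \<open>min L (max 0 t)\<close>: the positive part is applied to \<open>t\<close> and, reflected, to the
  distance from \<open>L\<close>. It is exactly constant for \<open>t \<ge> L + 1\<close>.\<close>

definition trunc :: "real \<Rightarrow> real \<Rightarrow> real" where
  "trunc L t = soft_pos L - soft_pos (L - soft_pos t)"

definition trunc' :: "real \<Rightarrow> real \<Rightarrow> real" where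
  "trunc' L t = soft_pos' (L - soft_pos t) * soft_pos' t"

lemma trunc_has_derivative: "(trunc L has_real_derivative trunc' L t) (at t)"
  unfolding trunc_def trunc'_def
  by (auto intro!: derivative_eq_intros DERIV_chain2[OF soft_pos_has_derivative] soft_pos_has_derivative)

lemma trunc'_bounds: "0 \<le> trunc' L t" "trunc' L t \<le> 1"
  using soft_pos'_bounds by (auto simp: trunc'_def intro: mult_le_one)

lemma trunc_nonpos: "t \<le> 0 \<Longrightarrow> trunc L t = 0"
  by (simp add: trunc_def soft_pos_nonpos)

lemma trunc'_nonpos: "t \<le> 0 \<Longrightarrow> trunc' L t = 0"
  by (simp add: trunc'_def soft_pos'_def)

lemma trunc_top: "L + 1 \<le> t \<Longrightarrow> trunc L t = soft_pos L"
  using soft_pos_ge[of t] by (simp add: trunc_def soft_pos_nonpos)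

lemma trunc'_top: "L + 1 \<le> t \<Longrightarrow> trunc' L t = 0"
  using soft_pos_ge[of t] by (simp add: trunc'_def soft_pos'_def)

lemma trunc_range:
  assumes "0 \<le> t"
  shows "0 \<le> trunc L t" "trunc L t \<le> t"
proof -
  have "trunc L 0 \<le> trunc L t"
    by (rule DERIV_nonneg_imp_nondecreasing[OF assms]) (use trunc_has_derivative trunc'_bounds in blast)
  then show "0 \<le> trunc L t" by (simp add: trunc_nonpos)
  have "((\<lambda>s. s - trunc L s) has_real_derivative 1 - trunc' L s) (at s)" for s
    by (rule DERIV_diff[OF DERIV_ident trunc_has_derivative])
  then have "0 - trunc L 0 \<le> t - trunc L t"
    using trunc'_bounds(2) by (intro DERIV_nonneg_imp_nondecreasing[OF assms, where f = "\<lambda>s. s - trunc L s"]) fastforce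
  then show "trunc L t \<le> t" by (simp add: trunc_nonpos)
qed

lemma Ck_on_trunc: "Ck_on k (trunc L) UNIV"
proof -
  have "Ck_on k (\<lambda>t. L + - soft_pos t) UNIV"
    by (intro Ck_on_add Ck_on_minus Ck_on_const Ck_on_soft_pos open_UNIV)
  then have "Ck_on k (\<lambda>t. soft_pos (L + - soft_pos t)) UNIV"
    by (intro Ck_on_compose[OF open_UNIV _ Ck_on_soft_pos]) auto
  then have "Ck_on k (\<lambda>t. soft_pos L + - soft_pos (L + - soft_pos t)) UNIV"
    by (intro Ck_on_add Ck_on_minus Ck_on_const open_UNIV)
  moreover have "trunc L = (\<lambda>t. soft_pos L + - soft_pos (L + - soft_pos t))"
    by (simp add: fun_eq_iff trunc_def)
  ultimately show ?thesis by simp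
qed

text \<open>\<open>trunc L (ln (\<delta> / r))\<close> as a function of \<open>z = (r / \<delta>)\<^sup>2\<close>. The square of the norm is smooth at the center, and the
  profile is constant for small \<open>z\<close>, so no singularity is left.\<close>

definition profile :: "real \<Rightarrow> real \<Rightarrow> real" where
  "profile L z = (if z \<le> 0 then soft_pos L else trunc L (- (ln z / 2)))"

definition profile' :: "real \<Rightarrow> real \<Rightarrow> real" where
  "profile' L z = (if z \<le> 0 then 0 else - trunc' L (- (ln z / 2)) / (2 * z))"

lemma profile_small: "z \<le> exp (- (2 * (L + 1))) \<Longrightarrow> profile L z = soft_pos L"
proof (cases "z \<le> 0")
  case False
  assume z: "z \<le> exp (- (2 * (L + 1)))"
  with False have "ln z \<le> ln (exp (- (2 * (L + 1))))" by (subst ln_le_cancel_iff) auto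
  then show ?thesis using False by (simp add: profile_def trunc_top)
qed (simp add: profile_def)

lemma profile'_small: "z \<le> exp (- (2 * (L + 1))) \<Longrightarrow> profile' L z = 0"
proof (cases "z \<le> 0")
  case False
  assume z: "z \<le> exp (- (2 * (L + 1)))"
  with False have "ln z \<le> ln (exp (- (2 * (L + 1))))" by (subst ln_le_cancel_iff) auto
  then show ?thesis using False by (simp add: profile'_def trunc'_top)
qed (simp add: profile'_def)

lemma profile_ge_1: "1 \<le> z \<Longrightarrow> profile L z = 0"
  by (simp add: profile_def trunc_nonpos)

lemma profile'_ge_1: "1 \<le> z \<Longrightarrow> profile' L z = 0"
  by (simp add: profile'_def trunc'_nonpos)

lemma profile_has_derivative: "(profile L has_real_derivative profile' L z) (at z)"
proof (cases "0 < z")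
  case True
  have "((\<lambda>z. trunc L (- (ln z / 2))) has_real_derivative trunc' L (- (ln z / 2)) * (- (inverse z / 2))) (at z)"
    by (rule DERIV_chain2[OF trunc_has_derivative])
      (use True in \<open>auto intro!: derivative_eq_intros simp: field_simps\<close>)
  then have "((\<lambda>z. trunc L (- (ln z / 2))) has_real_derivative profile' L z) (at z)"
    using True by (simp add: profile'_def field_simps)
  then show ?thesis
    by (rule has_field_derivative_transform_within_open[where S = "{0<..}"]) (use True in \<open>auto simp: profile_def\<close>)
next
  case False
  have "((\<lambda>z. soft_pos L) has_real_derivative 0) (at z)" by simp
  then have "(profile L has_real_derivative 0) (at z)"
    by (rule has_field_derivative_transform_within_open[where S = "{..<exp (- (2 * (L + 1)))}"])
      (use False profile_small in \<open>auto intro: le_less_trans[OF _ exp_gt_zero]\<close>)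
  then show ?thesis using False by (simp add: profile'_def)
qed

lemma Ck_on_profile: "Ck_on k (profile L) UNIV"
proof (rule Ck_on_local)
  fix z :: real
  show "\<exists>W. open W \<and> z \<in> W \<and> Ck_on k (profile L) W"
  proof (cases "0 < z")
    case True
    have "Ck_on k (\<lambda>z. (- (1/2) :: real) * ln z) {0<..}"
      by (rule Ck_on_linear_comp[OF bounded_linear_mult_right open_greaterThan Ck_on_ln])
    then have "Ck_on k (\<lambda>z. trunc L ((- (1/2)) * ln z)) {0<..}"
      by (intro Ck_on_compose[OF open_greaterThan _ Ck_on_trunc]) auto
    then have "Ck_on k (profile L) {0<..}"
      by (rule Ck_on_cong[OF open_greaterThan, rotated]) (auto simp: profile_def)
    then show ?thesis using True by (intro exI[of _ "{0<..}"]) auto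
  next
    case False
    have "Ck_on k (profile L) {..<exp (- (2 * (L + 1)))}"
      by (rule Ck_on_cong[OF open_lessThan _ Ck_on_const]) (use profile_small in auto)
    then show ?thesis using False
      by (intro exI[of _ "{..<exp (- (2 * (L + 1)))}"]) (auto intro: le_less_trans[OF _ exp_gt_zero])
  qed
qed

lemma profile_radius_le:
  assumes "0 < r" "r < \<delta>"
  shows "0 \<le> profile L ((r / \<delta>)\<^sup>2)" "profile L ((r / \<delta>)\<^sup>2) \<le> ln (\<delta> / r)"
proof -
  have "- (ln ((r / \<delta>)\<^sup>2) / 2) = ln (\<delta> / r)"
    using assms by (simp add: ln_realpow ln_div field_simps)
  moreover have "0 < (r / \<delta>)\<^sup>2" using assms by (simp add: zero_less_power)
  moreover have "0 \<le> ln (\<delta> / r)" using assms by simp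
  ultimately show "0 \<le> profile L ((r / \<delta>)\<^sup>2)" "profile L ((r / \<delta>)\<^sup>2) \<le> ln (\<delta> / r)"
    using trunc_range[of "ln (\<delta> / r)" L] by (simp_all add: profile_def del: ln_divide_pos)
qed

text \<open>By the chain rule, the left-hand side is the length of the gradient of the profile with respect to \<open>y\<close>.\<close>

lemma profile'_radius:
  assumes "0 < \<delta>" "0 \<le> r"
  shows "\<bar>profile' L ((r / \<delta>)\<^sup>2)\<bar> * (2 * r / \<delta>\<^sup>2) \<le> (if \<delta> * exp (- (L + 1)) < r \<and> r < \<delta> then 1 / r else 0)"
proof (cases "\<delta> * exp (- (L + 1)) < r \<and> r < \<delta>")
  case True
  have "0 < \<delta> * exp (- (L + 1))" using assms by simp
  then have r: "0 < r" using True by linarith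
  then have z: "0 < (r / \<delta>)\<^sup>2" using assms by simp
  define a where "a = trunc' L (- (ln ((r / \<delta>)\<^sup>2) / 2))"
  have a: "0 \<le> a" "a \<le> 1" using trunc'_bounds by (auto simp: a_def)
  have "\<bar>profile' L ((r / \<delta>)\<^sup>2)\<bar> = a / (2 * (r / \<delta>)\<^sup>2)"
    using z a by (simp add: profile'_def a_def[symmetric])
  then have "\<bar>profile' L ((r / \<delta>)\<^sup>2)\<bar> * (2 * r / \<delta>\<^sup>2) = a / r"
    using r assms by (simp add: field_simps power2_eq_square)
  also have "\<dots> \<le> 1 / r" using a r by (simp add: divide_right_mono)
  finally show ?thesis using True by simp
next
  case False
  then consider "r \<le> \<delta> * exp (- (L + 1))" | "\<delta> \<le> r" by linarith
  then have "profile' L ((r / \<delta>)\<^sup>2) = 0"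
  proof cases
    case 1
    then have "r / \<delta> \<le> exp (- (L + 1))" using assms by (simp add: field_simps)
    then have "(r / \<delta>)\<^sup>2 \<le> (exp (- (L + 1)))\<^sup>2" using assms by (intro power_mono) auto
    also have "\<dots> = exp (- (2 * (L + 1)))" by (simp add: power2_eq_square exp_add[symmetric] algebra_simps)
    finally show ?thesis by (rule profile'_small)
  next
    case 2
    then have "1 \<le> r / \<delta>" using assms by simp
    then have "1 \<le> (r / \<delta>)\<^sup>2" by (simp add: one_le_power)
    then show ?thesis by (rule profile'_ge_1)
  qed
  then show ?thesis using False by (auto simp: assms)
qed

lemma profile_radius_small:
  assumes "0 < \<delta>" "0 \<le> r" "r \<le> \<delta> * exp (- (L + 1))"
  shows "profile L ((r / \<delta>)\<^sup>2) = soft_pos L"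
proof -
  have "r / \<delta> \<le> exp (- (L + 1))" using assms by (simp add: field_simps)
  then have "(r / \<delta>)\<^sup>2 \<le> (exp (- (L + 1)))\<^sup>2" using assms by (intro power_mono) auto
  also have "\<dots> = exp (- (2 * (L + 1)))" by (simp add: power2_eq_square exp_add[symmetric] algebra_simps)
  finally show ?thesis by (rule profile_small)
qed

text \<open>The density \<open>r ^ (n - 1)\<close> turns \<open>r\<close> to the power \<open>- n\<close> into \<open>1 / r\<close>, with integral \<open>ln (\<delta> / a)\<close>; the term with \<open>C\<close>
  stays bounded as \<open>a\<close> tends to 0.\<close>

lemma nn_integral_annulus:
  fixes \<delta> a C :: real
  assumes "0 < a" "a \<le> \<delta>" "\<delta> \<le> 1" "0 \<le> C"
  shows "(\<integral>\<^sup>+y. ennreal ((if a < norm y \<and> norm y < \<delta> then (1 / norm y) ^ DIM('e) else 0) * (1 + C * norm y))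
      \<partial>(lborel :: 'e::euclidean_space measure)) \<le>
    ennreal (DIM('e) * unit_ball_vol DIM('e) * (ln (\<delta> / a) + C))"
proof -
  let ?w = "DIM('e) * unit_ball_vol (real DIM('e))"
  let ?f = "\<lambda>r. ennreal ((if a < r \<and> r < \<delta> then (1 / r) ^ DIM('e) else 0) * (1 + C * r))"
  have w0: "0 \<le> ?w" by simp
  have "(\<integral>\<^sup>+y. ?f (norm y) \<partial>(lborel :: 'e measure)) =
      (\<integral>\<^sup>+r. ennreal (?w * r ^ (DIM('e) - 1)) * indicator {0..} r * ?f r \<partial>lborel)"
    by (rule nn_integral_radial) measurable
  also have "\<dots> \<le> (\<integral>\<^sup>+r. ennreal (?w * (1 / r + C)) * indicator {a..\<delta>} r \<partial>lborel)"
  proof (rule nn_integral_mono)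
    fix r :: real
    show "ennreal (?w * r ^ (DIM('e) - 1)) * indicator {0..} r * ?f r \<le> ennreal (?w * (1 / r + C)) * indicator {a..\<delta>} r"
    proof (cases "a < r \<and> r < \<delta>")
      case True
      then have r: "0 < r" using assms by simp
      have "r ^ DIM('e) = r * r ^ (DIM('e) - 1)"
        using power_Suc[of r "DIM('e) - 1"] by simp
      then have eq1: "?w * r ^ (DIM('e) - 1) * ((1 / r) ^ DIM('e) * (1 + C * r)) = ?w * (1 / r + C)"
        using r by (simp add: field_simps)
      have eq2: "ennreal (?w * r ^ (DIM('e) - 1)) * indicator {0..} r * ?f r =
          ennreal (?w * r ^ (DIM('e) - 1) * ((1 / r) ^ DIM('e) * (1 + C * r)))"
        using True r w0 assms by (subst ennreal_mult') (auto simp del: ennreal_plus)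
      show ?thesis unfolding eq2 eq1 using True by simp
    qed auto
  qed
  also have "\<dots> = ennreal ((?w * (ln \<delta> + C * \<delta>)) - (?w * (ln a + C * a)))"
    using assms w0
    by (intro nn_integral_FTC_Icc) (auto intro!: derivative_eq_intros mult_nonneg_nonneg add_nonneg_nonneg simp: field_simps)
  also have "(?w * (ln \<delta> + C * \<delta>)) - (?w * (ln a + C * a)) = ?w * (ln (\<delta> / a) + C * (\<delta> - a))"
    using assms by (simp add: ln_div algebra_simps)
  also have "ennreal \<dots> \<le> ennreal (?w * (ln (\<delta> / a) + C))"
    using assms w0 by (intro ennreal_leI mult_left_mono add_left_mono mult_left_le) auto
  finally show ?thesis .
qed

text \<open>From \<open>t ^ n / n! \<le> exp t\<close> with \<open>t = ln (\<delta> / r)\<close> the integrand is at most \<open>n! * \<delta> / r\<close>. This is integrable against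
  \<open>r ^ (n - 1)\<close> because \<open>n \<ge> 2\<close>.\<close>

lemma nn_integral_log_power:
  fixes \<delta> :: real
  assumes "2 \<le> DIM('e)" "0 < \<delta>" "\<delta> \<le> 1"
  shows "(\<integral>\<^sup>+y. ennreal (if norm y < \<delta> \<and> y \<noteq> 0 then ln (\<delta> / norm y) ^ DIM('e) else 0) \<partial>(lborel :: 'e::euclidean_space measure)) \<le>
    ennreal (DIM('e) * unit_ball_vol DIM('e) * fact DIM('e))"
proof -
  let ?n = "DIM('e)"
  let ?w = "?n * unit_ball_vol (real ?n)"
  let ?f = "\<lambda>r. ennreal (if r < \<delta> \<and> r \<noteq> 0 then fact ?n * (\<delta> / r) else 0)"
  have w0: "0 \<le> ?w" by simp
  have "(\<integral>\<^sup>+y. ennreal (if norm y < \<delta> \<and> y \<noteq> 0 then ln (\<delta> / norm y) ^ ?n else 0) \<partial>(lborel :: 'e measure)) \<le>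
      (\<integral>\<^sup>+y. ?f (norm y) \<partial>(lborel :: 'e measure))"
  proof (intro nn_integral_mono ennreal_leI)
    fix y :: 'e
    show "(if norm y < \<delta> \<and> y \<noteq> 0 then ln (\<delta> / norm y) ^ ?n else 0) \<le>
        (if norm y < \<delta> \<and> norm y \<noteq> 0 then fact ?n * (\<delta> / norm y) else 0)"
    proof (cases "norm y < \<delta> \<and> y \<noteq> 0")
      case True
      then have q: "1 \<le> \<delta> / norm y" by simp
      define t where "t = ln (\<delta> / norm y)"
      have t: "0 \<le> t" "exp t = \<delta> / norm y" using q by (auto simp: t_def)
      have "(\<lambda>k. t ^ k /\<^sub>R fact k) sums exp t" by (rule exp_converges)
      then have "t ^ ?n /\<^sub>R fact ?n \<le> exp t"
        using sum_le_suminf[of "\<lambda>k. t ^ k /\<^sub>R fact k" "{?n}"] t(1) by (auto simp: sums_iff)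
      then have "t ^ ?n \<le> fact ?n * (\<delta> / norm y)" unfolding t(2)[symmetric] by (simp add: field_simps)
      then show ?thesis using True by (simp add: t_def)
    qed auto
  qed
  also have "\<dots> = (\<integral>\<^sup>+r. ennreal (?w * r ^ (?n - 1)) * indicator {0..} r * ?f r \<partial>lborel)"
    by (rule nn_integral_radial) measurable
  also have "\<dots> \<le> (\<integral>\<^sup>+r. ennreal (?w * fact ?n) * indicator {0..1} (r :: real) \<partial>lborel)"
  proof (rule nn_integral_mono)
    fix r :: real
    show "ennreal (?w * r ^ (?n - 1)) * indicator {0..} r * ?f r \<le> ennreal (?w * fact ?n) * indicator {0..1} r"
    proof (cases "0 < r \<and> r < \<delta>")
      case True
      then have r: "0 < r" "r \<le> 1" using assms by auto
      have e: "r ^ (?n - 1) = r * r ^ (?n - 2)"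
      proof -
        obtain m where "?n = Suc (Suc m)" using assms(1) by (metis add_2_eq_Suc le_Suc_ex)
        then show ?thesis by simp
      qed
      have "?w * r ^ (?n - 1) * (fact ?n * (\<delta> / r)) = ?w * fact ?n * (r ^ (?n - 2) * \<delta>)"
        unfolding e using r by (simp add: field_simps)
      also have "\<dots> \<le> ?w * fact ?n * 1"
        using r assms w0 by (intro mult_left_mono mult_le_one power_le_one) auto
      finally have le: "?w * r ^ (?n - 1) * (fact ?n * (\<delta> / r)) \<le> ?w * fact ?n" by simp
      have "ennreal (?w * r ^ (?n - 1)) * indicator {0..} r * ?f r =
          ennreal (?w * r ^ (?n - 1) * (fact ?n * (\<delta> / r)))"
        using True r w0 assms by (subst ennreal_mult') auto
      also have "\<dots> \<le> ennreal (?w * fact ?n)" by (rule ennreal_leI[OF le])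
      finally show ?thesis using r by simp
    qed (auto simp: indicator_def)
  qed
  also have "\<dots> = ennreal (?w * fact ?n)"
    by (simp add: nn_integral_cmult_indicator)
  finally show ?thesis .
qed

section \<open>Coordinates adapted to the metric at a point\<close>

lemma Ck_on_prod:
  fixes f :: "'i \<Rightarrow> 'e::euclidean_space \<Rightarrow> real"
  assumes "open U" "\<And>i. i \<in> I \<Longrightarrow> Ck_on k (f i) U"
  shows "Ck_on k (\<lambda>x. \<Prod>i\<in>I. f i x) U"
  using assms(2)
  by (induction I rule: infinite_finite_induct) (auto intro: Ck_on_const Ck_on_mult[OF assms(1)])

lemma Ck_on_det: "Ck_on k (det :: real^'n::finite^'n \<Rightarrow> real) UNIV"
proof -
  have "Ck_on k (\<lambda>M :: real^'n^'n. M $ i $ j) UNIV" for i j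
    by (intro Ck_on_linear bounded_linear_compose[OF bounded_linear_vec_nth bounded_linear_vec_nth])
  then show ?thesis
    unfolding det_def[abs_def] by (intro Ck_on_sum Ck_on_mult Ck_on_const Ck_on_prod open_UNIV)
qed

lemma has_derivative_imp_linear_bound:
  fixes f :: "'a::real_normed_vector \<Rightarrow> 'b::real_normed_vector"
  assumes "(f has_derivative f') (at 0)"
  shows "\<exists>C\<ge>0. \<exists>d>0. \<forall>y. norm y \<le> d \<longrightarrow> norm (f y - f 0) \<le> C * norm y"
proof -
  have bl: "bounded_linear f'" using assms by (rule has_derivative_bounded_linear)
  obtain d where d: "0 < d" "\<And>y. norm (y - 0) < d \<Longrightarrow> norm (f y - f 0 - f' (y - 0)) \<le> 1 * norm (y - 0)"
    using assms unfolding has_derivative_at_alt by (metis zero_less_one)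
  have "norm (f y - f 0) \<le> (1 + onorm f') * norm y" if "norm y \<le> d / 2" for y
  proof -
    have "norm y < d" using that d(1) by linarith
    then have "norm (f y - f 0 - f' y) \<le> norm y" using d(2)[of y] by simp
    moreover have "norm (f' y) \<le> onorm f' * norm y" by (rule onorm[OF bl])
    moreover have "norm (f y - f 0) \<le> norm (f y - f 0 - f' y) + norm (f' y)"
      using norm_triangle_ineq[of "f y - f 0 - f' y" "f' y"] by simp
    ultimately show ?thesis by (simp add: algebra_simps)
  qed
  then show ?thesis using d(1) onorm_pos_le[OF bl]
    by (intro exI[of _ "1 + onorm f'"] conjI exI[of _ "d / 2"]) auto
qed

lemma quadratic_form_bound:
  "\<exists>K\<ge>0. \<forall>M :: real^'n::finite^'m::finite. \<forall>v. norm (M *v v) \<le> K * norm M * norm v"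
proof -
  have "bilinear ((*v) :: real^'n^'m \<Rightarrow> _)"
    unfolding bilinear_def
    by (auto simp: linear_iff matrix_vector_mult_add_rdistrib matrix_vector_right_distrib
        scaleR_matrix_vector_assoc matrix_vector_mult_scaleR)
  then have "bounded_bilinear ((*v) :: real^'n^'m \<Rightarrow> _)"
    by (simp add: bilinear_conv_bounded_bilinear)
  from bounded_bilinear.nonneg_bounded[OF this]
  obtain K where "0 \<le> K" "\<And>M v. norm ((M :: real^'n^'m) *v v) \<le> norm M * norm v * K" by blast
  then show ?thesis by (intro exI[of _ K]) (auto simp: mult_ac)
qed

text \<open>The coordinates \<open>y\<close> with \<open>x = x0 + P *v y\<close> make the metric at \<open>x0\<close> the identity. In them the metric
  and its volume density deviate from the Euclidean ones by an error linear in \<open>norm y\<close> on the ball of radius \<open>\<delta>\<close>. For the metric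
  this is a lower bound, because the length of a gradient is dual to the metric.\<close>

locale adapted_chart = riemannian_manifold X A g
  for X :: "'a topology" and A :: "('a, 'n::finite) chart set" and g :: "('a, 'n) chart \<Rightarrow> 'a \<Rightarrow> real^'n^'n" +
  fixes c0 :: "('a, 'n) chart" and x0 :: "real^'n" and P B :: "real^'n^'n" and \<delta> C1 C2 :: real
  assumes c0: "c0 \<in> A" and BP: "B ** P = mat 1" and PB: "P ** B = mat 1"
    and \<delta>: "0 < \<delta>" "\<delta> \<le> 1" and C1: "0 \<le> C1" "C1 * \<delta> \<le> 1 / 2" and C2: "0 \<le> C2"
    and ball_int: "\<And>y. norm y \<le> \<delta> \<Longrightarrow> x0 + P *v y \<in> interior (chart_img c0)"
    and metric_lower: "\<And>y v. norm y \<le> \<delta> \<Longrightarrow>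
      (1 - C1 * norm y) * (norm (B *v v))\<^sup>2 \<le> v \<bullet> (g c0 (coord_inv c0 (x0 + P *v y)) *v v)"
    and density_lower: "\<And>y. norm y \<le> \<delta> \<Longrightarrow> 1 / 2 \<le> \<bar>det P\<bar> * vol_density c0 (x0 + P *v y)"
    and density_upper: "\<And>y. norm y \<le> \<delta> \<Longrightarrow> \<bar>det P\<bar> * vol_density c0 (x0 + P *v y) \<le> 1 + C2 * norm y"

text \<open>The components of the metric and its determinant are differentiable functions of \<open>y\<close>, hence they differ from
  their values at 0 by at most a constant times \<open>norm y\<close>.\<close>

lemma (in riemannian_manifold) adapted_chart_exists:
  assumes c: "c \<in> A" and x0: "x0 \<in> interior (chart_img c)"
  shows "\<exists>P B \<delta> C1 C2. adapted_chart X A g c x0 P B \<delta> C1 C2"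
proof -
  define G where "G x = g c (coord_inv c x)" for x
  have xi: "x0 \<in> chart_img c" using x0 interior_subset by blast
  have sym: "transpose (G x0) = G x0" and pos: "\<And>v. v \<noteq> 0 \<Longrightarrow> 0 < v \<bullet> (G x0 *v v)"
    using symmetric[OF c coord_inv_in[OF xi]] positive[OF c coord_inv_in[OF xi]] by (auto simp: G_def)
  obtain P :: "real^'n^'n" where P: "transpose P ** (G x0 ** P) = mat 1"
    using linear_orthonormal_frame[OF sym pos] by blast
  define B where "B = transpose P ** G x0"
  have BP: "B ** P = mat 1" using P by (simp add: B_def matrix_mul_assoc)
  then have PB: "P ** B = mat 1" by (simp add: matrix_left_right_inverse)
  have G0: "v \<bullet> (G x0 *v v) = (norm (B *v v))\<^sup>2" for v
  proof -
    have v: "v = P *v (B *v v)" by (simp add: matrix_vector_mul_assoc PB)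
    have "v \<bullet> (G x0 *v v) = (P *v (B *v v)) \<bullet> (G x0 *v (P *v (B *v v)))" using v by simp
    also have "\<dots> = (B *v v) \<bullet> (transpose P *v (G x0 *v (P *v (B *v v))))" by (rule inner_matrix_left)
    also have "transpose P *v (G x0 *v (P *v (B *v v))) = (transpose P ** (G x0 ** P)) *v (B *v v)"
      by (simp add: matrix_vector_mul_assoc matrix_mul_assoc)
    also have "\<dots> = B *v v" unfolding P by simp
    finally show ?thesis by (simp add: power2_norm_eq_inner)
  qed
  have "det P * (det (G x0) * det P) = 1" using P by (metis det_I det_mul det_transpose)
  then have detP: "(det P)\<^sup>2 * det (G x0) = 1" by (simp add: power2_eq_square algebra_simps)
  have "Ck_on (Suc 0) (g c \<circ> coord_inv c) (interior (chart_img c))"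
    by (rule smooth_on_openD[OF smooth_on_subset[OF smooth[OF c] interior_subset]]) simp
  then obtain G' where "((g c \<circ> coord_inv c) has_derivative G') (at x0)"
    using x0 by (auto simp: differentiable_def)
  then have G': "(G has_derivative G') (at x0)" by (simp add: G_def[abs_def] o_def)
  have T: "((\<lambda>y. x0 + P *v y) has_derivative (\<lambda>v. P *v v)) (at 0)"
    by (auto intro!: derivative_eq_intros bounded_linear_imp_has_derivative matrix_vector_mul_bounded_linear)
  have d1: "((\<lambda>y. G (x0 + P *v y)) has_derivative (\<lambda>v. G' (P *v v))) (at 0)"
    by (rule has_derivative_compose[OF T]) (use G' in simp)
  have "Ck_on (Suc 0) (det :: real^'n^'n \<Rightarrow> real) UNIV" by (rule Ck_on_det)
  then obtain det' where "((det :: real^'n^'n \<Rightarrow> real) has_derivative det') (at (G x0))"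
    by (auto simp: differentiable_def)
  then have "((\<lambda>y. det (G (x0 + P *v y))) has_derivative (\<lambda>v. det' (G' (P *v v)))) (at 0)"
    by (intro has_derivative_compose[OF d1]) simp
  then have d2: "((\<lambda>y. (det P)\<^sup>2 * det (G (x0 + P *v y))) has_derivative (\<lambda>v. (det P)\<^sup>2 * det' (G' (P *v v)))) (at 0)"
    by (rule has_derivative_mult_right)
  obtain Ca da where a: "0 \<le> Ca" "0 < da"
    "\<And>y. norm y \<le> da \<Longrightarrow> norm (G (x0 + P *v y) - G (x0 + P *v 0)) \<le> Ca * norm y"
    using has_derivative_imp_linear_bound[OF d1] by blast
  obtain Cb db where b: "0 \<le> Cb" "0 < db"
    "\<And>y. norm y \<le> db \<Longrightarrow> norm ((det P)\<^sup>2 * det (G (x0 + P *v y)) - (det P)\<^sup>2 * det (G (x0 + P *v 0))) \<le> Cb * norm y"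
    using has_derivative_imp_linear_bound[OF d2] by blast
  obtain K where K: "0 \<le> K" "\<And>M :: real^'n^'n. \<And>v. norm (M *v v) \<le> K * norm M * norm v"
    using quadratic_form_bound by blast
  define C1 where "C1 = K * Ca * (K * norm P)\<^sup>2"
  have C1: "0 \<le> C1" using K a by (simp add: C1_def)
  have "open ((\<lambda>y. x0 + P *v y) -` interior (chart_img c))"
    by (intro open_vimage open_interior continuous_intros linear_continuous_on matrix_vector_mul_bounded_linear)
  moreover have "0 \<in> (\<lambda>y. x0 + P *v y) -` interior (chart_img c)" using x0 by simp
  ultimately obtain dc where dc': "0 < dc" "ball 0 dc \<subseteq> (\<lambda>y. x0 + P *v y) -` interior (chart_img c)"
    by (rule openE)
  have dc: "0 < dc" "\<And>y. norm y < dc \<Longrightarrow> x0 + P *v y \<in> interior (chart_img c)"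
    using dc' by (auto simp: subset_iff)
  \<comment> \<open>the two error estimates hold, the ball stays in the chart, and both errors are at most one half\<close>
  define \<delta> where "\<delta> = Min {1, da, db, dc / 2, 1 / (2 * (C1 + 1)), 1 / (2 * (Cb + 1))}"
  have \<delta>: "0 < \<delta>" "\<delta> \<le> 1" "\<delta> \<le> da" "\<delta> \<le> db" "\<delta> \<le> dc / 2" "\<delta> \<le> 1 / (2 * (C1 + 1))" "\<delta> \<le> 1 / (2 * (Cb + 1))"
    using a b dc C1 by (auto simp: \<delta>_def)
  have small: "D * \<delta> \<le> 1 / 2" if "0 \<le> D" "\<delta> \<le> 1 / (2 * (D + 1))" for D
  proof -
    have "\<delta> * (2 * (D + 1)) \<le> 1" using that by (simp add: field_simps)
    then show ?thesis using \<delta>(1) by (simp add: algebra_simps)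
  qed
  have ball: "x0 + P *v y \<in> interior (chart_img c)" if "norm y \<le> \<delta>" for y
    using dc that \<delta>(5) by simp
  have dens: "\<bar>\<bar>det P\<bar> * vol_density c (x0 + P *v y) - 1\<bar> \<le> Cb * norm y" if "norm y \<le> \<delta>" for y
  proof -
    let ?r = "\<bar>det P\<bar> * vol_density c (x0 + P *v y)"
    have yi: "x0 + P *v y \<in> chart_img c" using ball[OF that] interior_subset by blast
    have r0: "0 \<le> ?r" using vol_density_pos[OF c yi] by simp
    have "0 < det (G (x0 + P *v y))"
      using det_metric_pos[OF c coord_inv_in[OF yi]] by (simp add: G_def)
    then have "?r\<^sup>2 = (det P)\<^sup>2 * det (G (x0 + P *v y))"
      by (simp add: power_mult_distrib vol_density_def G_def)
    then have "\<bar>?r\<^sup>2 - 1\<bar> \<le> Cb * norm y"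
      using b(3)[of y] that \<delta>(4) detP by simp
    moreover have "\<bar>t\<^sup>2 - 1\<bar> = \<bar>t - 1\<bar> * (t + 1)" if "0 \<le> t" for t :: real
    proof -
      have "t\<^sup>2 - 1 = (t - 1) * (t + 1)" by (simp add: power2_eq_square algebra_simps)
      then show ?thesis using that by (simp add: abs_mult)
    qed
    note this[OF r0]
    moreover have "\<bar>?r - 1\<bar> * 1 \<le> \<bar>?r - 1\<bar> * (?r + 1)" using r0 by (intro mult_left_mono) auto
    ultimately show ?thesis by linarith
  qed
  have "adapted_chart X A g c x0 P B \<delta> C1 Cb"
  proof unfold_locales
    show "(1 - C1 * norm y) * (norm (B *v v))\<^sup>2 \<le> v \<bullet> (g c (coord_inv c (x0 + P *v y)) *v v)"
      if y: "norm y \<le> \<delta>" for y v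
    proof -
      let ?D = "G (x0 + P *v y) - G x0"
      have "norm v = norm (P *v (B *v v))" by (simp add: matrix_vector_mul_assoc PB)
      also have "\<dots> \<le> K * norm P * norm (B *v v)" by (rule K(2))
      finally have nv: "(norm v)\<^sup>2 \<le> (K * norm P)\<^sup>2 * (norm (B *v v))\<^sup>2"
        using power_mono[of "norm v" "K * norm P * norm (B *v v)" 2] by (simp add: power_mult_distrib)
      have "\<bar>v \<bullet> (?D *v v)\<bar> \<le> norm v * norm (?D *v v)" by (rule Cauchy_Schwarz_ineq2)
      also have "\<dots> \<le> norm v * (K * norm ?D * norm v)" by (intro mult_left_mono K(2)) simp
      also have "\<dots> = K * norm ?D * (norm v)\<^sup>2" by (simp add: power2_eq_square)
      also have "\<dots> \<le> K * (Ca * norm y) * ((K * norm P)\<^sup>2 * (norm (B *v v))\<^sup>2)"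
        using a(3)[of y] y \<delta>(3) K(1) a(1) nv by (intro mult_mono mult_nonneg_nonneg) auto
      also have "\<dots> = C1 * norm y * (norm (B *v v))\<^sup>2" by (simp add: C1_def)
      finally have "\<bar>v \<bullet> (?D *v v)\<bar> \<le> C1 * norm y * (norm (B *v v))\<^sup>2" .
      moreover have "v \<bullet> (G (x0 + P *v y) *v v) = v \<bullet> (G x0 *v v) + v \<bullet> (?D *v v)"
        by (simp add: matrix_vector_mult_diff_rdistrib inner_diff_right)
      ultimately have "(norm (B *v v))\<^sup>2 - C1 * norm y * (norm (B *v v))\<^sup>2 \<le> v \<bullet> (G (x0 + P *v y) *v v)"
        using G0[of v] by linarith
      then show ?thesis by (simp add: G_def algebra_simps)
    qed
    show "1 / 2 \<le> \<bar>det P\<bar> * vol_density c (x0 + P *v y)" if y: "norm y \<le> \<delta>" for y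
    proof -
      have "Cb * norm y \<le> Cb * \<delta>" using y b(1) by (rule mult_left_mono)
      then show ?thesis using dens[OF y] small[OF b(1) \<delta>(7)] by linarith
    qed
    show "\<bar>det P\<bar> * vol_density c (x0 + P *v y) \<le> 1 + Cb * norm y" if y: "norm y \<le> \<delta>" for y
      using dens[OF y] by linarith
  qed (use c BP PB \<delta>(1,2) C1 small[OF C1 \<delta>(6)] b(1) ball in auto)
  then show ?thesis by blast
qed

context adapted_chart
begin

lemma dim: "DIM(real^'n) = CARD('n)" by simp

definition \<omega> :: real where "\<omega> = CARD('n) * unit_ball_vol CARD('n)"

definition param :: "real^'n \<Rightarrow> real^'n" where "param y = x0 + P *v y"

definition radius :: "real^'n \<Rightarrow> real" where "radius x = norm (B *v (x - x0))"

definition ellipsoid :: "real \<Rightarrow> (real^'n) set" where "ellipsoid s = param ` cball 0 s"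

text \<open>A bound for the excess energy, which is independent of \<open>L\<close>: the exponential comes from \<open>error_factor\<close>, and the
  summand 1 is the width of the transition zone of \<open>trunc\<close>.\<close>

definition slack :: real where
  "slack = (2 * CARD('n) * C1 + C2) * exp (2 * CARD('n) * C1 + C2) + 1"

text \<open>The normalization that makes the energy at most 1.\<close>

definition amplitude :: "real \<Rightarrow> real" where
  "amplitude L = (\<omega> * (L + slack)) powr (- (1 / CARD('n)))"

definition bump :: "real \<Rightarrow> real^'n \<Rightarrow> real" where
  "bump L x = amplitude L * profile L ((radius x / \<delta>)\<^sup>2)"

lemma \<omega>_pos: "0 < \<omega>" by (simp add: \<omega>_def)

lemma slack_ge_1: "1 \<le> slack" using C1 C2 by (simp add: slack_def)

lemma amplitude_pos: "0 \<le> L \<Longrightarrow> 0 < amplitude L"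
  using \<omega>_pos slack_ge_1 by (simp add: amplitude_def)

lemma amplitude_power: "0 \<le> L \<Longrightarrow> amplitude L ^ CARD('n) = 1 / (\<omega> * (L + slack))"
proof -
  assume "0 \<le> L"
  define z where "z = \<omega> * (L + slack)"
  have z: "0 < z" using \<open>0 \<le> L\<close> \<omega>_pos slack_ge_1 by (simp add: z_def)
  have "(z powr (- (1 / CARD('n)))) ^ CARD('n) = z powr (CARD('n) * (- (1 / CARD('n))))"
    by (rule powr_power) (use z in simp)
  also have "real CARD('n) * (- (1 / CARD('n))) = - 1" by simp
  also have "z powr (- 1) = 1 / z" using z by (simp add: powr_minus_divide)
  finally show ?thesis by (simp add: amplitude_def z_def)
qed

lemma radius_param [simp]: "radius (param y) = norm y"
  by (simp add: radius_def param_def matrix_vector_mul_assoc BP)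

lemma param_inverse: "param (B *v (x - x0)) = x"
  by (simp add: param_def matrix_vector_mul_assoc PB)

lemma ellipsoid_eq: "ellipsoid s = {x. radius x \<le> s}"
proof (intro set_eqI iffI)
  fix x assume "x \<in> {x. radius x \<le> s}"
  then show "x \<in> ellipsoid s"
    unfolding ellipsoid_def by (intro image_eqI[of _ _ "B *v (x - x0)"]) (auto simp: param_inverse radius_def)
qed (auto simp: ellipsoid_def)

lemma continuous_param: "continuous_on S param"
  unfolding param_def by (intro continuous_intros linear_continuous_on matrix_vector_mul_bounded_linear)

lemma compact_ellipsoid: "compact (ellipsoid s)"
  unfolding ellipsoid_def by (intro compact_continuous_image continuous_param compact_cball)

lemma ellipsoid_interior: "s \<le> \<delta> \<Longrightarrow> ellipsoid s \<subseteq> interior (chart_img c0)"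
  using ball_int by (auto simp: ellipsoid_def param_def)

lemma ellipsoid_img: "s \<le> \<delta> \<Longrightarrow> ellipsoid s \<subseteq> chart_img c0"
  using ellipsoid_interior interior_subset by blast

lemma nn_integral_ellipsoid:
  assumes cont: "continuous_on (ellipsoid s) f" and nn: "\<And>x. x \<in> ellipsoid s \<Longrightarrow> 0 \<le> f x"
  shows "(\<integral>\<^sup>+x. ennreal (f x) * indicator (ellipsoid s) x \<partial>lborel) =
    (\<integral>\<^sup>+y. ennreal (\<bar>det P\<bar> * f (param y)) * indicator (cball 0 s) y \<partial>lborel)"
proof -
  have m: "matrix ((*v) P) = P" by (rule matrix_of_matrix_vector_mul)
  have "(\<integral>\<^sup>+x. ennreal (f x) * indicator (param ` cball 0 s) x \<partial>lborel) =
    (\<integral>\<^sup>+y. ennreal (\<bar>det (matrix ((*v) P))\<bar> * f (param y)) * indicator (cball 0 s) y \<partial>lborel)"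
  proof (rule nn_integral_change_of_variables)
    show "(param has_derivative (*v) P) (at x within cball 0 s)" for x
      unfolding param_def
      by (auto intro!: derivative_eq_intros bounded_linear_imp_has_derivative matrix_vector_mul_bounded_linear)
    show "inj_on param (cball 0 s)"
    proof (rule inj_on_inverseI)
      show "B *v (param y - x0) = y" for y by (simp add: param_def matrix_vector_mul_assoc BP)
    qed
    show "(\<lambda>y. indicator (param ` cball 0 s) y * f y) \<in> borel_measurable borel"
      using borel_measurable_continuous_on_indicator[OF _ cont] compact_ellipsoid[of s]
      by (simp add: ellipsoid_def borel_compact)
    have "continuous_on (cball 0 s) (\<lambda>y. \<bar>det P\<bar> * f (param y))"
      by (intro continuous_intros continuous_on_compose2[OF cont continuous_param]) (auto simp: ellipsoid_def)
    from borel_measurable_continuous_on_indicator[OF _ this]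
    show "(\<lambda>x. indicator (cball 0 s) x * (\<bar>det (matrix ((*v) P))\<bar> * f (param x))) \<in> borel_measurable borel"
      unfolding m by simp
  qed (use nn in \<open>auto simp: ellipsoid_def\<close>)
  then show ?thesis unfolding m ellipsoid_def .
qed

lemma nn_integral_chart_ellipsoid:
  assumes cont: "continuous_on (ellipsoid \<delta>) H" and nn: "\<And>x. 0 \<le> H x"
    and out: "\<And>x. x \<notin> ellipsoid \<delta> \<Longrightarrow> H x = 0"
  shows "(\<integral>\<^sup>+x. ennreal (H x * vol_density c0 x) * indicator (chart_img c0) x \<partial>lborel) =
    (\<integral>\<^sup>+y. ennreal (\<bar>det P\<bar> * (H (param y) * vol_density c0 (param y))) * indicator (cball 0 \<delta>) y \<partial>lborel)"
proof -
  have vd: "continuous_on (ellipsoid \<delta>) (vol_density c0)"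
    by (rule continuous_on_subset[OF continuous_on_vol_density[OF c0] ellipsoid_img]) simp
  have "(\<integral>\<^sup>+x. ennreal (H x * vol_density c0 x) * indicator (chart_img c0) x \<partial>lborel) =
      (\<integral>\<^sup>+x. ennreal (H x * vol_density c0 x) * indicator (ellipsoid \<delta>) x \<partial>lborel)"
    using out ellipsoid_img[of \<delta>] by (intro nn_integral_cong) (auto simp: indicator_def)
  also have "\<dots> = (\<integral>\<^sup>+y. ennreal (\<bar>det P\<bar> * (H (param y) * vol_density c0 (param y))) * indicator (cball 0 \<delta>) y \<partial>lborel)"
    by (rule nn_integral_ellipsoid)
      (use nn vol_density_pos[OF c0] ellipsoid_img[of \<delta>] in \<open>auto intro!: continuous_intros cont vd simp: less_imp_le subset_iff\<close>)
  finally show ?thesis .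
qed

lemma bump_has_derivative:
  "(bump L has_derivative (\<lambda>v. amplitude L * (profile' L ((radius x / \<delta>)\<^sup>2) *
      (2 * ((B *v (x - x0)) \<bullet> (B *v v)) / \<delta>\<^sup>2)))) (at x)"
proof -
  have sq: "(radius x / \<delta>)\<^sup>2 = ((B *v (x - x0)) \<bullet> (B *v (x - x0))) / \<delta>\<^sup>2" for x
    by (simp add: radius_def power_divide power2_norm_eq_inner)
  have l: "((\<lambda>x. B *v (x - x0)) has_derivative (\<lambda>v. B *v v)) (at x)"
    by (auto intro!: derivative_eq_intros
        bounded_linear.has_derivative[OF matrix_vector_mul_bounded_linear] )
  have "((\<lambda>x. ((B *v (x - x0)) \<bullet> (B *v (x - x0))) / \<delta>\<^sup>2) has_derivative
      (\<lambda>v. 2 * ((B *v (x - x0)) \<bullet> (B *v v)) / \<delta>\<^sup>2)) (at x)"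
    by (rule has_derivative_eq_rhs[OF has_derivative_divide[OF has_derivative_inner[OF l l] has_derivative_const]])
      (use \<delta> in \<open>auto simp: fun_eq_iff inner_commute field_simps power2_eq_square\<close>)
  then have q: "((\<lambda>x. (radius x / \<delta>)\<^sup>2) has_derivative (\<lambda>v. 2 * ((B *v (x - x0)) \<bullet> (B *v v)) / \<delta>\<^sup>2)) (at x)"
    by (simp add: sq)
  have "(profile L has_derivative (\<lambda>t. profile' L ((radius x / \<delta>)\<^sup>2) * t)) (at ((radius x / \<delta>)\<^sup>2))"
    using profile_has_derivative[of L "(radius x / \<delta>)\<^sup>2"] by (simp add: has_field_derivative_def)
  from has_derivative_compose[OF q this]
  show ?thesis unfolding bump_def by (rule has_derivative_mult_right)
qed

lemma Ck_on_bump: "Ck_on k (bump L) UNIV"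
proof -
  have "Ck_on k (\<lambda>x. (B *v (x - x0)) $ i) UNIV" for i
  proof -
    have bl: "bounded_linear (\<lambda>x. (B *v x) $ i)"
      by (rule bounded_linear_compose[OF bounded_linear_vec_nth matrix_vector_mul_bounded_linear])
    have "Ck_on k (\<lambda>x. (B *v x) $ i + - ((B *v x0) $ i)) UNIV"
      by (intro Ck_on_add Ck_on_const Ck_on_linear bl open_UNIV)
    then show ?thesis by (simp add: matrix_vector_mult_diff_distrib)
  qed
  then have "Ck_on k (\<lambda>x. (1 / \<delta>\<^sup>2) * (\<Sum>i\<in>UNIV. (B *v (x - x0)) $ i * (B *v (x - x0)) $ i)) UNIV"
    by (intro Ck_on_mult[OF open_UNIV Ck_on_const] Ck_on_sum Ck_on_mult open_UNIV)
  then have "Ck_on k (\<lambda>x. (radius x / \<delta>)\<^sup>2) UNIV"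
    by (simp add: radius_def power_divide power2_norm_eq_inner inner_vec_def)
  then have "Ck_on k (\<lambda>x. profile L ((radius x / \<delta>)\<^sup>2)) UNIV"
    by (intro Ck_on_compose[OF open_UNIV _ Ck_on_profile]) auto
  then show ?thesis
    unfolding bump_def[abs_def] by (intro Ck_on_mult[OF open_UNIV Ck_on_const])
qed

lemma bump_outside: "x \<notin> ellipsoid \<delta> \<Longrightarrow> bump L x = 0"
  using \<delta> by (auto simp: bump_def ellipsoid_eq intro!: profile_ge_1 one_le_power)

lemma chart_bump_bump: "chart_bump X A g c0 (bump L) (ellipsoid \<delta>)"
  by unfold_locales
    (use c0 compact_ellipsoid ellipsoid_interior Ck_on_bump bump_outside in auto)

lemma bump_derivative_bound:
  assumes L: "0 \<le> L"
  shows "\<bar>frechet_derivative (bump L) (at (param y)) v\<bar> \<le>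
    amplitude L * (if \<delta> * exp (- (L + 1)) < norm y \<and> norm y < \<delta> then 1 / norm y else 0) * norm (B *v v)"
proof -
  have By: "B *v (param y - x0) = y" by (simp add: param_def matrix_vector_mul_assoc BP)
  have "frechet_derivative (bump L) (at (param y)) v =
      amplitude L * (profile' L ((norm y / \<delta>)\<^sup>2) * (2 * (y \<bullet> (B *v v)) / \<delta>\<^sup>2))"
    using frechet_derivative_at[OF bump_has_derivative[of L "param y"], symmetric] by (simp add: By)
  also have "\<bar>\<dots>\<bar> = amplitude L * (\<bar>profile' L ((norm y / \<delta>)\<^sup>2)\<bar> * (2 / \<delta>\<^sup>2)) * \<bar>y \<bullet> (B *v v)\<bar>"
    using amplitude_pos[OF L] by (simp add: abs_mult)
  also have "\<dots> \<le> amplitude L * (\<bar>profile' L ((norm y / \<delta>)\<^sup>2)\<bar> * (2 / \<delta>\<^sup>2)) * (norm y * norm (B *v v))"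
    using amplitude_pos[OF L] by (intro mult_left_mono Cauchy_Schwarz_ineq2) auto
  also have "\<dots> = amplitude L * (\<bar>profile' L ((norm y / \<delta>)\<^sup>2)\<bar> * (2 * norm y / \<delta>\<^sup>2)) * norm (B *v v)"
    by (simp add: field_simps)
  also have "\<dots> \<le> amplitude L * (if \<delta> * exp (- (L + 1)) < norm y \<and> norm y < \<delta> then 1 / norm y else 0) * norm (B *v v)"
    using amplitude_pos[OF L] profile'_radius[OF \<delta>(1), of "norm y" L]
    by (intro mult_right_mono mult_left_mono) auto
  finally show ?thesis .
qed

text \<open>If \<open>N\<^sup>2\<close> is the square of the length of the gradient and also the differential applied to the gradient,
  a lower bound \<open>1 - s\<close> for the metric turns a bound \<open>m\<close> for the differential into one for \<open>N\<close>.\<close>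

lemma dual_norm_bound:
  fixes N b m s :: real
  assumes "0 \<le> N" "0 \<le> b" "0 \<le> m" "0 \<le> s" "s \<le> 1 / 2" "(1 - s) * b\<^sup>2 \<le> N\<^sup>2" "N\<^sup>2 \<le> m * b"
  shows "N \<le> m * (1 + 2 * s)"
proof (cases "b = 0")
  case True
  then show ?thesis using assms by simp
next
  case False
  then have b: "0 < b" using assms by simp
  have "(1 - s) * b * b \<le> m * b" using assms(6,7) by (simp add: power2_eq_square)
  then have hb: "(1 - s) * b \<le> m" using b by simp
  have "1 \<le> (1 + 2 * s) * (1 - s)"
  proof -
    have "0 \<le> s * (1 - 2 * s)" using assms by simp
    then show ?thesis by (simp add: algebra_simps)
  qed
  then have "1 * b \<le> ((1 + 2 * s) * (1 - s)) * b" using b by (intro mult_right_mono) auto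
  also have "\<dots> \<le> (1 + 2 * s) * m" using mult_left_mono[OF hb, of "1 + 2 * s"] assms(4) by (simp add: mult.assoc)
  finally have "b \<le> (1 + 2 * s) * m" by simp
  then have "m * b \<le> m * ((1 + 2 * s) * m)" using assms(3) by (rule mult_left_mono)
  also have "\<dots> \<le> (1 + 2 * s) * (m * ((1 + 2 * s) * m))"
    using mult_right_mono[of 1 "1 + 2 * s" "m * ((1 + 2 * s) * m)"] assms by simp
  finally have "N\<^sup>2 \<le> (m * (1 + 2 * s))\<^sup>2" using assms(7) by (simp add: power2_eq_square mult_ac)
  then show ?thesis by (rule power2_le_imp_le) (use assms in simp)
qed

text \<open>All the deviations from the Euclidean energy density, collected in one term that is linear in the radius.\<close>

lemma error_factor:
  assumes "0 \<le> r" "r \<le> 1"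
  shows "(1 + 2 * (C1 * r)) ^ CARD('n) * (1 + C2 * r) \<le> 1 + (slack - 1) * r"
proof -
  let ?s = "2 * CARD('n) * C1 + C2"
  have s: "0 \<le> ?s" using C1 C2 by simp
  have "(1 + 2 * (C1 * r)) ^ CARD('n) * (1 + C2 * r) \<le> exp (2 * (C1 * r)) ^ CARD('n) * exp (C2 * r)"
    using assms C1 C2 by (intro mult_mono power_mono exp_ge_add_one_self) auto
  also have "\<dots> = exp (?s * r)" by (simp add: exp_of_nat_mult[symmetric] exp_add[symmetric] algebra_simps)
  also have "\<dots> \<le> 1 + ?s * r * exp ?s"
  proof -
    have "1 + - (?s * r) \<le> exp (- (?s * r))" by (rule exp_ge_add_one_self)
    then have "(1 - ?s * r) * exp (?s * r) \<le> 1"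
      using mult_right_mono[of "1 - ?s * r" "exp (- (?s * r))" "exp (?s * r)"] by (simp add: exp_minus)
    then have "exp (?s * r) \<le> 1 + ?s * r * exp (?s * r)" by (simp add: algebra_simps)
    also have "\<dots> \<le> 1 + ?s * r * exp ?s"
      using assms s by (intro add_left_mono mult_left_mono) (auto intro: mult_left_le)
    finally show ?thesis .
  qed
  finally show ?thesis by (simp add: slack_def mult_ac)
qed

lemma density_nonneg: "norm y \<le> \<delta> \<Longrightarrow> 0 \<le> \<bar>det P\<bar> * vol_density c0 (param y)"
  using density_lower[of y] by (simp add: param_def)

text \<open>The hypotheses on \<open>N\<close> say that it is the length of the gradient of \<open>bump L\<close>. Duality bounds it by the Euclidean
  length \<open>amplitude L / norm y\<close> on the annulus, up to the error factor, and the annulus contributes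
  \<open>\<omega> * (L + slack)\<close>.\<close>

lemma gradient_integral_bound:
  assumes L: "0 \<le> L" and N0: "\<And>x. 0 \<le> N x"
    and cont: "continuous_on (ellipsoid \<delta>) N" and out: "\<And>x. x \<notin> ellipsoid \<delta> \<Longrightarrow> N x = 0"
    and N: "\<And>x. x \<in> ellipsoid \<delta> \<Longrightarrow> \<exists>w. (N x)\<^sup>2 = w \<bullet> (g c0 (coord_inv c0 x) *v w) \<and>
      (N x)\<^sup>2 = frechet_derivative (bump L) (at x) w"
  shows "(\<integral>\<^sup>+x. ennreal (N x ^ CARD('n) * vol_density c0 x) * indicator (chart_img c0) x \<partial>lborel) \<le> ennreal 1"
proof -
  let ?a = "\<delta> * exp (- (L + 1))"
  let ?m = "\<lambda>y :: real^'n. if ?a < norm y \<and> norm y < \<delta> then 1 / norm y else 0"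
  have a: "0 < ?a" "?a \<le> \<delta>" using \<delta> L by (auto simp: mult_left_le)
  have pt: "\<bar>det P\<bar> * (N (param y) ^ CARD('n) * vol_density c0 (param y)) \<le>
      amplitude L ^ CARD('n) * ((?m y) ^ CARD('n) * (1 + (slack - 1) * norm y))" if y: "norm y \<le> \<delta>" for y
  proof -
    have "param y \<in> ellipsoid \<delta>" using y by (simp add: ellipsoid_def)
    from N[OF this] obtain w where w: "(N (param y))\<^sup>2 = w \<bullet> (g c0 (coord_inv c0 (param y)) *v w)"
      "(N (param y))\<^sup>2 = frechet_derivative (bump L) (at (param y)) w" by blast
    have s: "C1 * norm y \<le> 1 / 2"
      using mult_left_mono[OF y C1(1)] C1(2) by linarith
    have m0: "0 \<le> amplitude L * ?m y" using amplitude_pos[OF L] by simp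
    have "N (param y) \<le> amplitude L * ?m y * (1 + 2 * (C1 * norm y))"
    proof (rule dual_norm_bound[OF N0 norm_ge_zero[of "B *v w"] m0 _ s])
      show "(1 - C1 * norm y) * (norm (B *v w))\<^sup>2 \<le> (N (param y))\<^sup>2"
        using metric_lower[OF y, of w] w(1) by (simp add: param_def)
      show "(N (param y))\<^sup>2 \<le> amplitude L * ?m y * norm (B *v w)"
        using bump_derivative_bound[OF L, of y w] unfolding w(2) by linarith
    qed (use C1 in simp)
    then have "N (param y) ^ CARD('n) \<le> (amplitude L * ?m y * (1 + 2 * (C1 * norm y))) ^ CARD('n)"
      by (intro power_mono N0)
    also have "\<dots> = amplitude L ^ CARD('n) * (?m y) ^ CARD('n) * (1 + 2 * (C1 * norm y)) ^ CARD('n)"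
      by (simp only: power_mult_distrib)
    finally have Nn: "N (param y) ^ CARD('n) \<le> amplitude L ^ CARD('n) * (?m y) ^ CARD('n) * (1 + 2 * (C1 * norm y)) ^ CARD('n)" .
    have m0': "0 \<le> amplitude L ^ CARD('n) * (?m y) ^ CARD('n)"
      using amplitude_pos[OF L] by (intro mult_nonneg_nonneg zero_le_power) auto
    have "\<bar>det P\<bar> * (N (param y) ^ CARD('n) * vol_density c0 (param y)) =
        N (param y) ^ CARD('n) * (\<bar>det P\<bar> * vol_density c0 (param y))" by simp
    also have "\<dots> \<le> (amplitude L ^ CARD('n) * (?m y) ^ CARD('n) * (1 + 2 * (C1 * norm y)) ^ CARD('n)) * (1 + C2 * norm y)"
      using density_upper[OF y] density_nonneg[OF y] Nn m0' C1 C2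
      by (intro mult_mono mult_nonneg_nonneg[OF m0'] zero_le_power) (auto simp: param_def)
    also have "\<dots> = (amplitude L ^ CARD('n) * (?m y) ^ CARD('n)) * ((1 + 2 * (C1 * norm y)) ^ CARD('n) * (1 + C2 * norm y))"
      by (simp only: mult.assoc)
    also have "\<dots> \<le> (amplitude L ^ CARD('n) * (?m y) ^ CARD('n)) * (1 + (slack - 1) * norm y)"
      using y \<delta> by (intro mult_left_mono error_factor m0') auto
    finally show ?thesis by (simp only: mult.assoc)
  qed
  have "(\<integral>\<^sup>+x. ennreal (N x ^ CARD('n) * vol_density c0 x) * indicator (chart_img c0) x \<partial>lborel) =
      (\<integral>\<^sup>+y. ennreal (\<bar>det P\<bar> * (N (param y) ^ CARD('n) * vol_density c0 (param y))) * indicator (cball 0 \<delta>) y \<partial>lborel)"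
    by (rule nn_integral_chart_ellipsoid) (use N0 out in \<open>auto intro!: continuous_intros cont simp: zero_power\<close>)
  also have "\<dots> \<le> (\<integral>\<^sup>+y. ennreal (amplitude L ^ CARD('n)) * ennreal ((if ?a < norm y \<and> norm y < \<delta> then (1 / norm y) ^ CARD('n) else 0) * (1 + (slack - 1) * norm y)) \<partial>(lborel :: (real^'n) measure))"
  proof (rule nn_integral_mono)
    fix y :: "real^'n"
    have e: "(if ?a < norm y \<and> norm y < \<delta> then (1 / norm y) ^ CARD('n) else 0) = (?m y) ^ CARD('n)"
      by (simp add: zero_power)
    have "0 \<le> amplitude L ^ CARD('n)" using amplitude_pos[OF L] by simp
    then show "ennreal (\<bar>det P\<bar> * (N (param y) ^ CARD('n) * vol_density c0 (param y))) * indicator (cball 0 \<delta>) y \<le>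
        ennreal (amplitude L ^ CARD('n)) * ennreal ((if ?a < norm y \<and> norm y < \<delta> then (1 / norm y) ^ CARD('n) else 0) * (1 + (slack - 1) * norm y))"
      unfolding e using ennreal_leI[OF pt[of y]]
      by (cases "norm y \<le> \<delta>") (simp_all add: ennreal_mult'[symmetric] del: ennreal_plus)
  qed
  also have "\<dots> = ennreal (amplitude L ^ CARD('n)) * (\<integral>\<^sup>+y. ennreal ((if ?a < norm y \<and> norm y < \<delta> then (1 / norm y) ^ CARD('n) else 0) * (1 + (slack - 1) * norm y)) \<partial>(lborel :: (real^'n) measure))"
    by (rule nn_integral_cmult) measurable
  also have "\<dots> \<le> ennreal (amplitude L ^ CARD('n)) * ennreal (CARD('n) * unit_ball_vol CARD('n) * (ln (\<delta> / ?a) + (slack - 1)))"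
    using nn_integral_annulus[where 'e = "real^'n", OF a \<delta>(2), of "slack - 1", unfolded dim] slack_ge_1
    by (intro mult_left_mono) auto
  also have "\<dots> = ennreal (amplitude L ^ CARD('n) * (\<omega> * (L + slack)))"
  proof -
    have "\<delta> / ?a = exp (L + 1)" using \<delta>(1) by (simp only: exp_minus) (simp add: field_simps)
    then have "ln (\<delta> / ?a) = L + 1" by (simp only: ln_exp)
    then show ?thesis using amplitude_pos[OF L] by (simp add: ennreal_mult'[symmetric] \<omega>_def)
  qed
  also have "\<dots> = ennreal 1"
    using amplitude_power[OF L] \<omega>_pos slack_ge_1 L by simp
  finally show ?thesis .
qed

text \<open>The function is at most \<open>amplitude L * ln (\<delta> / norm y)\<close>, and the power of the logarithm is integrable. All the
  dependence on \<open>L\<close> is in the amplitude.\<close>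

lemma bump_integral_bound:
  assumes n2: "2 \<le> CARD('n)" and L: "0 \<le> L"
  shows "(\<integral>\<^sup>+x. ennreal (\<bar>bump L x\<bar> ^ CARD('n) * vol_density c0 x) * indicator (chart_img c0) x \<partial>lborel) \<le>
    ennreal ((1 + C2) * fact CARD('n) / (L + slack))"
proof -
  let ?l = "\<lambda>y :: real^'n. if norm y < \<delta> \<and> y \<noteq> 0 then ln (\<delta> / norm y) ^ CARD('n) else 0"
  have pt: "\<bar>det P\<bar> * (\<bar>bump L (param y)\<bar> ^ CARD('n) * vol_density c0 (param y)) \<le> (1 + C2) * amplitude L ^ CARD('n) * ?l y"
    if y: "norm y \<le> \<delta>" "y \<noteq> 0" for y
  proof -
    have "\<bar>bump L (param y)\<bar> ^ CARD('n) \<le> amplitude L ^ CARD('n) * ?l y"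
    proof (cases "norm y < \<delta>")
      case True
      have "0 < norm y" using y by simp
      from profile_radius_le[OF this True, of L] amplitude_pos[OF L]
      have "\<bar>bump L (param y)\<bar> \<le> amplitude L * ln (\<delta> / norm y)" by (simp add: bump_def abs_mult)
      then have "\<bar>bump L (param y)\<bar> ^ CARD('n) \<le> (amplitude L * ln (\<delta> / norm y)) ^ CARD('n)" by (intro power_mono) auto
      then show ?thesis using True y by (simp add: power_mult_distrib)
    next
      case False
      then have "1 \<le> (norm y / \<delta>)\<^sup>2" using \<delta> by (auto intro!: one_le_power)
      then have "bump L (param y) = 0" by (simp add: bump_def profile_ge_1)
      then show ?thesis using False by (simp add: zero_power)
    qed
    moreover have "\<bar>det P\<bar> * vol_density c0 (param y) \<le> 1 + C2"
      using density_upper[OF y(1)] mult_left_le[of "norm y" C2] C2 y \<delta> by (simp add: param_def)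
    moreover have "0 \<le> amplitude L ^ CARD('n) * ?l y"
      using amplitude_pos[OF L] y by (intro mult_nonneg_nonneg) (auto intro!: zero_le_power ln_ge_zero)
    ultimately have "\<bar>bump L (param y)\<bar> ^ CARD('n) * (\<bar>det P\<bar> * vol_density c0 (param y)) \<le> (amplitude L ^ CARD('n) * ?l y) * (1 + C2)"
      using density_nonneg[OF y(1)] by (intro mult_mono) auto
    then show ?thesis by (simp only: mult_ac)
  qed
  have cb: "continuous_on (ellipsoid \<delta>) (bump L)"
    using Ck_on_bump[of 0 L] continuous_on_subset[of UNIV "bump L" "ellipsoid \<delta>"] by simp
  have c0': "0 \<le> (1 + C2) * amplitude L ^ CARD('n)" using amplitude_pos[OF L] C2 by simp
  have "(\<integral>\<^sup>+x. ennreal (\<bar>bump L x\<bar> ^ CARD('n) * vol_density c0 x) * indicator (chart_img c0) x \<partial>lborel) =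
      (\<integral>\<^sup>+y. ennreal (\<bar>det P\<bar> * (\<bar>bump L (param y)\<bar> ^ CARD('n) * vol_density c0 (param y))) * indicator (cball 0 \<delta>) y \<partial>lborel)"
    by (rule nn_integral_chart_ellipsoid)
      (use bump_outside[of _ L] in \<open>auto intro!: continuous_intros cb simp: zero_power\<close>)
  also have "\<dots> \<le> (\<integral>\<^sup>+y. ennreal ((1 + C2) * amplitude L ^ CARD('n)) * ennreal (?l y) \<partial>lborel)"
  proof (rule nn_integral_mono_AE)
    have "AE y in lborel. y \<noteq> (0 :: real^'n)" by (rule AE_lborel_singleton)
    then show "AE y in lborel. ennreal (\<bar>det P\<bar> * (\<bar>bump L (param y)\<bar> ^ CARD('n) * vol_density c0 (param y))) * indicator (cball 0 \<delta>) y \<le>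
        ennreal ((1 + C2) * amplitude L ^ CARD('n)) * ennreal (?l y)"
    proof eventually_elim
      case (elim y)
      show ?case
        using ennreal_leI[OF pt[of y]] elim c0'
        by (cases "norm y \<le> \<delta>") (simp_all add: ennreal_mult'[symmetric] del: ennreal_plus)
    qed
  qed
  also have "\<dots> = ennreal ((1 + C2) * amplitude L ^ CARD('n)) * (\<integral>\<^sup>+y. ennreal (?l y) \<partial>lborel)"
    by (rule nn_integral_cmult) measurable
  also have "\<dots> \<le> ennreal ((1 + C2) * amplitude L ^ CARD('n)) * ennreal (CARD('n) * unit_ball_vol CARD('n) * fact CARD('n))"
    using nn_integral_log_power[where 'e = "real^'n", of \<delta>, unfolded dim] n2 \<delta> by (intro mult_left_mono) auto
  also have "\<dots> = ennreal ((1 + C2) * amplitude L ^ CARD('n) * (\<omega> * fact CARD('n)))"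
    using c0' by (simp add: ennreal_mult'[symmetric] \<omega>_def)
  also have "(1 + C2) * amplitude L ^ CARD('n) * (\<omega> * fact CARD('n)) = (1 + C2) * fact CARD('n) / (L + slack)"
    using \<omega>_pos slack_ge_1 by (simp add: amplitude_power[OF L])
  finally show ?thesis .
qed

text \<open>The set where the truncation is reached and the function has its largest value.\<close>

definition core :: "real \<Rightarrow> 'a set" where
  "core L = {p \<in> chart_dom c0. coord c0 p \<in> ellipsoid (\<delta> * exp (- (L + 1)))}"

lemma core_sets: "core L \<in> sets (borel_on X)"
proof -
  have "core L = chart_dom c0 - {p \<in> chart_dom c0. coord c0 p \<in> - ellipsoid (\<delta> * exp (- (L + 1)))}"
    by (auto simp: core_def)
  moreover have "openin X {p \<in> chart_dom c0. coord c0 p \<in> - ellipsoid (\<delta> * exp (- (L + 1)))}"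
    by (intro openin_coord_vimage c0 open_Compl compact_imp_closed compact_ellipsoid)
  ultimately show ?thesis using chart_dom_borel[OF c0] by (simp add: sets.Diff sets_borel_on_open)
qed

lemma bump_core: "p \<in> core L \<Longrightarrow> chart_push c0 (bump L) p = amplitude L * soft_pos L"
  using profile_radius_small[OF \<delta>(1), of "radius (coord c0 p)" L]
  by (simp add: core_def chart_push_def bump_def ellipsoid_eq radius_def)

text \<open>The core is the image of a ball of radius \<open>\<delta> * exp (- (L + 1))\<close>, on which the density is at least one half.\<close>

lemma emeasure_core:
  fixes L :: real
  assumes L: "0 \<le> L"
  shows "ennreal (unit_ball_vol CARD('n) * (\<delta> * exp (- 1)) ^ CARD('n) / 2 * exp (- (CARD('n) * L))) \<le> emeasure vol (core L)"
proof -
  let ?a = "\<delta> * exp (- (L + 1))"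
  have a: "0 < ?a" "?a \<le> \<delta>" using \<delta> L by (auto simp: mult_left_le)
  have img: "coord c0 ` core L = ellipsoid ?a"
  proof (intro set_eqI iffI)
    fix x assume x: "x \<in> ellipsoid ?a"
    then have "x \<in> chart_img c0" using ellipsoid_img[OF a(2)] by blast
    then show "x \<in> coord c0 ` core L"
      using x coord_inv_in[of x c0] coord_coord_inv[of x c0]
      unfolding core_def by (intro image_eqI[of _ _ "coord_inv c0 x"] CollectI conjI) simp_all
  qed (auto simp: core_def)
  have sub: "core L \<subseteq> chart_dom c0" by (auto simp: core_def)
  have vd: "continuous_on (ellipsoid ?a) (vol_density c0)"
    by (rule continuous_on_subset[OF continuous_on_vol_density[OF c0] ellipsoid_img[OF a(2)]])
  have "emeasure vol (core L) = emeasure (chart_measure c0) (ellipsoid ?a)"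
    using is_volume_riemannian_volume c0 core_sets sub unfolding is_volume_def img[symmetric] by blast
  also have "\<dots> = (\<integral>\<^sup>+x. ennreal (vol_density c0 x) * indicator (ellipsoid ?a) x \<partial>lborel)"
    by (rule emeasure_chart_measure[OF c0 _ ellipsoid_img[OF a(2)]]) (simp add: borel_compact compact_ellipsoid)
  also have "\<dots> = (\<integral>\<^sup>+y. ennreal (\<bar>det P\<bar> * vol_density c0 (param y)) * indicator (cball 0 ?a) y \<partial>lborel)"
    by (rule nn_integral_ellipsoid[OF vd])
      (use vol_density_pos[OF c0] ellipsoid_img[OF a(2)] in \<open>auto simp: less_imp_le subset_iff\<close>)
  finally have eq: "emeasure vol (core L) =
      (\<integral>\<^sup>+y. ennreal (\<bar>det P\<bar> * vol_density c0 (param y)) * indicator (cball 0 ?a) y \<partial>lborel)" .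
  have "ennreal (1 / 2 * (unit_ball_vol CARD('n) * ?a ^ CARD('n))) = ennreal (1 / 2) * emeasure lborel (cball (0 :: real^'n) ?a)"
  proof -
    have e: "emeasure lborel (cball (0 :: real^'n) ?a) = ennreal (unit_ball_vol CARD('n) * ?a ^ CARD('n))"
      using emeasure_cball[of ?a "0 :: real^'n"] a(1) by (simp only: dim less_imp_le)
    show ?thesis unfolding e using a(1) by (intro ennreal_mult) auto
  qed
  also have "\<dots> = (\<integral>\<^sup>+y. ennreal (1 / 2) * indicator (cball (0 :: real^'n) ?a) y \<partial>lborel)"
    by (subst nn_integral_cmult_indicator) auto
  also have "\<dots> \<le> (\<integral>\<^sup>+y. ennreal (\<bar>det P\<bar> * vol_density c0 (param y)) * indicator (cball 0 ?a) y \<partial>lborel)"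
  proof (rule nn_integral_mono)
    fix y :: "real^'n"
    show "ennreal (1 / 2) * indicator (cball 0 ?a) y \<le> ennreal (\<bar>det P\<bar> * vol_density c0 (param y)) * indicator (cball 0 ?a) y"
    proof (cases "norm y \<le> ?a")
      case True
      then have "norm y \<le> \<delta>" using a(2) by linarith
      from ennreal_leI[OF density_lower[OF this]] True show ?thesis by (simp add: param_def)
    qed simp
  qed
  also have "1 / 2 * (unit_ball_vol CARD('n) * ?a ^ CARD('n)) = unit_ball_vol CARD('n) * (\<delta> * exp (- 1)) ^ CARD('n) / 2 * exp (- (CARD('n) * L))"
    by (simp add: power_mult_distrib exp_of_nat_mult[symmetric] exp_add[symmetric] algebra_simps)
  finally show ?thesis unfolding eq .
qed

end

section \<open>Asymptotics\<close>

text \<open>The polynomial that is subtracted is negligible compared with the exponential function.\<close>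

lemma exp_n_ge_half_exp: "\<exists>T. \<forall>t\<ge>T. exp t / 2 \<le> exp_n n t"
proof -
  have "((\<lambda>t::real. \<Sum>i\<le>n - 2. (t ^ i / exp t) / fact i) \<longlongrightarrow> (\<Sum>i\<le>n - 2. 0 / fact i)) at_top"
    by (intro tendsto_sum tendsto_divide tendsto_power_div_exp_0 tendsto_const) simp
  then have "((\<lambda>t::real. \<Sum>i\<le>n - 2. (t ^ i / exp t) / fact i) \<longlongrightarrow> 0) at_top" by simp
  then have "\<forall>\<^sub>F t in at_top. (\<Sum>i\<le>n - 2. (t ^ i / exp t) / fact i) < (1 / 2 :: real)"
    by (rule order_tendstoD) simp
  then obtain T where T: "\<And>t. T \<le> t \<Longrightarrow> (\<Sum>i\<le>n - 2. (t ^ i / exp t) / fact i) < (1 / 2 :: real)"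
    by (auto simp: eventually_at_top_linorder)
  have "exp t / 2 \<le> exp_n n t" if "T \<le> t" for t
  proof -
    have "(\<Sum>i\<le>n - 2. t ^ i / fact i) = exp t * (\<Sum>i\<le>n - 2. (t ^ i / exp t) / fact i)"
      by (simp add: sum_distrib_left)
    also have "\<dots> \<le> exp t * (1 / 2)" using T[OF that] by (intro mult_left_mono) auto
    finally show ?thesis by (simp add: exp_n_def)
  qed
  then show ?thesis by blast
qed

text \<open>With \<open>x = s / (L + S)\<close> the right-hand side is \<open>n * (L + S) * x powr (n / (n - 1))\<close>. The normalization by
  \<open>L + S\<close> instead of \<open>L\<close> and the defect of \<open>s\<close> cost only a constant, as
  \<open>x powr (n / (n - 1)) \<ge> x\<^sup>2 \<ge> 2 * x - 1\<close>.\<close>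

lemma critical_exponent_lower:
  fixes \<omega> L S s :: real
  assumes n: "2 \<le> n" and pos: "0 < \<omega>" "1 \<le> S" "1 \<le> L" and s: "0 < s" "L - 1 \<le> s" "s \<le> L"
  shows "n * L - n * (2 + S) \<le>
    n * \<omega> powr (1 / (real n - 1)) * ((\<omega> * (L + S)) powr (- (1 / n)) * s) powr (n / (real n - 1))"
proof -
  let ?b = "n / (real n - 1)" and ?m = "1 / (real n - 1)"
  define Z where "Z = L + S"
  have Z: "0 < Z" "s \<le> Z" using pos s by (auto simp: Z_def)
  have n1: "0 < real n - 1" using n by simp
  have b: "?b = 1 + ?m" using n1 by (simp add: field_simps)
  have b2: "1 \<le> ?b" "?b \<le> 2" using n n1 by (auto simp: field_simps)
  have nb: "- (1 / n) * ?b = - ?m" using n n1 by (simp add: field_simps)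
  have "((\<omega> * Z) powr (- (1 / n)) * s) powr ?b = (\<omega> * Z) powr (- ?m) * s powr ?b"
    using pos Z s n by (subst powr_mult) (auto simp only: powr_powr nb zero_le_mult_iff powr_ge_zero)
  also have "(\<omega> * Z) powr (- ?m) = \<omega> powr (- ?m) * Z powr (- ?m)"
    using pos Z by (simp add: powr_mult)
  finally have "n * \<omega> powr ?m * ((\<omega> * Z) powr (- (1 / n)) * s) powr ?b =
      n * (\<omega> powr ?m * \<omega> powr (- ?m)) * (Z powr (- ?m) * s powr ?b)" by (simp add: mult_ac)
  also have "\<omega> powr ?m * \<omega> powr (- ?m) = 1" using pos by (simp add: powr_add[symmetric])
  also have "Z powr (- ?m) * s powr ?b = Z * (s / Z) powr ?b"
  proof -
    have "Z powr (- ?m) = Z powr (1 - ?b)" by (simp add: b)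
    also have "\<dots> = Z / Z powr ?b" using Z by (simp add: powr_diff)
    finally show ?thesis using Z s by (simp add: powr_divide)
  qed
  finally have eq: "n * \<omega> powr ?m * ((\<omega> * Z) powr (- (1 / n)) * s) powr ?b = n * (Z * (s / Z) powr ?b)" by simp
  have x: "0 < s / Z" "s / Z \<le> 1" using Z s by auto
  \<comment> \<open>the base is at most 1 and the exponent at most 2\<close>
  have "(s / Z)\<^sup>2 = (s / Z) powr 2" using x by simp
  also have "\<dots> \<le> (s / Z) powr ?b" using x b2 by (intro powr_mono') auto
  finally have "2 * (s / Z) - 1 \<le> (s / Z) powr ?b"
    using zero_le_power2[of "s / Z - 1"] by (simp add: power2_eq_square algebra_simps)
  then have "Z * (2 * (s / Z) - 1) \<le> Z * (s / Z) powr ?b" using Z by (intro mult_left_mono) auto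
  moreover have "Z * (2 * (s / Z) - 1) = 2 * s - Z" using Z by (simp add: algebra_simps)
  moreover have "L - (2 + S) \<le> 2 * s - Z" using s by (simp add: Z_def)
  ultimately have "n * (L - (2 + S)) \<le> n * (Z * (s / Z) powr ?b)" by (intro mult_left_mono) auto
  then show ?thesis unfolding eq[unfolded Z_def] Z_def by (simp add: algebra_simps)
qed

text \<open>Near a boundary point of a half-space there are points of its interior.\<close>

lemma chart_interior_nonempty:
  assumes "model_space (H :: (real^'n::finite) set)" "openin (top_of_set H) S" "S \<noteq> {}"
  shows "interior S \<noteq> {}"
proof -
  obtain T where T: "open T" "S = H \<inter> T" using assms(2) by (auto simp: openin_open)
  from assms(1) consider "H = UNIV" | k where "H = {x. 0 \<le> x $ k}" by (auto simp: model_space_def)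
  then show ?thesis
  proof cases
    case 1
    then show ?thesis using T assms(3) by (simp add: interior_open)
  next
    case 2
    obtain z where z: "z \<in> H" "z \<in> T" using assms(3) T by blast
    obtain e where e: "0 < e" "ball z e \<subseteq> T" using T(1) z(2) by (rule openE)
    let ?z = "z + (e / 2) *\<^sub>R axis k 1"
    have "dist z ?z < e" using e(1) by (simp add: dist_norm norm_axis_1)
    then have "?z \<in> T" using e(2) by auto
    moreover have "0 < ?z $ k" using z(1) 2 e(1) by simp
    moreover have "open ({x. 0 < x $ k} \<inter> T)"
      using T(1) open_halfspace_component_gt_cart[of 0 k] by (auto simp: open_Int)
    moreover have "{x. 0 < x $ k} \<inter> T \<subseteq> S" using T(2) 2 by auto
    ultimately have "?z \<in> interior S" by (intro interiorI[of "{x. 0 < x $ k} \<inter> T"]) auto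
    then show ?thesis by blast
  qed
qed

lemma filterlim_imp_tendsto_top:
  fixes F :: "nat \<Rightarrow> ennreal"
  assumes "filterlim f at_top sequentially" "\<forall>\<^sub>F l in sequentially. ennreal (f l) \<le> F l"
  shows "F \<longlonglongrightarrow> \<infinity>"
  unfolding infinity_ennreal_def tendsto_top_iff_ennreal
proof (intro allI impI)
  fix b :: real assume "0 \<le> b"
  have "\<forall>\<^sub>F l in sequentially. b < f l"
    using assms(1) by (simp add: filterlim_at_top_dense)
  with assms(2) show "\<forall>\<^sub>F l in sequentially. ennreal b < F l"
  proof eventually_elim
    case (elim l)
    then have "ennreal b < ennreal (f l)" using \<open>0 \<le> b\<close> by (simp add: ennreal_lessI)
    with elim(1) show ?case by (rule less_le_trans[rotated])
  qed
qed

lemma ennreal_inverse_antimono: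
  assumes "ennreal a \<le> ennreal b" "0 < b"
  shows "inverse (ennreal b) \<le> inverse (ennreal a)"
proof (cases "0 < a")
  case True
  then show ?thesis using assms by (simp add: inverse_ennreal ennreal_leI)
next
  case False
  then have "ennreal a = 0" by (simp add: ennreal_neg)
  then show ?thesis by simp
qed

context adapted_chart
begin

lemma bump_sobolev:
  fixes L :: real
  assumes n2: "2 \<le> CARD('n)" and L: "0 \<le> L"
  shows "chart_push c0 (bump L) \<in> W1n_0 X A g"
    and "\<exists>D. has_W1n_gradient X A g (chart_push c0 (bump L)) D \<and>
      Lp_norm CARD('n) vol (vf_norm A g D) \<le> 1"
    and "Lp_norm CARD('n) vol (chart_push c0 (bump L)) ^ CARD('n) \<le>
      (1 + C2) * fact CARD('n) / (L + slack)"
proof -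
  interpret b: chart_bump X A g c0 "bump L" "ellipsoid \<delta>" by (rule chart_bump_bump)
  show "chart_push c0 (bump L) \<in> W1n_0 X A g" by (rule b.push_W1n_0)
  show "Lp_norm CARD('n) vol (chart_push c0 (bump L)) ^ CARD('n) \<le>
      (1 + C2) * fact CARD('n) / (L + slack)"
    by (rule b.Lp_norm_push_le[OF _ bump_integral_bound[OF n2 L]]) (use C2 L slack_ge_1 in simp)
  have "(\<integral>\<^sup>+x. ennreal (b.grad_norm x ^ CARD('n) * vol_density c0 x) * indicator (chart_img c0) x \<partial>lborel) \<le> ennreal 1"
  proof (rule gradient_integral_bound[OF L b.grad_norm_nonneg b.continuous_grad_norm b.grad_norm_outside])
    fix x assume x: "x \<in> ellipsoid \<delta>"
    show "\<exists>w. (b.grad_norm x)\<^sup>2 = w \<bullet> (g c0 (coord_inv c0 x) *v w) \<and>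
        (b.grad_norm x)\<^sup>2 = frechet_derivative (bump L) (at x) w"
      using b.grad_norm_sq[OF x] unfolding b.metric_at_def by blast
  qed
  from b.Lp_norm_grad_le[OF _ this b.grad_norm_nonneg]
  have "Lp_norm CARD('n) vol (vf_norm A g b.grad_field) ^ CARD('n) \<le> 1 ^ CARD('n)" by simp
  then have "Lp_norm CARD('n) vol (vf_norm A g b.grad_field) \<le> 1"
    by (rule power_le_imp_le_base[where n = "CARD('n) - 1"] | simp add: power_mono_iff Lp_norm_def)
  with b.push_has_W1n_gradient
  show "\<exists>D. has_W1n_gradient X A g (chart_push c0 (bump L)) D \<and>
      Lp_norm CARD('n) vol (vf_norm A g D) \<le> 1" by blast
qed

definition core_const :: real where
  "core_const = unit_ball_vol CARD('n) * (\<delta> * exp (- 1)) ^ CARD('n) / 2"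

lemma core_const_pos: "0 < core_const"
  using \<delta> by (simp add: core_const_def)

definition height :: "real \<Rightarrow> real" where
  "height L = amplitude L * soft_pos L"

lemma height_pos: "1 \<le> L \<Longrightarrow> 0 < height L"
  using amplitude_pos[of L] soft_pos_pos[of L] by (simp add: height_def)

lemma height_le:
  fixes L :: real
  assumes "1 \<le> L"
  shows "1 + height L \<le> (1 + \<omega> powr (- (1 / CARD('n)))) * L powr (1 - 1 / CARD('n))"
proof -
  have N: "1 / real CARD('n) \<le> 1" by simp
  have "amplitude L \<le> (\<omega> * L) powr (- (1 / CARD('n)))"
    unfolding amplitude_def using assms \<omega>_pos slack_ge_1 by (intro powr_mono2') auto
  then have "height L \<le> (\<omega> * L) powr (- (1 / CARD('n))) * L"
    unfolding height_def using assms soft_pos_le[of L] soft_pos_nonneg[of L] by (intro mult_mono) auto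
  also have "\<dots> = \<omega> powr (- (1 / CARD('n))) * L powr (1 - 1 / CARD('n))"
    using assms \<omega>_pos by (simp add: powr_mult powr_diff powr_minus_divide)
  finally have "height L \<le> \<omega> powr (- (1 / CARD('n))) * L powr (1 - 1 / CARD('n))" .
  moreover have "1 \<le> L powr (1 - 1 / CARD('n))"
    using assms N by (intro ge_one_powr_ge_zero) auto
  ultimately show ?thesis by (simp add: algebra_simps)
qed

lemma height_power_le:
  fixes L :: real
  assumes L: "1 \<le> L" and q: "q \<le> q'" "0 \<le> q'"
  shows "(1 + height L) powr q \<le> (1 + \<omega> powr (- (1 / CARD('n)))) powr q' * L powr ((1 - 1 / CARD('n)) * q')"
proof -
  have h: "1 \<le> 1 + height L" using height_pos[OF L] by simp
  have "(1 + height L) powr q \<le> (1 + height L) powr q'" using h q by (intro powr_mono) auto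
  also have "\<dots> \<le> ((1 + \<omega> powr (- (1 / CARD('n)))) * L powr (1 - 1 / CARD('n))) powr q'"
    using h q height_le[OF L] by (intro powr_mono2) auto
  also have "\<dots> = (1 + \<omega> powr (- (1 / CARD('n)))) powr q' * L powr ((1 - 1 / CARD('n)) * q')"
    using L by (simp add: powr_mult powr_powr add_nonneg_nonneg)
  finally show ?thesis .
qed

text \<open>Only the core counts. There the function is constant, the exponent is bounded from below by
  \<open>critical_exponent_lower\<close>, and \<open>big\<close> puts it into the range where \<open>exp_n\<close> is comparable with \<open>exp\<close>.\<close>

lemma integral_lower:
  fixes L :: real
  assumes n2: "2 \<le> CARD('n)" and L: "1 \<le> L" and \<theta>: "1 \<le> \<theta>"
    and \<alpha>: "\<alpha> = \<theta> * (CARD('n) * \<omega> powr (1 / (real CARD('n) - 1)))"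
    and T: "\<And>t. T \<le> t \<Longrightarrow> exp t / 2 \<le> exp_n CARD('n) t"
    and big: "T \<le> \<theta> * (CARD('n) * L - CARD('n) * (2 + slack))"
  shows "ennreal (exp (\<theta> * (CARD('n) * L - CARD('n) * (2 + slack))) / 2 / (1 + height L) powr q *
      (core_const * exp (- (CARD('n) * L)))) \<le>
    (\<integral>\<^sup>+p. ennreal (exp_n CARD('n) (\<alpha> * \<bar>chart_push c0 (bump L) p\<bar> powr (CARD('n) / (real CARD('n) - 1)))
      / (1 + \<bar>chart_push c0 (bump L) p\<bar>) powr q) \<partial>vol)"
proof -
  let ?N = "real CARD('n)" and ?\<mu> = "vol"
  let ?t = "\<alpha> * height L powr (?N / (?N - 1))"
  let ?\<tau> = "\<theta> * (?N * L - ?N * (2 + slack))"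
  have L0: "0 < L" "0 \<le> L" using L by auto
  have h: "0 < height L" by (rule height_pos[OF L])
  have "?N * L - ?N * (2 + slack) \<le> ?N * \<omega> powr (1 / (?N - 1)) * height L powr (?N / (?N - 1))"
    unfolding height_def amplitude_def
    by (rule critical_exponent_lower[OF n2 \<omega>_pos slack_ge_1 L soft_pos_pos[OF L0(1)] soft_pos_ge soft_pos_le[OF L0(2)]])
  then have t: "?\<tau> \<le> ?t"
    using mult_left_mono[of "?N * L - ?N * (2 + slack)" "?N * \<omega> powr (1 / (?N - 1)) * height L powr (?N / (?N - 1))" \<theta>] \<theta>
    by (simp add: \<alpha> mult_ac)
  have "exp ?\<tau> / 2 \<le> exp ?t / 2" using t by simp
  also have "\<dots> \<le> exp_n CARD('n) ?t" using T[of ?t] t big by linarith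
  finally have e: "exp ?\<tau> / 2 / (1 + height L) powr q \<le> exp_n CARD('n) ?t / (1 + height L) powr q"
    by (intro divide_right_mono) auto
  have "ennreal (exp ?\<tau> / 2 / (1 + height L) powr q * (core_const * exp (- (?N * L)))) =
      ennreal (exp ?\<tau> / 2 / (1 + height L) powr q) * ennreal (core_const * exp (- (?N * L)))"
    using core_const_pos by (intro ennreal_mult) auto
  also have "\<dots> \<le> ennreal (exp ?\<tau> / 2 / (1 + height L) powr q) * emeasure ?\<mu> (core L)"
    using emeasure_core[OF L0(2)] unfolding core_const_def by (rule mult_left_mono) simp
  also have "\<dots> = (\<integral>\<^sup>+p. ennreal (exp ?\<tau> / 2 / (1 + height L) powr q) * indicator (core L) p \<partial>?\<mu>)"
    using core_sets by (intro nn_integral_cmult_indicator[symmetric]) simp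
  also have "\<dots> \<le> (\<integral>\<^sup>+p. ennreal (exp_n CARD('n) (\<alpha> * \<bar>chart_push c0 (bump L) p\<bar> powr (?N / (?N - 1)))
      / (1 + \<bar>chart_push c0 (bump L) p\<bar>) powr q) \<partial>?\<mu>)"
  proof (rule nn_integral_mono)
    fix p
    show "ennreal (exp ?\<tau> / 2 / (1 + height L) powr q) * indicator (core L) p \<le>
        ennreal (exp_n CARD('n) (\<alpha> * \<bar>chart_push c0 (bump L) p\<bar> powr (?N / (?N - 1)))
          / (1 + \<bar>chart_push c0 (bump L) p\<bar>) powr q)"
    proof (cases "p \<in> core L")
      case True
      have "\<bar>chart_push c0 (bump L) p\<bar> = height L" using bump_core[OF True] h by (simp add: height_def)
      then show ?thesis using True ennreal_leI[OF e] by simp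
    qed simp
  qed
  finally show ?thesis .
qed

lemma bump_nonzero:
  fixes L :: real
  assumes L: "1 \<le> L"
  shows "\<not> (AE p in vol. chart_push c0 (bump L) p = 0)"
proof
  assume "AE p in vol. chart_push c0 (bump L) p = 0"
  then have "AE p in vol. p \<notin> core L"
    by eventually_elim (use bump_core[of _ L] height_pos[OF L] in \<open>auto simp: height_def\<close>)
  then have "emeasure vol (core L) = 0"
    using core_sets[of L] sets.sets_into_space[OF core_sets[of L]]
    by (subst (asm) AE_iff_measurable[of "core L"]) auto
  moreover have "0 < ennreal (core_const * exp (- (CARD('n) * L)))" using core_const_pos by simp
  moreover have "ennreal (core_const * exp (- (CARD('n) * L))) \<le> emeasure vol (core L)"
    unfolding core_const_def by (rule emeasure_core) (use L in simp)
  ultimately show False by (metis leD)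
qed

text \<open>The integral is bounded from below by a constant over \<open>(1 + height L) powr q\<close>, and dividing by the norm multiplies by \<open>L\<close>. For
  negative \<open>q\<close> the denominator is at most 1, hence the exponent \<open>max q 0\<close>.\<close>

lemma critical_limit:
  assumes n2: "2 \<le> CARD('n)" and q: "q < CARD('n) / (real CARD('n) - 1)"
  shows "(\<lambda>l. (\<integral>\<^sup>+p. ennreal (exp_n CARD('n) (CARD('n) * \<omega> powr (1 / (real CARD('n) - 1)) *
        \<bar>chart_push c0 (bump (real l + 1)) p\<bar> powr (CARD('n) / (real CARD('n) - 1)))
      / (1 + \<bar>chart_push c0 (bump (real l + 1)) p\<bar>) powr q) \<partial>vol) /
    ennreal (Lp_norm CARD('n) vol (chart_push c0 (bump (real l + 1))) ^ CARD('n)))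
    \<longlonglongrightarrow> \<infinity>" (is "(\<lambda>l. ?I l / ennreal (?D l)) \<longlonglongrightarrow> \<infinity>")
proof -
  let ?N = "real CARD('n)"
  obtain T where T: "\<And>t. T \<le> t \<Longrightarrow> exp t / 2 \<le> exp_n CARD('n) t" using exp_n_ge_half_exp by blast
  define q' where "q' = max q 0"
  have q': "q \<le> q'" "0 \<le> q'" by (auto simp: q'_def)
  have N1: "0 < ?N - 1" using n2 by simp
  \<comment> \<open>the power of \<open>L\<close> that is left; it is positive because \<open>q\<close> is subcritical\<close>
  define e where "e = 1 - (1 - 1 / ?N) * q'"
  have "q' < ?N / (?N - 1)" using q N1 by (auto simp: q'_def)
  then have "q' * (?N - 1) < ?N" using N1 by (simp add: pos_less_divide_eq)
  then have e: "0 < e" using N1 by (simp add: e_def field_simps)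
  define k where "k = (1 + \<omega> powr (- (1 / ?N))) powr q'"
  have "0 < 1 + \<omega> powr (- (1 / ?N))" by (simp add: add_pos_nonneg)
  then have k: "0 < k" unfolding k_def by (simp only: powr_gt_zero)
  define D where "D = (1 + C2) * fact CARD('n)"
  have D: "0 < D" using C2 by (simp add: D_def)
  define c3 where "c3 = exp (- (?N * (2 + slack))) / 2 * core_const / k / D"
  have c3: "0 < c3" using core_const_pos k D by (simp add: c3_def)
  have lim: "filterlim (\<lambda>l. c3 * (real l + 1) powr e) at_top sequentially"
    using c3 e by real_asymp
  have "\<forall>\<^sub>F l in sequentially. T \<le> 1 * (?N * (real l + 1) - ?N * (2 + slack))"
  proof -
    have "filterlim (\<lambda>l. 1 * (?N * (real l + 1) - ?N * (2 + slack))) at_top sequentially"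
      using N1 by real_asymp
    then show ?thesis by (simp only: filterlim_at_top)
  qed
  then have "\<forall>\<^sub>F l in sequentially. ennreal (c3 * (real l + 1) powr e) \<le> ?I l / ennreal (?D l)"
  proof eventually_elim
    case (elim l)
    let ?L = "real l + 1"
    have L: "1 \<le> ?L" by simp
    let ?f = "exp (1 * (?N * ?L - ?N * (2 + slack))) / 2 / (1 + height ?L) powr q * (core_const * exp (- (?N * ?L)))"
    have I: "ennreal ?f \<le> ?I l"
      by (rule integral_lower[OF n2 L order_refl _ T elim]) simp
    have Dl: "?D l \<le> D / (?L + slack)"
      using bump_sobolev(3)[OF n2, of ?L] by (simp add: D_def)
    have pos: "0 < D / (?L + slack)" using D slack_ge_1 by simp
    have h: "0 < (1 + height ?L) powr q" using height_pos[OF L] by simp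
    have f: "?f = exp (- (?N * (2 + slack))) / 2 * core_const / (1 + height ?L) powr q"
    proof -
      have "exp (1 * (?N * ?L - ?N * (2 + slack))) * exp (- (?N * ?L)) = exp (- (?N * (2 + slack)))"
        by (simp add: exp_add[symmetric])
      then show ?thesis by (simp add: field_simps)
    qed
    have "c3 * ?L powr e \<le> ?f / (D / (?L + slack))"
    proof -
      have "(1 + height ?L) powr q \<le> k * ?L powr (1 - e)"
        using height_power_le[OF L q'] by (simp add: k_def e_def)
      then have "exp (- (?N * (2 + slack))) / 2 * core_const / (k * ?L powr (1 - e)) \<le> ?f"
        unfolding f using core_const_pos k height_pos[OF L]
        by (intro divide_left_mono mult_pos_pos) auto
      then have "exp (- (?N * (2 + slack))) / 2 * core_const / (k * ?L powr (1 - e)) * (?L / D) \<le> ?f * ((?L + slack) / D)"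
        using D slack_ge_1 core_const_pos h
        by (intro mult_mono divide_right_mono) (auto simp: f)
      moreover have "exp (- (?N * (2 + slack))) / 2 * core_const / (k * ?L powr (1 - e)) * (?L / D) = c3 * ?L powr e"
      proof -
        have "?L / ?L powr (1 - e) = ?L powr 1 / ?L powr (1 - e)" by simp
        also have "\<dots> = ?L powr e" by (simp only: powr_diff[symmetric]) simp
        finally have z: "?L / ?L powr (1 - e) = ?L powr e" .
        have "u / (k * v) * (w / D) = u / k / D * (w / v)" for u v w :: real by (simp add: mult_ac)
        from this[of _ "?L powr (1 - e)" ?L] show ?thesis unfolding z c3_def .
      qed
      ultimately show ?thesis by (simp add: field_simps)
    qed
    then have "ennreal (c3 * ?L powr e) \<le> ennreal (?f / (D / (?L + slack)))" by (rule ennreal_leI)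
    also have "\<dots> = ennreal ?f / ennreal (D / (?L + slack))"
      using pos h core_const_pos by (intro divide_ennreal[symmetric]) auto
    also have "\<dots> \<le> ?I l / ennreal (D / (?L + slack))"
      using I by (rule divide_right_mono_ennreal)
    also have "\<dots> \<le> ?I l / ennreal (?D l)"
      unfolding divide_ennreal_def
      by (intro mult_left_mono ennreal_inverse_antimono ennreal_leI Dl pos) simp
    finally show ?case .
  qed
  with lim show ?thesis by (rule filterlim_imp_tendsto_top)
qed

text \<open>With \<open>\<alpha> = \<theta> * (n * \<omega> powr (1 / (n - 1)))\<close> the exponential over the core exceeds the inverse of the volume of the
  core by the factor \<open>exp ((\<theta> - 1) * n * L)\<close>.\<close>

lemma supercritical_limit:
  assumes n2: "2 \<le> CARD('n)" and \<alpha>: "CARD('n) * \<omega> powr (1 / (real CARD('n) - 1)) < \<alpha>" and q: "0 \<le> q"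
  shows "(\<lambda>l. \<integral>\<^sup>+p. ennreal (exp_n CARD('n) (\<alpha> *
        \<bar>chart_push c0 (bump (real l + 1)) p\<bar> powr (CARD('n) / (real CARD('n) - 1)))
      / (1 + \<bar>chart_push c0 (bump (real l + 1)) p\<bar>) powr q) \<partial>vol)
    \<longlonglongrightarrow> \<infinity>" (is "(\<lambda>l. ?I l) \<longlonglongrightarrow> \<infinity>")
proof -
  let ?N = "real CARD('n)"
  obtain T where T: "\<And>t. T \<le> t \<Longrightarrow> exp t / 2 \<le> exp_n CARD('n) t" using exp_n_ge_half_exp by blast
  define \<theta> where "\<theta> = \<alpha> / (?N * \<omega> powr (1 / (?N - 1)))"
  have "0 < ?N * \<omega> powr (1 / (?N - 1))" using \<omega>_pos by simp
  then have \<theta>: "1 < \<theta>" "\<alpha> = \<theta> * (?N * \<omega> powr (1 / (?N - 1)))"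
    using \<alpha> \<omega>_pos by (auto simp: \<theta>_def)
  have N0: "0 < ?N" by simp
  define b where "b = (1 - 1 / ?N) * q"
  define k where "k = (1 + \<omega> powr (- (1 / ?N))) powr q"
  have "0 < 1 + \<omega> powr (- (1 / ?N))" by (simp add: add_pos_nonneg)
  then have k: "0 < k" unfolding k_def by (simp only: powr_gt_zero)
  define c3 where "c3 = exp (- (\<theta> * (?N * (2 + slack)))) / 2 * core_const / k"
  have c3: "0 < c3" using core_const_pos k by (simp add: c3_def)
  define a where "a = (\<theta> - 1) * ?N"
  have a: "0 < a" using \<theta> by (simp add: a_def)
  have lim: "filterlim (\<lambda>l. c3 * (exp (a * (real l + 1)) / (real l + 1) powr b)) at_top sequentially"
    using c3 a by real_asymp
  have "\<forall>\<^sub>F l in sequentially. T \<le> \<theta> * (?N * (real l + 1) - ?N * (2 + slack))"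
  proof -
    have "filterlim (\<lambda>l. \<theta> * (?N * (real l + 1) - ?N * (2 + slack))) at_top sequentially"
      using N0 \<theta>(1) by real_asymp
    then show ?thesis by (simp only: filterlim_at_top)
  qed
  then have "\<forall>\<^sub>F l in sequentially. ennreal (c3 * (exp (a * (real l + 1)) / (real l + 1) powr b)) \<le> ?I l"
  proof eventually_elim
    case (elim l)
    let ?L = "real l + 1"
    have L: "1 \<le> ?L" by simp
    let ?f = "exp (\<theta> * (?N * ?L - ?N * (2 + slack))) / 2 / (1 + height ?L) powr q * (core_const * exp (- (?N * ?L)))"
    have I: "ennreal ?f \<le> ?I l"
      by (rule integral_lower[OF n2 L less_imp_le[OF \<theta>(1)] \<theta>(2) T elim])
    have h: "0 < (1 + height ?L) powr q" using height_pos[OF L] by simp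
    have f: "?f = exp (- (\<theta> * (?N * (2 + slack)))) / 2 * core_const * exp (a * ?L) / (1 + height ?L) powr q"
    proof -
      have "exp (\<theta> * (?N * ?L - ?N * (2 + slack))) * exp (- (?N * ?L)) =
          exp (- (\<theta> * (?N * (2 + slack)))) * exp (a * ?L)"
        by (simp add: exp_add[symmetric] a_def algebra_simps)
      then show ?thesis by (simp add: field_simps)
    qed
    have "c3 * (exp (a * ?L) / ?L powr b) =
        exp (- (\<theta> * (?N * (2 + slack)))) / 2 * core_const * exp (a * ?L) / (k * ?L powr b)"
      by (simp add: c3_def)
    also have "\<dots> \<le> ?f"
      unfolding f
    proof (intro divide_left_mono)
      show "(1 + height ?L) powr q \<le> k * ?L powr b"
        using height_power_le[OF L order_refl q] by (simp add: k_def b_def)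
      show "0 < k * ?L powr b * (1 + height ?L) powr q" using k h by simp
    qed (use core_const_pos in simp)
    finally have "ennreal (c3 * (exp (a * ?L) / ?L powr b)) \<le> ennreal ?f" by (rule ennreal_leI)
    with I show ?case by (rule order_trans[rotated])
  qed
  with lim show ?thesis by (rule filterlim_imp_tendsto_top)
qed

end

lemma (in riemannian_manifold) adapted_chart_obtain:
  obtains c0 x0 P B \<delta> C1 C2 where "adapted_chart X A g c0 x0 P B \<delta> C1 C2"
proof -
  obtain p c where c: "c \<in> A" "p \<in> chart_dom c" using nonempty cover by blast
  obtain H where "model_space H" "openin (top_of_set H) (chart_img c)"
    using charts[OF c(1)] by (auto simp: is_chart_def)
  then have "interior (chart_img c) \<noteq> {}"
    using chart_interior_nonempty c(2) coord_in by (metis empty_iff)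
  then obtain x0 where "x0 \<in> interior (chart_img c)" by blast
  with adapted_chart_exists[OF c(1)] that show ?thesis by blast
qed

theorem theorem1p6:
  fixes X :: "'a topology"
    and A :: "('a, 'n::finite) chart set"
    and g :: "('a, 'n) chart \<Rightarrow> 'a \<Rightarrow> real^'n^'n"
  defines "n \<equiv> CARD('n)"
    and "\<omega> \<equiv> sphere_volume TYPE('n)"
    and "\<mu> \<equiv> riemannian_volume X A g"
  assumes "riemannian_manifold X A g"
    and "2 \<le> n"
  shows "\<exists>(\<psi> :: nat \<Rightarrow> 'a \<Rightarrow> real) D\<psi>.
    (\<forall>l. \<psi> l \<in> W1n_0 X A g \<and> \<not> (AE p in \<mu>. \<psi> l p = 0) \<and>
         has_W1n_gradient X A g (\<psi> l) (D\<psi> l) \<and>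
         Lp_norm n \<mu> (vf_norm A g (D\<psi> l)) \<le> 1) \<and>
    (\<forall>q::real. q < n / (real n - 1) \<longrightarrow>
       (\<lambda>l. (\<integral>\<^sup>+p. ennreal
                (exp_n n (n * \<omega> powr (1 / (real n - 1)) * \<bar>\<psi> l p\<bar> powr (n / (real n - 1)))
                  / (1 + \<bar>\<psi> l p\<bar>) powr q) \<partial>\<mu>)
             / ennreal (Lp_norm n \<mu> (\<psi> l) ^ n)) \<longlonglongrightarrow> \<infinity>) \<and>
    (\<forall>\<alpha>::real. \<forall>q::real. n * \<omega> powr (1 / (real n - 1)) < \<alpha> \<and> 0 \<le> q \<longrightarrow>
       (\<lambda>l. \<integral>\<^sup>+p. ennreal
                (exp_n n (\<alpha> * \<bar>\<psi> l p\<bar> powr (n / (real n - 1)))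
                  / (1 + \<bar>\<psi> l p\<bar>) powr q) \<partial>\<mu>) \<longlonglongrightarrow> \<infinity>)"
proof -
  interpret riemannian_manifold X A g by fact
  obtain c0 x0 P B \<delta> C1 C2 where "adapted_chart X A g c0 x0 P B \<delta> C1 C2"
    by (rule adapted_chart_obtain)
  then interpret M: adapted_chart X A g c0 x0 P B \<delta> C1 C2 .
  have n2: "2 \<le> CARD('n)" using \<open>2 \<le> n\<close> by (simp add: n_def)
  have \<omega>: "\<omega> = M.\<omega>" unfolding \<omega>_def sphere_volume_eq[OF n2] M.\<omega>_def ..
  define \<psi> where "\<psi> l = chart_push c0 (M.bump (real l + 1))" for l :: nat
  have "\<forall>l. \<exists>D. has_W1n_gradient X A g (\<psi> l) D \<and> Lp_norm n \<mu> (vf_norm A g D) \<le> 1"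
    unfolding \<psi>_def n_def \<mu>_def using M.bump_sobolev(2)[OF n2] by simp
  then obtain D\<psi> where D: "\<And>l. has_W1n_gradient X A g (\<psi> l) (D\<psi> l)"
    "\<And>l. Lp_norm n \<mu> (vf_norm A g (D\<psi> l)) \<le> 1" by metis
  have W: "\<psi> l \<in> W1n_0 X A g" for l
    unfolding \<psi>_def by (rule M.bump_sobolev(1)[OF n2]) simp
  have nz: "\<not> (AE p in \<mu>. \<psi> l p = 0)" for l
    unfolding \<psi>_def \<mu>_def by (rule M.bump_nonzero) simp
  show ?thesis
    by (intro exI[of _ \<psi>] exI[of _ D\<psi>] conjI allI impI W nz D)
      (use M.critical_limit[OF n2] M.supercritical_limit[OF n2] in
        \<open>auto simp: \<psi>_def n_def \<mu>_def \<omega>\<close>)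
qed

end
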